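(* Let $(M,\nabla)$ be an affine manifold of dimension $n\ge 2$, i.e. a smooth $n$-dimensional manifold $M$ with a torsion free connection $\nabla$ on $TM$. Let $\Phi\in C^\infty(S^2(T^*M))$ be a symmetric $(0,2)$-tensor field on $M$ and let $c\in\mathbb{R}$, $c\neq 0$. Then the modified Riemannian extension $g_{\nabla,\Phi,c}$ on the cotangent bundle $T^*M$ is Einstein if and only if $$\Phi=\frac{4}{c(n-1)}\,\rho^{\nabla,s},$$ where $\rho^{\nabla,s}$ is the symmetric part of the Ricci tensor of $\nabla$.
   Context: The curvature operator of $\nabla$ is $R^\nabla(X,Y)=\nabla_X\nabla_Y-\nabla_Y\nabla_X-\nabla_{[X,Y]}$; the Ricci tensor is $\rho^\nabla(X,Y)=\operatorname{Tr}\{Z\mapsto R^\nabla(Z,X)Y\}$ (not necessarily symmetric); its symmetric part is $\rho^{\nabla,s}(X,Y)=\frac12\{\rho^\nabla(X,Y)+\rho^\nabla(Y,X)\}$. Symmetric product of 1-forms: $\xi_1\circ\xi_2=\frac12(\xi_1\otimes\xi_2+\xi_2\otimes\xi_1)$. Local coordinates $(x_i)$ on $M$ induce coordinates $(x_i,x_{i'})$ on $T^*M$ by writing a covector as $\omega=\sum_i x_{i'}dx^i$. Let $\pi:T^*M\to M$ be the projection and write $\nabla_{\partial_i}\partial_j=\Gamma^\nabla_{ij}{}^k\partial_k$. The modified Riemannian extension $g_{\nabla,\Phi,c}$ is the pseudo-Riemannian metric of neutral signature $(n,n)$ on $T^*M$ given in such local coordinates (sum over repeated indices) by $$g_{\nabla,\Phi,c}=2\,dx^i\circ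 dx^{i'}+\{c\,x_{i'}x_{j'}+\Phi_{ij}(x)-2x_{k'}\Gamma^\nabla_{ij}{}^k\}\,dx^i\circ dx^j .$$ This is globally well defined: $g_{\nabla,\Phi,c}=c\cdot\iota\operatorname{id}\circ\iota\operatorname{id}+g_\nabla+\pi^*\Phi$, where $\iota\operatorname{id}=\sum_i x_{i'}dx^i$ is the tautological 1-form and $g_\nabla=2\,dx^i\circ dx^{i'}-2x_{k'}\Gamma^\nabla_{ij}{}^k\,dx^i\circ dx^j$ is the Riemannian extension of $\nabla$. A pseudo-Riemannian metric $g$ on a manifold of dimension $2n$ is Einstein if its Ricci tensor equals $\frac{\tau^g}{2n}g$, with $\tau^g$ the scalar curvature. *)

theory Defs
  imports "HOL-Analysis.Analysis"
begin

section \<open>Smooth functions on open subsets of Euclidean space\<close>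

text \<open>Meaningful for open \<open>S\<close> only. A function is \<open>C\<^sup>k\<^sup>+\<^sup>1\<close> if it is (Frechet) differentiable with all
  directional derivatives \<open>C\<^sup>k\<close>.\<close>

primrec Ck_on :: "nat \<Rightarrow> 'a::real_normed_vector set \<Rightarrow> ('a \<Rightarrow> 'b::real_normed_vector) \<Rightarrow> bool" where
  "Ck_on 0 S f \<longleftrightarrow> continuous_on S f"
| "Ck_on (Suc k) S f \<longleftrightarrow>
     (\<forall>x\<in>S. f differentiable (at x)) \<and>
     (\<forall>v. Ck_on k S (\<lambda>x. frechet_derivative f (at x) v))"

definition smooth_on :: "'a::real_normed_vector set \<Rightarrow> ('a \<Rightarrow> 'b::real_normed_vector) \<Rightarrow> bool" where
  "smooth_on S f \<longleftrightarrow> (\<forall>k. Ck_on k S f)"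


section \<open>Smooth manifolds\<close>

text \<open>A chart is a pair \<open>(U, \<phi>)\<close> of a domain and a coordinate map; values of \<open>\<phi>\<close> outside \<open>U\<close>
  are irrelevant. A smooth manifold is presented by an atlas \<open>A\<close>, which need not be maximal. The
  underlying set is the union of the chart domains and the topology is the one for which the charts
  are homeomorphisms onto open sets. The dimension is \<open>CARD('n)\<close>.\<close>

type_synonym ('m, 'n) chart = "'m set \<times> ('m \<Rightarrow> real ^ 'n)"

definition carrier :: "('m, 'n::finite) chart set \<Rightarrow> 'm set" where
  "carrier A = (\<Union>(U, \<phi>)\<in>A. U)"

definition mtop :: "('m, 'n::finite) chart set \<Rightarrow> 'm topology" where
  "mtop A = topology (\<lambda>W. W \<subseteq> carrier A \<and> (\<forall>(U, \<phi>)\<in>A. open (\<phi> ` (W \<inter> U))))"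

definition smooth_manifold :: "('m, 'n::finite) chart set \<Rightarrow> bool" where
  "smooth_manifold A \<longleftrightarrow>
     (\<forall>(U, \<phi>)\<in>A. inj_on \<phi> U \<and> open (\<phi> ` U)) \<and>
     (\<forall>(U, \<phi>)\<in>A. \<forall>(V, \<psi>)\<in>A.
        open (\<phi> ` (U \<inter> V)) \<and> smooth_on (\<phi> ` (U \<inter> V)) (\<lambda>x. \<psi> (inv_into U \<phi> x))) \<and>
     Hausdorff_space (mtop A) \<and> second_countable (mtop A)"

definition smooth_fun :: "('m, 'n::finite) chart set \<Rightarrow> 'm set \<Rightarrow> ('m \<Rightarrow> real) \<Rightarrow> bool" where
  "smooth_fun A W f \<longleftrightarrow>
     openin (mtop A) W \<and> (\<forall>(U, \<phi>)\<in>A. smooth_on (\<phi> ` (W \<inter> U)) (\<lambda>x. f (inv_into U \<phi> x)))"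

definition smooth_at :: "('m, 'n::finite) chart set \<Rightarrow> 'm \<Rightarrow> ('m \<Rightarrow> real) \<Rightarrow> bool" where
  "smooth_at A p f \<longleftrightarrow> (\<exists>W. p \<in> W \<and> smooth_fun A W f)"

definition chart_at :: "('m, 'n::finite) chart set \<Rightarrow> 'm \<Rightarrow> ('m, 'n) chart" where
  "chart_at A p = (SOME c. c \<in> A \<and> p \<in> fst c)"


section \<open>Tangent vectors and vector fields\<close>

text \<open>A tangent vector at \<open>p\<close> is a directional derivative operator on the functions that are smooth
  near \<open>p\<close>. It is extended by \<open>0\<close> to the remaining functions, so that equality of tangent vectors is
  equality of HOL functions; vector operations are pointwise.\<close>

type_synonym 'm tvec = "('m \<Rightarrow> real) \<Rightarrow> real"

definition coord_deriv :: "('m, 'n::finite) chart set \<Rightarrow> ('m, 'n) chart \<Rightarrow> 'm \<Rightarrow> real ^ 'n \<Rightarrow> 'm tvec" where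
  "coord_deriv A c p w = (\<lambda>f. if smooth_at A p f
     then frechet_derivative (\<lambda>x. f (inv_into (fst c) (snd c) x)) (at (snd c p)) w else 0)"

definition tangent_space :: "('m, 'n::finite) chart set \<Rightarrow> 'm \<Rightarrow> 'm tvec set" where
  "tangent_space A p = {coord_deriv A c p w | c w. c \<in> A \<and> p \<in> fst c}"

text \<open>The coordinate vector field \<open>\<partial>\<^sub>i\<close> and the coordinate differential \<open>dx\<^sup>k\<close>.\<close>

definition coord_vec :: "('m, 'n::finite) chart set \<Rightarrow> ('m, 'n) chart \<Rightarrow> 'n \<Rightarrow> 'm \<Rightarrow> 'm tvec" where
  "coord_vec A c i p = coord_deriv A c p (axis i 1)"

definition coord_diff :: "('m, 'n::finite) chart \<Rightarrow> 'n \<Rightarrow> 'm tvec \<Rightarrow> real" where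
  "coord_diff c k v = v (\<lambda>q. snd c q $ k)"

definition vector_field :: "('m, 'n::finite) chart set \<Rightarrow> 'm set \<Rightarrow> ('m \<Rightarrow> 'm tvec) \<Rightarrow> bool" where
  "vector_field A U X \<longleftrightarrow>
     openin (mtop A) U \<and> (\<forall>p\<in>U. X p \<in> tangent_space A p) \<and>
     (\<forall>V f. V \<subseteq> U \<and> smooth_fun A V f \<longrightarrow> smooth_fun A V (\<lambda>q. X q f))"

definition lie_bracket ::
  "('m, 'n::finite) chart set \<Rightarrow> ('m \<Rightarrow> 'm tvec) \<Rightarrow> ('m \<Rightarrow> 'm tvec) \<Rightarrow> 'm \<Rightarrow> 'm tvec" where
  "lie_bracket A X Y p =
     (\<lambda>f. if smooth_at A p f then X p (\<lambda>q. Y q f) - Y p (\<lambda>q. X q f) else 0)"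

text \<open>Trace of an endomorphism \<open>L\<close> of the tangent space at \<open>p\<close>, computed in a coordinate basis.\<close>

definition tangent_trace :: "('m, 'n::finite) chart set \<Rightarrow> 'm \<Rightarrow> ('m tvec \<Rightarrow> 'm tvec) \<Rightarrow> real" where
  "tangent_trace A p L = (let c = chart_at A p in
     trace ((\<chi> i j. coord_diff c i (L (coord_vec A c j p))) :: real ^ 'n ^ 'n))"


section \<open>Affine connections and curvature\<close>

text \<open>Connections act on vector fields defined on arbitrary open sets \<open>U\<close>; the second clause says that
  \<open>D X Y\<close> on \<open>U\<close> depends only on \<open>X\<close> and \<open>Y\<close> on \<open>U\<close>, which makes the operators on the
  various open sets compatible with restriction.\<close>

definition connection ::
  "('m, 'n::finite) chart set \<Rightarrow> (('m \<Rightarrow> 'm tvec) \<Rightarrow> ('m \<Rightarrow> 'm tvec) \<Rightarrow> 'm \<Rightarrow> 'm tvec) \<Rightarrow> bool" where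
  "connection A D \<longleftrightarrow>
     (\<forall>U X Y. vector_field A U X \<and> vector_field A U Y \<longrightarrow> vector_field A U (D X Y)) \<and>
     (\<forall>U X X' Y Y'. vector_field A U X \<and> vector_field A U X' \<and>
        vector_field A U Y \<and> vector_field A U Y' \<and> (\<forall>p\<in>U. X p = X' p \<and> Y p = Y' p) \<longrightarrow>
        (\<forall>p\<in>U. D X Y p = D X' Y' p)) \<and>
     (\<forall>U X X' Y. vector_field A U X \<and> vector_field A U X' \<and> vector_field A U Y \<longrightarrow>
        (\<forall>p\<in>U. D (\<lambda>q f. X q f + X' q f) Y p = (\<lambda>f. D X Y p f + D X' Y p f))) \<and>
     (\<forall>U h X Y. smooth_fun A U h \<and> vector_field A U X \<and> vector_field A U Y \<longrightarrow>
        (\<forall>p\<in>U. D (\<lambda>q f. h q * X q f) Y p = (\<lambda>f. h p * D X Y p f))) \<and>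
     (\<forall>U X Y Y'. vector_field A U X \<and> vector_field A U Y \<and> vector_field A U Y' \<longrightarrow>
        (\<forall>p\<in>U. D X (\<lambda>q f. Y q f + Y' q f) p = (\<lambda>f. D X Y p f + D X Y' p f))) \<and>
     (\<forall>U h X Y. smooth_fun A U h \<and> vector_field A U X \<and> vector_field A U Y \<longrightarrow>
        (\<forall>p\<in>U. D X (\<lambda>q f. h q * Y q f) p = (\<lambda>f. X p h * Y p f + h p * D X Y p f)))"

definition torsion_free ::
  "('m, 'n::finite) chart set \<Rightarrow> (('m \<Rightarrow> 'm tvec) \<Rightarrow> ('m \<Rightarrow> 'm tvec) \<Rightarrow> 'm \<Rightarrow> 'm tvec) \<Rightarrow> bool" where
  "torsion_free A D \<longleftrightarrow>
     (\<forall>U X Y. vector_field A U X \<and> vector_field A U Y \<longrightarrow>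
        (\<forall>p\<in>U. (\<lambda>f. D X Y p f - D Y X p f) = lie_bracket A X Y p))"

definition affine_manifold ::
  "('m, 'n::finite) chart set \<Rightarrow> (('m \<Rightarrow> 'm tvec) \<Rightarrow> ('m \<Rightarrow> 'm tvec) \<Rightarrow> 'm \<Rightarrow> 'm tvec) \<Rightarrow> bool" where
  "affine_manifold A D \<longleftrightarrow> smooth_manifold A \<and> connection A D \<and> torsion_free A D"

definition christoffel ::
  "('m, 'n::finite) chart set \<Rightarrow> (('m \<Rightarrow> 'm tvec) \<Rightarrow> ('m \<Rightarrow> 'm tvec) \<Rightarrow> 'm \<Rightarrow> 'm tvec)
    \<Rightarrow> ('m, 'n) chart \<Rightarrow> 'n \<Rightarrow> 'n \<Rightarrow> 'n \<Rightarrow> 'm \<Rightarrow> real" where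
  "christoffel A D c i j k p = coord_diff c k (D (coord_vec A c i) (coord_vec A c j) p)"

definition curvature ::
  "('m, 'n::finite) chart set \<Rightarrow> (('m \<Rightarrow> 'm tvec) \<Rightarrow> ('m \<Rightarrow> 'm tvec) \<Rightarrow> 'm \<Rightarrow> 'm tvec)
    \<Rightarrow> ('m \<Rightarrow> 'm tvec) \<Rightarrow> ('m \<Rightarrow> 'm tvec) \<Rightarrow> ('m \<Rightarrow> 'm tvec) \<Rightarrow> 'm \<Rightarrow> 'm tvec" where
  "curvature A D X Y Z p =
     (\<lambda>f. D X (D Y Z) p f - D Y (D X Z) p f - D (lie_bracket A X Y) Z p f)"

text \<open>The curvature is tensorial, so its value on tangent vectors at \<open>p\<close> is obtained from any
  extensions to vector fields near \<open>p\<close>.\<close>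

definition local_extension :: "('m, 'n::finite) chart set \<Rightarrow> 'm \<Rightarrow> 'm tvec \<Rightarrow> 'm \<Rightarrow> 'm tvec" where
  "local_extension A p v = (SOME X. X p = v \<and> (\<exists>U. p \<in> U \<and> vector_field A U X))"

definition curvature_at ::
  "('m, 'n::finite) chart set \<Rightarrow> (('m \<Rightarrow> 'm tvec) \<Rightarrow> ('m \<Rightarrow> 'm tvec) \<Rightarrow> 'm \<Rightarrow> 'm tvec)
    \<Rightarrow> 'm \<Rightarrow> 'm tvec \<Rightarrow> 'm tvec \<Rightarrow> 'm tvec \<Rightarrow> 'm tvec" where
  "curvature_at A D p x y z =
     curvature A D (local_extension A p x) (local_extension A p y) (local_extension A p z) p"

definition ricci ::
  "('m, 'n::finite) chart set \<Rightarrow> (('m \<Rightarrow> 'm tvec) \<Rightarrow> ('m \<Rightarrow> 'm tvec) \<Rightarrow> 'm \<Rightarrow> 'm tvec)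
    \<Rightarrow> 'm \<Rightarrow> 'm tvec \<Rightarrow> 'm tvec \<Rightarrow> real" where
  "ricci A D p x y = tangent_trace A p (\<lambda>z. curvature_at A D p z x y)"

definition ricci_sym ::
  "('m, 'n::finite) chart set \<Rightarrow> (('m \<Rightarrow> 'm tvec) \<Rightarrow> ('m \<Rightarrow> 'm tvec) \<Rightarrow> 'm \<Rightarrow> 'm tvec)
    \<Rightarrow> 'm \<Rightarrow> 'm tvec \<Rightarrow> 'm tvec \<Rightarrow> real" where
  "ricci_sym A D p x y = (ricci A D p x y + ricci A D p y x) / 2"


section \<open>Symmetric tensor fields and Einstein metrics\<close>

definition symmetric_tensor_field ::
  "('m, 'n::finite) chart set \<Rightarrow> ('m \<Rightarrow> 'm tvec \<Rightarrow> 'm tvec \<Rightarrow> real) \<Rightarrow> bool" where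
  "symmetric_tensor_field A \<Phi> \<longleftrightarrow>
     (\<forall>p\<in>carrier A. \<forall>u\<in>tangent_space A p. \<forall>u'\<in>tangent_space A p. \<forall>v\<in>tangent_space A p. \<forall>a.
        \<Phi> p (\<lambda>f. u f + u' f) v = \<Phi> p u v + \<Phi> p u' v \<and>
        \<Phi> p (\<lambda>f. a * u f) v = a * \<Phi> p u v \<and>
        \<Phi> p u v = \<Phi> p v u) \<and>
     (\<forall>U X Y. vector_field A U X \<and> vector_field A U Y \<longrightarrow> smooth_fun A U (\<lambda>p. \<Phi> p (X p) (Y p)))"

definition pseudo_riemannian_metric ::
  "('m, 'n::finite) chart set \<Rightarrow> ('m \<Rightarrow> 'm tvec \<Rightarrow> 'm tvec \<Rightarrow> real) \<Rightarrow> bool" where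
  "pseudo_riemannian_metric A g \<longleftrightarrow>
     symmetric_tensor_field A g \<and>
     (\<forall>p\<in>carrier A. \<forall>u\<in>tangent_space A p. (\<forall>v\<in>tangent_space A p. g p u v = 0) \<longrightarrow> u = (\<lambda>f. 0))"

definition is_levi_civita ::
  "('m, 'n::finite) chart set \<Rightarrow> ('m \<Rightarrow> 'm tvec \<Rightarrow> 'm tvec \<Rightarrow> real)
    \<Rightarrow> (('m \<Rightarrow> 'm tvec) \<Rightarrow> ('m \<Rightarrow> 'm tvec) \<Rightarrow> 'm \<Rightarrow> 'm tvec) \<Rightarrow> bool" where
  "is_levi_civita A g D \<longleftrightarrow>
     connection A D \<and> torsion_free A D \<and>
     (\<forall>U X Y Z. vector_field A U X \<and> vector_field A U Y \<and> vector_field A U Z \<longrightarrow>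
        (\<forall>p\<in>U. X p (\<lambda>q. g q (Y q) (Z q)) = g p (D X Y p) (Z p) + g p (Y p) (D X Z p)))"

text \<open>Unique on smooth vector fields, but not as a HOL function; hence \<open>SOME\<close> rather than \<open>THE\<close>.\<close>

definition levi_civita ::
  "('m, 'n::finite) chart set \<Rightarrow> ('m \<Rightarrow> 'm tvec \<Rightarrow> 'm tvec \<Rightarrow> real)
    \<Rightarrow> ('m \<Rightarrow> 'm tvec) \<Rightarrow> ('m \<Rightarrow> 'm tvec) \<Rightarrow> 'm \<Rightarrow> 'm tvec" where
  "levi_civita A g = (SOME D. is_levi_civita A g D)"

definition metric_ricci ::
  "('m, 'n::finite) chart set \<Rightarrow> ('m \<Rightarrow> 'm tvec \<Rightarrow> 'm tvec \<Rightarrow> real)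
    \<Rightarrow> 'm \<Rightarrow> 'm tvec \<Rightarrow> 'm tvec \<Rightarrow> real" where
  "metric_ricci A g = ricci A (levi_civita A g)"

text \<open>The scalar curvature \<open>g\<^sup>a\<^sup>b Ric\<^sub>a\<^sub>b\<close>.\<close>

definition scalar_curvature ::
  "('m, 'n::finite) chart set \<Rightarrow> ('m \<Rightarrow> 'm tvec \<Rightarrow> 'm tvec \<Rightarrow> real) \<Rightarrow> 'm \<Rightarrow> real" where
  "scalar_curvature A g p = (let c = chart_at A p;
       G = ((\<chi> a b. g p (coord_vec A c a p) (coord_vec A c b p)) :: real ^ 'n ^ 'n)
     in \<Sum>a\<in>UNIV. \<Sum>b\<in>UNIV. matrix_inv G $ a $ b * metric_ricci A g p (coord_vec A c a p) (coord_vec A c b p))"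

definition einstein ::
  "('m, 'n::finite) chart set \<Rightarrow> ('m \<Rightarrow> 'm tvec \<Rightarrow> 'm tvec \<Rightarrow> real) \<Rightarrow> bool" where
  "einstein A g \<longleftrightarrow>
     pseudo_riemannian_metric A g \<and>
     (\<forall>p\<in>carrier A. \<forall>u\<in>tangent_space A p. \<forall>v\<in>tangent_space A p.
        metric_ricci A g p u v = scalar_curvature A g p / real CARD('n) * g p u v)"


section \<open>The cotangent bundle and the modified Riemannian extension\<close>

text \<open>Covectors at \<open>p\<close> are linear forms on the tangent space at \<open>p\<close>, extended by \<open>0\<close> outside it.\<close>

type_synonym 'm covec = "'m tvec \<Rightarrow> real"

definition cotangent_space :: "('m, 'n::finite) chart set \<Rightarrow> 'm \<Rightarrow> 'm covec set" where
  "cotangent_space A p = {\<omega>.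
     (\<forall>u\<in>tangent_space A p. \<forall>v\<in>tangent_space A p. \<omega> (\<lambda>f. u f + v f) = \<omega> u + \<omega> v) \<and>
     (\<forall>u\<in>tangent_space A p. \<forall>a. \<omega> (\<lambda>f. a * u f) = a * \<omega> u) \<and>
     (\<forall>u. u \<notin> tangent_space A p \<longrightarrow> \<omega> u = 0)}"

text \<open>The coordinates \<open>(x\<^sub>i, x\<^sub>i\<^sub>')\<close> induced by \<open>(x\<^sub>i)\<close>: the index \<open>i\<close> is \<open>Inl i\<close>, the index \<open>i'\<close> is
  \<open>Inr i\<close>, and \<open>x\<^sub>i\<^sub>'\<close> of a covector \<open>\<omega> = \<Sum>\<^sub>i x\<^sub>i\<^sub>' dx\<^sup>i\<close> is \<open>\<omega>(\<partial>\<^sub>i)\<close>.\<close>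

definition cotangent_chart ::
  "('m, 'n::finite) chart set \<Rightarrow> ('m, 'n) chart \<Rightarrow> ('m \<times> 'm covec, 'n + 'n) chart" where
  "cotangent_chart A c =
     ({(p, \<omega>). p \<in> fst c \<and> \<omega> \<in> cotangent_space A p},
      \<lambda>(p, \<omega>). \<chi> k. case k of Inl i \<Rightarrow> snd c p $ i | Inr i \<Rightarrow> \<omega> (coord_vec A c i p))"

definition cotangent_atlas ::
  "('m, 'n::finite) chart set \<Rightarrow> ('m \<times> 'm covec, 'n + 'n) chart set" where
  "cotangent_atlas A = cotangent_chart A ` A"

definition sym_prod :: "('v \<Rightarrow> real) \<Rightarrow> ('v \<Rightarrow> real) \<Rightarrow> 'v \<Rightarrow> 'v \<Rightarrow> real" where
  "sym_prod \<alpha> \<beta> = (\<lambda>\<xi> \<eta>. (\<alpha> \<xi> * \<beta> \<eta> + \<beta> \<xi> * \<alpha> \<eta>) / 2)"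

text \<open>The coordinate formula defining the metric, in the coordinates induced by a chart \<open>c\<close> of the
  base, and the resulting tensor field; the formula does not depend on the chart around the base point.\<close>

definition mre_in_chart ::
  "('m, 'n::finite) chart set \<Rightarrow> (('m \<Rightarrow> 'm tvec) \<Rightarrow> ('m \<Rightarrow> 'm tvec) \<Rightarrow> 'm \<Rightarrow> 'm tvec)
    \<Rightarrow> ('m \<Rightarrow> 'm tvec \<Rightarrow> 'm tvec \<Rightarrow> real) \<Rightarrow> real \<Rightarrow> ('m, 'n) chart
    \<Rightarrow> 'm \<times> 'm covec \<Rightarrow> ('m \<times> 'm covec) tvec \<Rightarrow> ('m \<times> 'm covec) tvec \<Rightarrow> real" where
  "mre_in_chart A D \<Phi> c ch P \<xi> \<eta> =
     (let p = fst P;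
          x' = (\<lambda>i. snd (cotangent_chart A ch) P $ Inr i);
          dx = (\<lambda>i. coord_diff (cotangent_chart A ch) (Inl i));
          dx' = (\<lambda>i. coord_diff (cotangent_chart A ch) (Inr i))
      in 2 * (\<Sum>i\<in>UNIV. sym_prod (dx i) (dx' i) \<xi> \<eta>) +
         (\<Sum>i\<in>UNIV. \<Sum>j\<in>UNIV.
            (c * x' i * x' j + \<Phi> p (coord_vec A ch i p) (coord_vec A ch j p)
              - 2 * (\<Sum>k\<in>UNIV. x' k * christoffel A D ch i j k p))
            * sym_prod (dx i) (dx j) \<xi> \<eta>))"

definition modified_riemannian_extension ::
  "('m, 'n::finite) chart set \<Rightarrow> (('m \<Rightarrow> 'm tvec) \<Rightarrow> ('m \<Rightarrow> 'm tvec) \<Rightarrow> 'm \<Rightarrow> 'm tvec)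
    \<Rightarrow> ('m \<Rightarrow> 'm tvec \<Rightarrow> 'm tvec \<Rightarrow> real) \<Rightarrow> real
    \<Rightarrow> 'm \<times> 'm covec \<Rightarrow> ('m \<times> 'm covec) tvec \<Rightarrow> ('m \<times> 'm covec) tvec \<Rightarrow> real" where
  "modified_riemannian_extension A D \<Phi> c P = mre_in_chart A D \<Phi> c (chart_at A (fst P)) P"

end

theory Submission
  imports Defs
begin

text \<open>
  Write \<open>y\<^sub>i\<close> for \<open>x\<^sub>i\<^sub>'\<close>. In the coordinates induced by a chart the metric has the block matrix
  \<open>[[B, I], [I, 0]]\<close> with \<open>B\<^sub>i\<^sub>j = c y\<^sub>i y\<^sub>j + \<Phi>\<^sub>i\<^sub>j - 2 y\<^sub>k \<Gamma>\<^sub>i\<^sub>j\<^sup>k\<close> and the inverse \<open>[[0, I], [I, -B]]\<close>.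
  The determinant is constant, so the traces \<open>\<Gamma>\<^sub>a\<^sub>b\<^sup>b\<close> of its Christoffel symbols vanish and
  \<open>Ric\<^sub>a\<^sub>b = \<partial>\<^sub>l \<Gamma>\<^sub>a\<^sub>b\<^sup>l - \<Gamma>\<^sub>l\<^sub>b\<^sup>m \<Gamma>\<^sub>a\<^sub>m\<^sup>l\<close>. As \<open>B\<close> is quadratic in the fibre coordinates, this can be evaluated by hand:
  with \<open>\<lambda> = c (n + 1) / 2\<close>, the tensor \<open>Ric - \<lambda> g\<close> has only the components
  \<open>\<rho>\<^sub>i\<^sub>j + \<rho>\<^sub>j\<^sub>i - c (n - 1) / 2 \<Phi>\<^sub>i\<^sub>j\<close> in the base directions. Its trace is \<open>0\<close>, since \<open>g\<^sup>i\<^sup>j = 0\<close>, so \<open>\<lambda> = \<tau> / 2n\<close>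
  for every \<open>\<Phi>\<close>, and the metric is Einstein iff these components vanish.

  All computations are done with tangent vectors as derivations. The Levi-Civita connection is given
  on each chart by the Christoffel formula; its uniqueness on overlaps glues these
  connections together.
\<close>

section \<open>Calculus of smooth functions\<close>

text \<open>Origin of the constants: the mixed components of Ric force the multiple \<lambda> = c (n
  + 1) / 2. In the base directions \<Phi> enters Ric only through a term c B, produced when fibre
  derivatives of the Christoffel symbols meet the block -B of the inverse metric, whereas \<lambda>
  g contains \<lambda> \<Phi>. The excess is c - \<lambda> = - c (n - 1) / 2. The rest of Ric in
  these directions is \<lambda> (B - \<Phi>) plus twice the symmetrised Ricci tensor of the base,
  which gives the factor 4 / (c (n - 1)). The obstacle is that the chart at a point, the extension
  of a tangent vector and the Levi-Civita connection are all picked by \<open>SOME\<close>. Traces,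
  curvature and the metric itself therefore become computable only after it is shown that their
  coordinate expressions agree in every chart around the point, whatever was picked.\<close>

lemma has_derivative_frechet:
  "f differentiable (at x) \<Longrightarrow> (f has_derivative frechet_derivative f (at x)) (at x)"
  by (simp add: frechet_derivative_works)

lemma frechet_derivative_eqI:
  "(f has_derivative f') (at x) \<Longrightarrow> frechet_derivative f (at x) = f'"
  by (metis frechet_derivative_at)

lemma differentiable_cong_open:
  assumes "open S" "x \<in> S" "\<And>y. y \<in> S \<Longrightarrow> f y = g y" "f differentiable (at x)"
  shows "g differentiable (at x)" "frechet_derivative g (at x) = frechet_derivative f (at x)"
proof -
  have "(g has_derivative frechet_derivative f (at x)) (at x)"
    using has_derivative_transform_within_open[OF has_derivative_frechet[OF assms(4)] assms(1,2,3)] by auto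
  then show "g differentiable (at x)" "frechet_derivative g (at x) = frechet_derivative f (at x)"
    by (auto simp: differentiable_def frechet_derivative_eqI)
qed

lemma Ck_on_cong:
  assumes "open S" "\<And>x. x \<in> S \<Longrightarrow> f x = g x" "Ck_on k S f"
  shows "Ck_on k S g"
  using assms(2,3)
proof (induction k arbitrary: f g)
  case 0
  then show ?case by (metis Ck_on.simps(1) continuous_on_cong)
next
  case (Suc k)
  note d = differentiable_cong_open[OF assms(1) _ Suc.prems(1)]
  have "Ck_on k S (\<lambda>x. frechet_derivative g (at x) v)" for v
    by (rule Suc.IH[of "\<lambda>x. frechet_derivative f (at x) v"]) (use Suc.prems(2) d(2) in auto)
  then show ?case
    using Suc.prems(2) d(1) by auto
qed

text \<open>The recursion of \<open>Ck_on\<close> lowers the order by differentiating and does not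
  say that the orders are nested. Nesting rests on the base case, where differentiability gives
  continuity.\<close>

lemma Ck_on_SucD: "Ck_on (Suc k) S f \<Longrightarrow> Ck_on k S f"
proof (induction k arbitrary: f)
  case 0
  then show ?case
    by (auto intro!: continuous_at_imp_continuous_on differentiable_imp_continuous_within)
next
  case (Suc k)
  have "f differentiable (at x)" if "x \<in> S" for x
    using Suc.prems that by auto
  moreover have "Ck_on k S (\<lambda>x. frechet_derivative f (at x) v)" for v
    using Suc.IH[of "\<lambda>x. frechet_derivative f (at x) v"] Suc.prems unfolding Ck_on.simps(2)[of "Suc k"] by blast
  ultimately show ?case
    unfolding Ck_on.simps(2)[of k] by blast
qed

lemma Ck_on_subset: "Ck_on k S f \<Longrightarrow> T \<subseteq> S \<Longrightarrow> Ck_on k T f"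
  by (induction k arbitrary: f) (auto intro: continuous_on_subset)

text \<open>Every level of the recursion is a condition at single points. Openness of
  \<open>T\<close> turns continuity on \<open>T\<close> into continuity at the point.\<close>

lemma Ck_on_local:
  assumes "\<And>x. x \<in> S \<Longrightarrow> \<exists>T. open T \<and> x \<in> T \<and> Ck_on k T f"
  shows "Ck_on k S f"
  using assms
proof (induction k arbitrary: f)
  case 0
  then show ?case
    by (metis Ck_on.simps(1) continuous_at_imp_continuous_on continuous_on_eq_continuous_at)
next
  case (Suc k)
  show ?case
    unfolding Ck_on.simps
  proof safe
    fix x assume "x \<in> S" then show "f differentiable (at x)"
      using Suc.prems by (meson Ck_on.simps(2))
  next
    fix v show "Ck_on k S (\<lambda>x. frechet_derivative f (at x) v)"
    proof (rule Suc.IH)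
      fix x assume "x \<in> S"
      then obtain T where "open T" "x \<in> T" "Ck_on (Suc k) T f" using Suc.prems by blast
      then show "\<exists>T. open T \<and> x \<in> T \<and> Ck_on k T (\<lambda>x. frechet_derivative f (at x) v)"
        unfolding Ck_on.simps by blast
    qed
  qed
qed

lemma Ck_on_const: "Ck_on k S (\<lambda>x. a)"
  by (induction k arbitrary: a) auto

text \<open>In a fixed direction the derivative of a linear map is constant, so a case distinction
  on the order replaces induction.\<close>

lemma Ck_on_linear: "bounded_linear L \<Longrightarrow> Ck_on k S L"
  by (cases k)
    (auto simp: Ck_on_const frechet_derivative_eqI[OF bounded_linear_imp_has_derivative]
      bounded_linear_imp_differentiable linear_continuous_on)

lemma Ck_on_bounded_linear:
  assumes "bounded_linear L" "open S" "Ck_on k S f"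
  shows "Ck_on k S (\<lambda>x. L (f x))"
  using assms(3)
proof (induction k arbitrary: f)
  case 0
  then show ?case
    by (simp add: bounded_linear.continuous_on[OF assms(1)])
next
  case (Suc k)
  have d: "((\<lambda>x. L (f x)) has_derivative (\<lambda>v. L (frechet_derivative f (at x) v))) (at x)" if "x \<in> S" for x
    using Suc.prems that by (intro bounded_linear.has_derivative[OF assms(1)] has_derivative_frechet) auto
  have "Ck_on k S (\<lambda>x. frechet_derivative (\<lambda>x. L (f x)) (at x) v)" for v
    by (rule Ck_on_cong[OF assms(2) _ Suc.IH[of "\<lambda>x. frechet_derivative f (at x) v"]])
      (use Suc.prems in \<open>auto simp: frechet_derivative_eqI[OF d]\<close>)
  then show ?case using d by (auto simp: differentiable_def)
qed

lemma Ck_on_add: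
  assumes "open S" "Ck_on k S f" "Ck_on k S g"
  shows "Ck_on k S (\<lambda>x. f x + g x)"
  using assms(2,3)
proof (induction k arbitrary: f g)
  case 0
  then show ?case by (simp add: continuous_on_add)
next
  case (Suc k)
  have d: "((\<lambda>x. f x + g x) has_derivative (\<lambda>v. frechet_derivative f (at x) v + frechet_derivative g (at x) v)) (at x)"
    if "x \<in> S" for x
    using Suc.prems that by (intro has_derivative_add has_derivative_frechet) auto
  have "Ck_on k S (\<lambda>x. frechet_derivative (\<lambda>x. f x + g x) (at x) v)" for v
    by (rule Ck_on_cong[OF assms(1) _ Suc.IH[of "\<lambda>x. frechet_derivative f (at x) v" "\<lambda>x. frechet_derivative g (at x) v"]])
      (use Suc.prems in \<open>auto simp: frechet_derivative_eqI[OF d]\<close>)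
  then show ?case using d by (auto simp: differentiable_def)
qed

text \<open>The Leibniz rule brings back the undifferentiated factors, which are available at order
  \<open>k\<close> through \<open>Ck_on_SucD\<close>.\<close>

lemma Ck_on_mult:
  fixes f g :: "'a::real_normed_vector \<Rightarrow> real"
  assumes "open S" "Ck_on k S f" "Ck_on k S g"
  shows "Ck_on k S (\<lambda>x. f x * g x)"
  using assms(2,3)
proof (induction k arbitrary: f g)
  case 0
  then show ?case by (simp add: continuous_on_mult)
next
  case (Suc k)
  have d: "((\<lambda>x. f x * g x) has_derivative (\<lambda>v. f x * frechet_derivative g (at x) v + frechet_derivative f (at x) v * g x)) (at x)"
    if "x \<in> S" for x
    using Suc.prems that by (intro has_derivative_mult has_derivative_frechet) auto
  have "Ck_on k S (\<lambda>x. frechet_derivative (\<lambda>x. f x * g x) (at x) v)" for v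
    by (rule Ck_on_cong[OF assms(1) _ Ck_on_add[OF assms(1)
            Suc.IH[of f "\<lambda>x. frechet_derivative g (at x) v"] Suc.IH[of "\<lambda>x. frechet_derivative f (at x) v" g]]])
      (use Suc.prems Ck_on_SucD[OF Suc.prems(1)] Ck_on_SucD[OF Suc.prems(2)] in
        \<open>auto simp: frechet_derivative_eqI[OF d]\<close>)
  then show ?case using d by (auto simp: differentiable_def)
qed

lemma Ck_on_sum:
  assumes "open S" "finite I" "\<And>i. i \<in> I \<Longrightarrow> Ck_on k S (f i)"
  shows "Ck_on k S (\<lambda>x. \<Sum>i\<in>I. f i x)"
  using assms(2,3) by (induction I) (auto intro: Ck_on_const Ck_on_add[OF assms(1)])

lemma linear_axis_expansion:
  fixes L :: "real ^ 'n \<Rightarrow> 'b::real_vector"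
  assumes "linear L"
  shows "L w = (\<Sum>i\<in>UNIV. w $ i *\<^sub>R L (axis i 1))"
proof -
  have "w = (\<Sum>i\<in>UNIV. w $ i *\<^sub>R axis i 1)"
    by (simp add: scalar_mult_eq_scaleR[symmetric] basis_expansion)
  then have "L w = L (\<Sum>i\<in>UNIV. w $ i *\<^sub>R axis i 1)" by simp
  also have "\<dots> = (\<Sum>i\<in>UNIV. w $ i *\<^sub>R L (axis i 1))"
    by (simp add: linear_sum[OF assms] linear_cmul[OF assms])
  finally show ?thesis .
qed

text \<open>The chain rule evaluates the derivative of \<open>g\<close> in a direction that varies
  with the point, whereas \<open>Ck_on\<close> controls fixed directions only. Expanding that
  direction in the standard basis turns the derivative into a finite sum of products, to which the
  induction hypothesis applies.\<close>

lemma Ck_on_compose: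
  fixes F :: "'a::real_normed_vector \<Rightarrow> real ^ 'n" and g :: "real ^ 'n \<Rightarrow> real"
  assumes "open S" "F ` S \<subseteq> T" "Ck_on k S F" "Ck_on k T g"
  shows "Ck_on k S (\<lambda>x. g (F x))"
  using assms(3,4)
proof (induction k arbitrary: g)
  case 0
  then show ?case
    using continuous_on_compose2[OF _ _ assms(2)] by auto
next
  case (Suc k)
  let ?F = "\<lambda>x. frechet_derivative F (at x)" and ?g = "\<lambda>y. frechet_derivative g (at y)"
  have g: "g differentiable (at (F x))" if "x \<in> S" for x
    using Suc.prems(2) assms(2) that by auto
  have d: "((\<lambda>x. g (F x)) has_derivative (\<lambda>v. ?g (F x) (?F x v))) (at x)" if "x \<in> S" for x
    using Suc.prems(1) that
    by (intro has_derivative_compose[of F "?F x" x UNIV g "?g (F x)"] has_derivative_frechet g) auto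
  have e: "?g (F x) (?F x v) = (\<Sum>i\<in>UNIV. ?F x v $ i * ?g (F x) (axis i 1))" if "x \<in> S" for x v
    using linear_axis_expansion[OF linear_frechet_derivative[OF g[OF that]], of "?F x v"] by simp
  have "Ck_on k S (\<lambda>x. frechet_derivative (\<lambda>x. g (F x)) (at x) v)" for v
  proof (rule Ck_on_cong[OF assms(1)])
    show "(\<Sum>i\<in>UNIV. ?F x v $ i * ?g (F x) (axis i 1)) = frechet_derivative (\<lambda>x. g (F x)) (at x) v"
      if "x \<in> S" for x
      using e[OF that] frechet_derivative_eqI[OF d[OF that]] by simp
    show "Ck_on k S (\<lambda>x. \<Sum>i\<in>UNIV. ?F x v $ i * ?g (F x) (axis i 1))"
      using Suc.prems Ck_on_SucD[OF Suc.prems(1)]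
      by (intro Ck_on_sum Ck_on_mult Suc.IH Ck_on_bounded_linear[OF bounded_linear_vec_nth] assms(1)) auto
  qed
  then show ?case using d by (auto simp: differentiable_def)
qed

lemma Ck_on_vecI:
  fixes F :: "'a::real_normed_vector \<Rightarrow> real ^ 'n"
  assumes "open S" "\<And>i. Ck_on k S (\<lambda>x. F x $ i)"
  shows "Ck_on k S F"
proof -
  have "Ck_on k S (\<lambda>x. F x $ i *\<^sub>R (axis i 1 :: real ^ 'n))" for i
    by (intro Ck_on_bounded_linear[OF bounded_linear_scaleR_left] assms)
  then have "Ck_on k S (\<lambda>x. \<Sum>i\<in>UNIV. F x $ i *\<^sub>R (axis i 1 :: real ^ 'n))"
    by (intro Ck_on_sum assms) auto
  then show ?thesis
    by (simp add: scalar_mult_eq_scaleR[symmetric] basis_expansion)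
qed

lemma smooth_on_cong:
  "open S \<Longrightarrow> (\<And>x. x \<in> S \<Longrightarrow> f x = g x) \<Longrightarrow> smooth_on S f \<Longrightarrow> smooth_on S g"
  unfolding smooth_on_def using Ck_on_cong by blast

lemma smooth_on_subset: "smooth_on S f \<Longrightarrow> T \<subseteq> S \<Longrightarrow> smooth_on T f"
  unfolding smooth_on_def using Ck_on_subset by blast

lemma smooth_on_local:
  assumes "\<And>x. x \<in> S \<Longrightarrow> \<exists>T. open T \<and> x \<in> T \<and> smooth_on T f"
  shows "smooth_on S f"
  unfolding smooth_on_def
proof (intro allI Ck_on_local)
  fix k x assume "x \<in> S"
  then obtain T where "open T" "x \<in> T" "smooth_on T f" using assms by blast
  then show "\<exists>T. open T \<and> x \<in> T \<and> Ck_on k T f" by (auto simp: smooth_on_def)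
qed

lemma smooth_onD: "smooth_on S f \<Longrightarrow> Ck_on k S f"
  by (simp add: smooth_on_def)

lemma smooth_on_differentiable: "smooth_on S f \<Longrightarrow> x \<in> S \<Longrightarrow> f differentiable (at x)"
  using smooth_onD[of S f "Suc 0"] by simp

lemma smooth_on_frechet_derivative:
  assumes "smooth_on S f"
  shows "smooth_on S (\<lambda>x. frechet_derivative f (at x) v)"
  unfolding smooth_on_def
proof
  fix k show "Ck_on k S (\<lambda>x. frechet_derivative f (at x) v)"
    using smooth_onD[OF assms, of "Suc k"] by simp
qed

lemma smooth_on_const: "smooth_on S (\<lambda>x. a)"
  by (simp add: smooth_on_def Ck_on_const)

lemma smooth_on_add: "open S \<Longrightarrow> smooth_on S f \<Longrightarrow> smooth_on S g \<Longrightarrow> smooth_on S (\<lambda>x. f x + g x)"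
  by (simp add: smooth_on_def Ck_on_add)

lemma smooth_on_mult:
  fixes f g :: "'a::real_normed_vector \<Rightarrow> real"
  shows "open S \<Longrightarrow> smooth_on S f \<Longrightarrow> smooth_on S g \<Longrightarrow> smooth_on S (\<lambda>x. f x * g x)"
  by (simp add: smooth_on_def Ck_on_mult)

lemma smooth_on_linear: "bounded_linear L \<Longrightarrow> smooth_on S L"
  by (simp add: smooth_on_def Ck_on_linear)

lemma smooth_on_compose:
  fixes F :: "'a::real_normed_vector \<Rightarrow> real ^ 'n" and g :: "real ^ 'n \<Rightarrow> real"
  shows "open S \<Longrightarrow> F ` S \<subseteq> T \<Longrightarrow> smooth_on S F \<Longrightarrow> smooth_on T g \<Longrightarrow> smooth_on S (\<lambda>x. g (F x))"
  by (simp add: smooth_on_def Ck_on_compose)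

lemma smooth_on_vecI:
  fixes F :: "'a::real_normed_vector \<Rightarrow> real ^ 'n"
  shows "open S \<Longrightarrow> (\<And>i. smooth_on S (\<lambda>x. F x $ i)) \<Longrightarrow> smooth_on S F"
  by (simp add: smooth_on_def Ck_on_vecI)

section \<open>Symmetry of second derivatives\<close>

lemma second_difference_mean_value:
  fixes f :: "'a::real_normed_vector \<Rightarrow> real"
  assumes f: "smooth_on S f" and t: "0 < t"
    and S: "\<And>\<sigma> \<tau>. 0 \<le> \<sigma> \<Longrightarrow> \<sigma> \<le> t \<Longrightarrow> 0 \<le> \<tau> \<Longrightarrow> \<tau> \<le> t \<Longrightarrow> x + \<sigma> *\<^sub>R v + \<tau> *\<^sub>R w \<in> S"
  obtains \<sigma> \<tau> where "0 \<le> \<sigma>" "\<sigma> \<le> t" "0 \<le> \<tau>" "\<tau> \<le> t"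
    "f (x + t *\<^sub>R v + t *\<^sub>R w) - f (x + t *\<^sub>R v) - f (x + t *\<^sub>R w) + f x
      = t * t * frechet_derivative (\<lambda>y. frechet_derivative f (at y) v) (at (x + \<sigma> *\<^sub>R v + \<tau> *\<^sub>R w)) w"
proof -
  let ?F = "\<lambda>y. frechet_derivative f (at y) v"
  have line: "((\<lambda>s. h (a + s *\<^sub>R u)) has_real_derivative frechet_derivative h (at (a + s *\<^sub>R u)) u) (at s)"
    if "h differentiable (at (a + s *\<^sub>R u))" for h :: "'a \<Rightarrow> real" and a u s
  proof -
    let ?h = "frechet_derivative h (at (a + s *\<^sub>R u))"
    have "((\<lambda>s. h (a + s *\<^sub>R u)) has_derivative (\<lambda>r. ?h (r *\<^sub>R u))) (at s)"
      by (rule has_derivative_compose[where g = h and s = UNIV])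
        (auto intro!: derivative_eq_intros has_derivative_frechet that)
    moreover have "(\<lambda>r. ?h (r *\<^sub>R u)) = (*) (?h u)"
      by (rule ext) (simp add: linear_cmul[OF linear_frechet_derivative[OF that]])
    ultimately show ?thesis
      by (simp add: has_field_derivative_def)
  qed
  \<comment> \<open>The second difference of \<open>f\<close> is the increment
    \<open>g t - g 0\<close>. One mean value theorem along \<open>v\<close> and another along
    \<open>w\<close> turn it into a mixed second derivative.\<close>
  define g where "g = (\<lambda>s. f ((x + t *\<^sub>R w) + s *\<^sub>R v) - f (x + s *\<^sub>R v))"
  have g': "(g has_real_derivative ?F ((x + t *\<^sub>R w) + s *\<^sub>R v) - ?F (x + s *\<^sub>R v)) (at s)"
    if "0 \<le> s" "s \<le> t" for s
    unfolding g_def using S[of s t] S[of s 0] that t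
    by (intro DERIV_diff line[of f "x + t *\<^sub>R w" s v] line[of f x s v] smooth_on_differentiable[OF f])
      (auto simp: algebra_simps)
  obtain \<sigma> where \<sigma>: "0 < \<sigma>" "\<sigma> < t"
      "g t - g 0 = (t - 0) * (?F ((x + t *\<^sub>R w) + \<sigma> *\<^sub>R v) - ?F (x + \<sigma> *\<^sub>R v))"
    using MVT2[OF t g'] by auto
  have "((\<lambda>r. ?F ((x + \<sigma> *\<^sub>R v) + r *\<^sub>R w)) has_real_derivative
      frechet_derivative ?F (at ((x + \<sigma> *\<^sub>R v) + r *\<^sub>R w)) w) (at r)" if "0 \<le> r" "r \<le> t" for r
    using S[of \<sigma> r] that \<sigma>
    by (intro line[of ?F "x + \<sigma> *\<^sub>R v" r w] smooth_on_differentiable[OF smooth_on_frechet_derivative[OF f]])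
      auto
  from MVT2[OF t this] obtain \<tau> where \<tau>: "0 < \<tau>" "\<tau> < t"
      "?F ((x + \<sigma> *\<^sub>R v) + t *\<^sub>R w) - ?F ((x + \<sigma> *\<^sub>R v) + 0 *\<^sub>R w) =
       (t - 0) * frechet_derivative ?F (at (x + \<sigma> *\<^sub>R v + \<tau> *\<^sub>R w)) w"
    by auto
  show ?thesis
    using \<sigma> \<tau> that[of \<sigma> \<tau>] by (simp add: g_def algebra_simps)
qed

text \<open>The second difference is symmetric in \<open>v\<close> and \<open>w\<close>, so the two
  mixed derivatives agree at suitable points of a small parallelogram. Continuity of both at
  \<open>x\<close> transfers the equality to \<open>x\<close>.\<close>

lemma frechet_derivative_commute:
  fixes f :: "'a::real_normed_vector \<Rightarrow> real"
  assumes f: "smooth_on S f" and "open S" "x \<in> S"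
  shows "frechet_derivative (\<lambda>y. frechet_derivative f (at y) v) (at x) w
       = frechet_derivative (\<lambda>y. frechet_derivative f (at y) w) (at x) v"
proof -
  define G where "G = (\<lambda>v w y. frechet_derivative (\<lambda>y. frechet_derivative f (at y) v) (at y) w)"
  have cont: "isCont (G v w) x" for v w
    unfolding G_def
    using smooth_on_frechet_derivative[OF smooth_on_frechet_derivative[OF f]] assms(2,3)
    by (intro differentiable_imp_continuous_within smooth_on_differentiable)
  have "\<bar>G v w x - G w v x\<bar> < e" if e: "e > 0" for e
  proof -
    obtain d1 where d1: "d1 > 0" "\<And>y. dist y x < d1 \<Longrightarrow> dist (G v w y) (G v w x) < e/2"
      using cont[of v w] e unfolding continuous_at_eps_delta by (meson half_gt_zero)
    obtain d2 where d2: "d2 > 0" "\<And>y. dist y x < d2 \<Longrightarrow> dist (G w v y) (G w v x) < e/2"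
      using cont[of w v] e unfolding continuous_at_eps_delta by (meson half_gt_zero)
    obtain d3 where d3: "d3 > 0" "\<And>y. dist y x < d3 \<Longrightarrow> y \<in> S"
      using assms(2,3) by (auto simp: open_dist)
    define d where "d = min d1 (min d2 d3)"
    \<comment> \<open>The parallelogram of side parameter \<open>t\<close> then stays within
      distance \<open>d\<close> of \<open>x\<close>; the summand 1 keeps the denominator positive
      when both vectors vanish.\<close>
    define t where "t = d / (2 * (norm v + norm w + 1))"
    have pos: "norm v + norm w + 1 > 0" by (smt (verit) norm_ge_zero)
    have t: "t > 0" using d1 d2 d3 pos by (simp add: t_def d_def)
    have near: "dist (x + \<sigma> *\<^sub>R v' + \<tau> *\<^sub>R w') x < d"
      if "0 \<le> \<sigma>" "\<sigma> \<le> t" "0 \<le> \<tau>" "\<tau> \<le> t" "norm v' + norm w' = norm v + norm w" for \<sigma> \<tau> v' w'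
    proof -
      have "dist (x + \<sigma> *\<^sub>R v' + \<tau> *\<^sub>R w') x \<le> \<sigma> * norm v' + \<tau> * norm w'"
        using norm_triangle_ineq[of "\<sigma> *\<^sub>R v'" "\<tau> *\<^sub>R w'"] that by (simp add: dist_norm add.assoc)
      also have "\<dots> \<le> t * norm v' + t * norm w'"
        using that by (intro add_mono mult_right_mono) auto
      also have "\<dots> = t * (norm v + norm w)"
        using that(5) by (simp flip: distrib_left)
      also have "\<dots> < t * (2 * (norm v + norm w + 1))"
        by (rule mult_strict_left_mono[OF _ t]) (smt (verit) norm_ge_zero)
      also have "\<dots> = d" using pos by (simp add: t_def)
      finally show ?thesis .
    qed
    have in_S: "x + \<sigma> *\<^sub>R v' + \<tau> *\<^sub>R w' \<in> S"
      if "0 \<le> \<sigma>" "\<sigma> \<le> t" "0 \<le> \<tau>" "\<tau> \<le> t" "norm v' + norm w' = norm v + norm w" for \<sigma> \<tau> v' w'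
      using near[OF that] d3(2) by (simp add: d_def)
    obtain \<sigma> \<tau> where 1: "0 \<le> \<sigma>" "\<sigma> \<le> t" "0 \<le> \<tau>" "\<tau> \<le> t"
      "f (x + t *\<^sub>R v + t *\<^sub>R w) - f (x + t *\<^sub>R v) - f (x + t *\<^sub>R w) + f x
        = t * t * G v w (x + \<sigma> *\<^sub>R v + \<tau> *\<^sub>R w)"
      using second_difference_mean_value[OF f t in_S, of v w] unfolding G_def by auto
    obtain \<sigma>' \<tau>' where 2: "0 \<le> \<sigma>'" "\<sigma>' \<le> t" "0 \<le> \<tau>'" "\<tau>' \<le> t"
      "f (x + t *\<^sub>R w + t *\<^sub>R v) - f (x + t *\<^sub>R w) - f (x + t *\<^sub>R v) + f x
        = t * t * G w v (x + \<sigma>' *\<^sub>R w + \<tau>' *\<^sub>R v)"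
      using second_difference_mean_value[OF f t in_S, of w v] unfolding G_def by (auto simp: add.commute)
    have "t * t * G v w (x + \<sigma> *\<^sub>R v + \<tau> *\<^sub>R w) = t * t * G w v (x + \<sigma>' *\<^sub>R w + \<tau>' *\<^sub>R v)"
      using 1(5) 2(5) by (simp add: algebra_simps)
    then have "G v w (x + \<sigma> *\<^sub>R v + \<tau> *\<^sub>R w) = G w v (x + \<sigma>' *\<^sub>R w + \<tau>' *\<^sub>R v)"
      using t by simp
    moreover have "dist (G v w (x + \<sigma> *\<^sub>R v + \<tau> *\<^sub>R w)) (G v w x) < e/2"
      using near[OF 1(1-4)] by (intro d1(2)) (simp add: d_def)
    moreover have "dist (G w v (x + \<sigma>' *\<^sub>R w + \<tau>' *\<^sub>R v)) (G w v x) < e/2"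
      using near[OF 2(1-4), of w v] by (intro d2(2)) (simp add: d_def)
    ultimately show ?thesis unfolding dist_real_def by linarith
  qed
  then have "\<bar>G v w x - G w v x\<bar> \<le> 0"
    using field_le_epsilon[of "\<bar>G v w x - G w v x\<bar>" 0] by (simp add: less_imp_le)
  then show ?thesis by (simp add: G_def)
qed

section \<open>Smooth atlases, tangent vectors and vector fields\<close>

definition chart_rep :: "('m, 'n::finite) chart \<Rightarrow> ('m \<Rightarrow> 'b) \<Rightarrow> real ^ 'n \<Rightarrow> 'b" where
  "chart_rep c f = (\<lambda>x. f (inv_into (fst c) (snd c) x))"

text \<open>The conditions on charts and transition maps in isolation, so that one calculus serves
  both the base and, by \<open>cotangent_smooth_atlas\<close>, the cotangent bundle.\<close>

locale smooth_atlas =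
  fixes A :: "('m, 'n::finite) chart set"
  assumes chart_inj: "c \<in> A \<Longrightarrow> inj_on (snd c) (fst c)"
    and chart_image_open: "c \<in> A \<Longrightarrow> open (snd c ` fst c)"
    and overlap_open: "c \<in> A \<Longrightarrow> d \<in> A \<Longrightarrow> open (snd c ` (fst c \<inter> fst d))"
    and transition_smooth: "c \<in> A \<Longrightarrow> d \<in> A \<Longrightarrow> smooth_on (snd c ` (fst c \<inter> fst d)) (chart_rep c (snd d))"

lemma smooth_manifold_atlas:
  assumes "smooth_manifold A"
  shows "smooth_atlas A"
proof
  fix c assume "c \<in> A"
  then show "inj_on (snd c) (fst c)" "open (snd c ` fst c)"
    using assms by (auto simp: smooth_manifold_def split_def)
next
  fix c d assume "c \<in> A" "d \<in> A"
  then show "open (snd c ` (fst c \<inter> fst d))" "smooth_on (snd c ` (fst c \<inter> fst d)) (chart_rep c (snd d))"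
    using assms by (auto simp: smooth_manifold_def split_def chart_rep_def)
qed

context smooth_atlas
begin

lemma chart_inv [simp]: "c \<in> A \<Longrightarrow> p \<in> fst c \<Longrightarrow> inv_into (fst c) (snd c) (snd c p) = p"
  by (simp add: inv_into_f_f chart_inj)

lemma chart_rep_at [simp]: "c \<in> A \<Longrightarrow> p \<in> fst c \<Longrightarrow> chart_rep c f (snd c p) = f p"
  by (simp add: chart_rep_def)

lemma in_carrier: "c \<in> A \<Longrightarrow> p \<in> fst c \<Longrightarrow> p \<in> carrier A"
  by (auto simp: carrier_def split_def)

lemma carrier_chart: "p \<in> carrier A \<Longrightarrow> \<exists>c\<in>A. p \<in> fst c"
  by (auto simp: carrier_def split_def)

lemma chart_at:
  assumes "p \<in> carrier A"
  shows "chart_at A p \<in> A" "p \<in> fst (chart_at A p)"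
proof -
  have "chart_at A p \<in> A \<and> p \<in> fst (chart_at A p)"
    unfolding chart_at_def by (rule someI_ex) (use carrier_chart[OF assms] in blast)
  then show "chart_at A p \<in> A" "p \<in> fst (chart_at A p)" by auto
qed

text \<open>\<open>topology\<close> can be evaluated only on predicates that satisfy
  \<open>istopology\<close>. Closure under intersection uses injectivity of the charts, since images
  must commute with intersections.\<close>

lemma openin_mtop: "openin (mtop A) W \<longleftrightarrow> W \<subseteq> carrier A \<and> (\<forall>c\<in>A. open (snd c ` (W \<inter> fst c)))"
proof -
  let ?L = "\<lambda>W. W \<subseteq> carrier A \<and> (\<forall>c\<in>A. open (snd c ` (W \<inter> fst c)))"
  have "istopology ?L"
    unfolding istopology_def
  proof (intro conjI allI impI ballI)
    fix S T c assume "?L S" "?L T" "c \<in> A"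
    moreover have "snd c ` (S \<inter> T \<inter> fst c) = snd c ` (S \<inter> fst c) \<inter> snd c ` (T \<inter> fst c)"
      using chart_inj[OF \<open>c \<in> A\<close>] by (auto simp: inj_on_def)
    ultimately show "open (snd c ` (S \<inter> T \<inter> fst c))" by (metis open_Int)
  next
    fix K c assume "\<forall>S\<in>K. ?L S" "c \<in> A"
    moreover have "snd c ` (\<Union> K \<inter> fst c) = (\<Union>S\<in>K. snd c ` (S \<inter> fst c))" by blast
    ultimately show "open (snd c ` (\<Union> K \<inter> fst c))" by (metis open_UN)
  qed auto
  then show ?thesis
    by (simp add: mtop_def split_def topology_inverse')
qed

lemma openin_chart: "c \<in> A \<Longrightarrow> openin (mtop A) (fst c)"
  using overlap_open by (auto simp: openin_mtop carrier_def split_def Int_commute)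

lemma open_chart_image: "openin (mtop A) W \<Longrightarrow> c \<in> A \<Longrightarrow> open (snd c ` (W \<inter> fst c))"
  by (simp add: openin_mtop)

lemma smooth_fun_iff:
  "smooth_fun A W f \<longleftrightarrow> openin (mtop A) W \<and> (\<forall>c\<in>A. smooth_on (snd c ` (W \<inter> fst c)) (chart_rep c f))"
  by (simp add: smooth_fun_def split_def chart_rep_def)

lemma smooth_fun_openin: "smooth_fun A W f \<Longrightarrow> openin (mtop A) W"
  by (simp add: smooth_fun_def)

lemma smooth_fun_subset: "smooth_fun A W f \<Longrightarrow> openin (mtop A) V \<Longrightarrow> V \<subseteq> W \<Longrightarrow> smooth_fun A V f"
  unfolding smooth_fun_iff
  by (metis Int_mono image_mono smooth_on_subset subset_refl)

lemma smooth_fun_Int1: "smooth_fun A V f \<Longrightarrow> openin (mtop A) W \<Longrightarrow> smooth_fun A (V \<inter> W) f"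
  by (meson Int_lower1 openin_Int smooth_fun_openin smooth_fun_subset)

lemma smooth_fun_Int2: "smooth_fun A W f \<Longrightarrow> openin (mtop A) V \<Longrightarrow> smooth_fun A (V \<inter> W) f"
  by (metis Int_commute smooth_fun_Int1)

lemma smooth_fun_cong:
  assumes "smooth_fun A W f" "\<And>q. q \<in> W \<Longrightarrow> f q = g q"
  shows "smooth_fun A W g"
  unfolding smooth_fun_iff
proof (intro conjI ballI)
  show W: "openin (mtop A) W" using assms(1) by (rule smooth_fun_openin)
  fix c assume c: "c \<in> A"
  show "smooth_on (snd c ` (W \<inter> fst c)) (chart_rep c g)"
    by (rule smooth_on_cong[OF open_chart_image[OF W c], of "chart_rep c f"])
      (use assms c in \<open>auto simp: smooth_fun_iff\<close>)
qed

text \<open>In any other chart the function is the given expression composed with a transition map,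
  so a single chart suffices.\<close>

lemma smooth_funI_chart:
  assumes c: "c \<in> A" and W: "openin (mtop A) W" "W \<subseteq> fst c"
    and f: "smooth_on (snd c ` W) (chart_rep c f)"
  shows "smooth_fun A W f"
  unfolding smooth_fun_iff
proof (intro conjI ballI W)
  fix d assume d: "d \<in> A"
  let ?S = "snd d ` (W \<inter> fst d)"
  have S: "open ?S" by (rule open_chart_image[OF W(1) d])
  show "smooth_on ?S (chart_rep d f)"
  proof (rule smooth_on_cong[OF S])
    show "smooth_on ?S (\<lambda>x. chart_rep c f (chart_rep d (snd c) x))"
    proof (rule smooth_on_compose[OF S _ _ f])
      show "chart_rep d (snd c) ` ?S \<subseteq> snd c ` W" using d by auto
      show "smooth_on ?S (chart_rep d (snd c))"
        by (rule smooth_on_subset[OF transition_smooth[OF d c]]) (use W in auto)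
    qed
    show "chart_rep c f (chart_rep d (snd c) x) = chart_rep d f x" if "x \<in> ?S" for x
      using that c d W(2) by auto
  qed
qed

lemma smooth_fun_local:
  assumes W: "openin (mtop A) W" and loc: "\<And>p. p \<in> W \<Longrightarrow> \<exists>V. p \<in> V \<and> smooth_fun A V f"
  shows "smooth_fun A W f"
  unfolding smooth_fun_iff
proof (intro conjI ballI W)
  fix c assume c: "c \<in> A"
  show "smooth_on (snd c ` (W \<inter> fst c)) (chart_rep c f)"
  proof (rule smooth_on_local)
    fix x assume "x \<in> snd c ` (W \<inter> fst c)"
    then obtain p where p: "p \<in> W" "p \<in> fst c" "x = snd c p" by auto
    with loc obtain V where "p \<in> V" "smooth_fun A V f" by blast
    then show "\<exists>T. open T \<and> x \<in> T \<and> smooth_on T (chart_rep c f)"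
      using p c open_chart_image[of V c]
      by (intro exI[of _ "snd c ` (V \<inter> fst c)"]) (auto simp: smooth_fun_iff)
  qed
qed

lemma smooth_fun_const: "openin (mtop A) W \<Longrightarrow> smooth_fun A W (\<lambda>q. a)"
  by (simp add: smooth_fun_iff chart_rep_def smooth_on_const)

lemma smooth_fun_add:
  "smooth_fun A W f \<Longrightarrow> smooth_fun A W g \<Longrightarrow> smooth_fun A W (\<lambda>q. f q + g q)"
  by (simp add: smooth_fun_iff chart_rep_def smooth_on_add open_chart_image)

lemma smooth_fun_mult:
  "smooth_fun A W f \<Longrightarrow> smooth_fun A W g \<Longrightarrow> smooth_fun A W (\<lambda>q. f q * g q)"
  by (simp add: smooth_fun_iff chart_rep_def smooth_on_mult open_chart_image)

lemma smooth_fun_cmult: "smooth_fun A W f \<Longrightarrow> smooth_fun A W (\<lambda>q. a * f q)"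
  by (intro smooth_fun_mult smooth_fun_const smooth_fun_openin)

lemma smooth_fun_diff:
  "smooth_fun A W f \<Longrightarrow> smooth_fun A W g \<Longrightarrow> smooth_fun A W (\<lambda>q. f q - g q)"
  using smooth_fun_add[OF _ smooth_fun_cmult[of W g "-1"]] by simp

lemma smooth_fun_sum:
  assumes "openin (mtop A) W" "\<And>i. i \<in> I \<Longrightarrow> smooth_fun A W (f i)"
  shows "smooth_fun A W (\<lambda>q. \<Sum>i\<in>I. f i q)"
  using assms(2)
  by (induction I rule: infinite_finite_induct) (auto intro: smooth_fun_add smooth_fun_const assms(1))

lemmas smooth_fun_intros =
  smooth_fun_add smooth_fun_diff smooth_fun_mult smooth_fun_cmult smooth_fun_sum smooth_fun_const

lemma smooth_fun_coord:
  assumes c: "c \<in> A"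
  shows "smooth_fun A (fst c) (\<lambda>q. snd c q $ k)"
proof (rule smooth_funI_chart[OF c openin_chart[OF c] subset_refl])
  show "smooth_on (snd c ` fst c) (chart_rep c (\<lambda>q. snd c q $ k))"
    by (rule smooth_on_cong[OF chart_image_open[OF c] _ smooth_on_linear[OF bounded_linear_vec_nth]])
      (use c in auto)
qed

lemma smooth_atI: "smooth_fun A W f \<Longrightarrow> p \<in> W \<Longrightarrow> smooth_at A p f"
  by (auto simp: smooth_at_def)

lemma smooth_at_carrier: "smooth_at A p f \<Longrightarrow> p \<in> carrier A"
  by (auto simp: smooth_at_def smooth_fun_def openin_mtop)

section \<open>Germs of smooth functions and tangent vectors\<close>

lemma smooth_at_cong:
  assumes "openin (mtop A) W" "p \<in> W" "\<And>q. q \<in> W \<Longrightarrow> f q = g q" "smooth_at A p f"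
  shows "smooth_at A p g"
proof -
  obtain V where V: "p \<in> V" "smooth_fun A V f" using assms(4) by (auto simp: smooth_at_def)
  have "smooth_fun A (V \<inter> W) g"
    by (rule smooth_fun_cong[OF smooth_fun_Int1[OF V(2) assms(1)]]) (use assms(3) in auto)
  then show ?thesis using V assms(2) by (intro smooth_atI[of "V \<inter> W"]) auto
qed

lemma smooth_at_common:
  assumes "smooth_at A p f" "smooth_at A p g"
  obtains W where "p \<in> W" "smooth_fun A W f" "smooth_fun A W g"
  using assms unfolding smooth_at_def
  by (metis IntI smooth_fun_Int1 smooth_fun_Int2 smooth_fun_openin)

lemma smooth_at_add: "smooth_at A p f \<Longrightarrow> smooth_at A p g \<Longrightarrow> smooth_at A p (\<lambda>q. f q + g q)"
  by (metis smooth_at_common smooth_fun_add smooth_atI)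

lemma smooth_at_mult: "smooth_at A p f \<Longrightarrow> smooth_at A p g \<Longrightarrow> smooth_at A p (\<lambda>q. f q * g q)"
  by (metis smooth_at_common smooth_fun_mult smooth_atI)

lemma smooth_at_const: "p \<in> carrier A \<Longrightarrow> smooth_at A p (\<lambda>q. a)"
  using chart_at smooth_fun_const[OF openin_chart] smooth_atI by metis

lemma smooth_at_cmult: "smooth_at A p f \<Longrightarrow> smooth_at A p (\<lambda>q. a * f q)"
  using smooth_at_mult smooth_at_const smooth_at_carrier by blast

lemma smooth_at_sum:
  "p \<in> carrier A \<Longrightarrow> (\<And>i. i \<in> I \<Longrightarrow> smooth_at A p (f i)) \<Longrightarrow> smooth_at A p (\<lambda>q. \<Sum>i\<in>I. f i q)"
  by (induction I rule: infinite_finite_induct) (auto intro: smooth_at_add smooth_at_const)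

lemma smooth_at_coord: "c \<in> A \<Longrightarrow> p \<in> fst c \<Longrightarrow> smooth_at A p (\<lambda>q. snd c q $ k)"
  by (rule smooth_atI[OF smooth_fun_coord])

lemma smooth_at_rep_differentiable:
  assumes "c \<in> A" "p \<in> fst c" "smooth_at A p f"
  shows "chart_rep c f differentiable (at (snd c p))"
proof -
  obtain W where "p \<in> W" "smooth_fun A W f" using assms(3) by (auto simp: smooth_at_def)
  then show ?thesis
    using assms(1,2) by (intro smooth_on_differentiable[of "snd c ` (W \<inter> fst c)"]) (auto simp: smooth_fun_iff)
qed

lemma coord_deriv_eq:
  "coord_deriv A c p w f = (if smooth_at A p f then frechet_derivative (chart_rep c f) (at (snd c p)) w else 0)"
  by (simp add: coord_deriv_def chart_rep_def)

text \<open>The chain rule for the transition map. On functions that are not smooth at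
  \<open>p\<close> both sides are 0 by convention, so the equality holds between HOL
  functions.\<close>

lemma coord_deriv_change:
  assumes c: "c \<in> A" "p \<in> fst c" and d: "d \<in> A" "p \<in> fst d"
  shows "coord_deriv A d p w = coord_deriv A c p (frechet_derivative (chart_rep d (snd c)) (at (snd d p)) w)"
proof
  fix f
  show "coord_deriv A d p w f = coord_deriv A c p (frechet_derivative (chart_rep d (snd c)) (at (snd d p)) w) f"
  proof (cases "smooth_at A p f")
    case True
    let ?S = "snd d ` (fst d \<inter> fst c)" and ?T = "chart_rep d (snd c)"
    have "((\<lambda>x. chart_rep c f (?T x)) has_derivative
        (\<lambda>v. frechet_derivative (chart_rep c f) (at (?T (snd d p))) (frechet_derivative ?T (at (snd d p)) v)))
        (at (snd d p))"
    proof (rule has_derivative_compose[where g = "chart_rep c f" and s = UNIV, OF has_derivative_frechet has_derivative_frechet])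
      show "?T differentiable (at (snd d p))"
        by (rule smooth_on_differentiable[OF transition_smooth[OF d(1) c(1)]]) (use c d in auto)
      show "chart_rep c f differentiable (at (?T (snd d p)))"
        using smooth_at_rep_differentiable[OF c True] d by simp
    qed
    then have "(chart_rep d f has_derivative
        (\<lambda>v. frechet_derivative (chart_rep c f) (at (?T (snd d p))) (frechet_derivative ?T (at (snd d p)) v)))
        (at (snd d p))"
      by (rule has_derivative_transform_within_open[OF _ overlap_open[OF d(1) c(1)]]) (use c d in auto)
    then show ?thesis
      using True c d by (simp add: coord_deriv_eq frechet_derivative_eqI)
  qed (simp add: coord_deriv_eq)
qed

lemma tangent_space_chart:
  assumes c: "c \<in> A" "p \<in> fst c"
  shows "tangent_space A p = range (coord_deriv A c p)"
proof (intro subset_antisym subsetI)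
  fix v assume "v \<in> tangent_space A p"
  then obtain d w where d: "d \<in> A" "p \<in> fst d" and v: "v = coord_deriv A d p w"
    by (auto simp: tangent_space_def)
  show "v \<in> range (coord_deriv A c p)"
    unfolding v coord_deriv_change[OF c d] by (rule rangeI)
qed (use c in \<open>unfold tangent_space_def, blast\<close>)

lemma tangent_carrier: "v \<in> tangent_space A p \<Longrightarrow> p \<in> carrier A"
  by (auto simp: tangent_space_def intro: in_carrier)

lemma tangentE:
  assumes "v \<in> tangent_space A p" "c \<in> A" "p \<in> fst c"
  obtains w where "v = coord_deriv A c p w"
  using assms tangent_space_chart by blast

lemma tangentE':
  assumes "v \<in> tangent_space A p"
  obtains c w where "c \<in> A" "p \<in> fst c" "v = coord_deriv A c p w"
  using assms by (auto simp: tangent_space_def)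

lemma tangent_not_smooth: "v \<in> tangent_space A p \<Longrightarrow> \<not> smooth_at A p f \<Longrightarrow> v f = 0"
  by (auto simp: tangent_space_def coord_deriv_def)

text \<open>Locality of derivations. Smoothness at \<open>p\<close> is itself local, so either both
  functions are smooth there and have the same derivative, or neither is and both values are the
  default 0.\<close>

lemma tangent_cong:
  assumes v: "v \<in> tangent_space A p" and W: "openin (mtop A) W" "p \<in> W" and eq: "\<And>q. q \<in> W \<Longrightarrow> f q = g q"
  shows "v f = v g"
proof (cases "smooth_at A p f")
  case True
  obtain c w where c: "c \<in> A" "p \<in> fst c" "v = coord_deriv A c p w" by (rule tangentE'[OF v])
  have "frechet_derivative (chart_rep c g) (at (snd c p)) = frechet_derivative (chart_rep c f) (at (snd c p))"
    by (rule differentiable_cong_open[OF open_chart_image[OF W(1) c(1)] _ _ smooth_at_rep_differentiable[OF c(1,2) True]])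
      (use c W eq in auto)
  then show ?thesis
    using True smooth_at_cong[OF W eq True] c(3) by (simp add: coord_deriv_eq)
next
  case False
  then have "\<not> smooth_at A p g" using smooth_at_cong[OF W, of g f] eq by auto
  with False show ?thesis using tangent_not_smooth[OF v] by simp
qed

lemma tangent_add:
  assumes v: "v \<in> tangent_space A p" and f: "smooth_at A p f" and g: "smooth_at A p g"
  shows "v (\<lambda>q. f q + g q) = v f + v g"
proof -
  obtain c w where c: "c \<in> A" "p \<in> fst c" "v = coord_deriv A c p w" by (rule tangentE'[OF v])
  have "((\<lambda>x. chart_rep c f x + chart_rep c g x) has_derivative
      (\<lambda>w. frechet_derivative (chart_rep c f) (at (snd c p)) w + frechet_derivative (chart_rep c g) (at (snd c p)) w))
      (at (snd c p))"
    by (intro has_derivative_add has_derivative_frechet smooth_at_rep_differentiable c f g)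
  from frechet_derivative_eqI[OF this] show ?thesis
    using c f g smooth_at_add[OF f g] by (simp add: coord_deriv_eq chart_rep_def)
qed

lemma tangent_mult:
  assumes v: "v \<in> tangent_space A p" and f: "smooth_at A p f" and g: "smooth_at A p g"
  shows "v (\<lambda>q. f q * g q) = v f * g p + f p * v g"
proof -
  obtain c w where c: "c \<in> A" "p \<in> fst c" "v = coord_deriv A c p w" by (rule tangentE'[OF v])
  have "((\<lambda>x. chart_rep c f x * chart_rep c g x) has_derivative
      (\<lambda>w. chart_rep c f (snd c p) * frechet_derivative (chart_rep c g) (at (snd c p)) w
         + frechet_derivative (chart_rep c f) (at (snd c p)) w * chart_rep c g (snd c p)))
      (at (snd c p))"
    by (intro has_derivative_mult has_derivative_frechet smooth_at_rep_differentiable c f g)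
  from frechet_derivative_eqI[OF this] show ?thesis
    using c f g smooth_at_mult[OF f g] by (simp add: coord_deriv_eq chart_rep_def)
qed

lemma tangent_const: "v \<in> tangent_space A p \<Longrightarrow> v (\<lambda>q. a) = 0"
  by (erule tangentE') (simp add: coord_deriv_eq chart_rep_def)

lemma tangent_cmult:
  assumes "v \<in> tangent_space A p" "smooth_at A p f"
  shows "v (\<lambda>q. a * f q) = a * v f"
  using tangent_mult[OF assms(1) smooth_at_const[OF tangent_carrier[OF assms(1)], of a] assms(2)]
    tangent_const[OF assms(1)] by simp

lemma tangent_diff:
  assumes "v \<in> tangent_space A p" "smooth_at A p f" "smooth_at A p g"
  shows "v (\<lambda>q. f q - g q) = v f - v g"
  using tangent_add[OF assms(1,2) smooth_at_cmult[OF assms(3), of "-1"]] tangent_cmult[OF assms(1,3), of "-1"] by simp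

lemma tangent_sum:
  assumes "v \<in> tangent_space A p" "\<And>i. i \<in> I \<Longrightarrow> smooth_at A p (f i)"
  shows "v (\<lambda>q. \<Sum>i\<in>I. f i q) = (\<Sum>i\<in>I. v (f i))"
  using assms(2)
proof (induction I rule: infinite_finite_induct)
  case (insert i I)
  then show ?case
    using tangent_add[OF assms(1), of "f i" "\<lambda>q. \<Sum>i\<in>I. f i q"] smooth_at_sum[OF tangent_carrier[OF assms(1)], of I f]
    by simp
qed (auto simp: tangent_const[OF assms(1)])

lemma coord_vec_tangent: "c \<in> A \<Longrightarrow> p \<in> fst c \<Longrightarrow> coord_vec A c i p \<in> tangent_space A p"
  by (simp add: coord_vec_def tangent_space_chart)

lemma coord_deriv_expand:
  assumes "c \<in> A" "p \<in> fst c"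
  shows "coord_deriv A c p w f = (\<Sum>k\<in>UNIV. w $ k * coord_vec A c k p f)"
  using linear_axis_expansion[OF linear_frechet_derivative[OF smooth_at_rep_differentiable[OF assms, of f]], of w]
  by (simp add: coord_deriv_eq coord_vec_def)

lemma coord_diff_coord_deriv:
  assumes c: "c \<in> A" "p \<in> fst c"
  shows "coord_diff c k (coord_deriv A c p w) = w $ k"
proof -
  have "(chart_rep c (\<lambda>q. snd c q $ k) has_derivative (\<lambda>w. w $ k)) (at (snd c p))"
    by (rule has_derivative_transform_within_open[OF _ chart_image_open[OF c(1)], of "\<lambda>x. x $ k"])
      (use c in \<open>auto intro: bounded_linear_imp_has_derivative\<close>)
  then show ?thesis
    using smooth_at_coord[OF c] by (simp add: coord_diff_def coord_deriv_eq frechet_derivative_eqI)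
qed

lemma coord_diff_coord_vec:
  "c \<in> A \<Longrightarrow> p \<in> fst c \<Longrightarrow> coord_diff c k (coord_vec A c i p) = (if i = k then 1 else 0)"
  by (simp add: coord_vec_def coord_diff_coord_deriv axis_def)

text \<open>Reduces statements about tangent vectors to components. It is an equality of functions
  because the coordinate vectors also vanish on functions that are not smooth at
  \<open>p\<close>.\<close>

lemma tangent_expand:
  assumes "v \<in> tangent_space A p" "c \<in> A" "p \<in> fst c"
  shows "v = (\<lambda>f. \<Sum>k\<in>UNIV. coord_diff c k v * coord_vec A c k p f)"
  by (rule tangentE[OF assms]) (use assms in \<open>auto simp: coord_diff_coord_deriv coord_deriv_expand\<close>)

lemma tangent_apply:
  assumes "v \<in> tangent_space A p" "c \<in> A" "p \<in> fst c"
  shows "v f = (\<Sum>k\<in>UNIV. coord_diff c k v * coord_vec A c k p f)"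
  using tangent_expand[OF assms] by (rule fun_cong)

lemma tangent_eqI:
  assumes "u \<in> tangent_space A p" "v \<in> tangent_space A p" "c \<in> A" "p \<in> fst c"
    and "\<And>k. coord_diff c k u = coord_diff c k v"
  shows "u = v"
  using tangent_expand[OF assms(1,3,4)] tangent_expand[OF assms(2,3,4)] assms(5) by simp

lemma tangent_combI:
  assumes "c \<in> A" "p \<in> fst c"
  shows "(\<lambda>f. \<Sum>k\<in>UNIV. a k * coord_vec A c k p f) \<in> tangent_space A p"
proof -
  have "(\<lambda>f. \<Sum>k\<in>UNIV. a k * coord_vec A c k p f) = coord_deriv A c p (\<chi> k. a k)"
    by (simp add: fun_eq_iff coord_deriv_expand[OF assms])
  then show ?thesis using tangent_space_chart[OF assms] by simp
qed

lemma coord_diff_comb: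
  assumes "c \<in> A" "p \<in> fst c"
  shows "coord_diff c l (\<lambda>f. \<Sum>k\<in>UNIV. a k * coord_vec A c k p f) = a l"
  using coord_diff_coord_vec[OF assms] by (simp add: coord_diff_def if_distrib[of "\<lambda>x. _ * x"] cong: if_cong)

lemma tangent_space_add:
  assumes "u \<in> tangent_space A p" "v \<in> tangent_space A p"
  shows "(\<lambda>f. u f + v f) \<in> tangent_space A p"
proof -
  obtain c where c: "c \<in> A" "p \<in> fst c" using carrier_chart[OF tangent_carrier[OF assms(1)]] by blast
  have "(\<lambda>f. u f + v f) = (\<lambda>f. \<Sum>k\<in>UNIV. (coord_diff c k u + coord_diff c k v) * coord_vec A c k p f)"
    using tangent_apply[OF assms(1) c] tangent_apply[OF assms(2) c] by (simp add: distrib_right sum.distrib fun_eq_iff)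
  then show ?thesis using tangent_combI[OF c] by simp
qed

lemma tangent_space_scale:
  assumes "u \<in> tangent_space A p"
  shows "(\<lambda>f. a * u f) \<in> tangent_space A p"
proof -
  obtain c where c: "c \<in> A" "p \<in> fst c" using carrier_chart[OF tangent_carrier[OF assms(1)]] by blast
  have "(\<lambda>f. a * u f) = (\<lambda>f. \<Sum>k\<in>UNIV. (a * coord_diff c k u) * coord_vec A c k p f)"
    by (rule ext, subst tangent_apply[OF assms(1) c]) (simp add: sum_distrib_left mult.assoc)
  then show ?thesis using tangent_combI[OF c] by simp
qed

lemma tangent_space_zero: "p \<in> carrier A \<Longrightarrow> (\<lambda>f. 0) \<in> tangent_space A p"
  using tangent_combI[OF chart_at, of p "\<lambda>k. 0"] by simp

lemma tangent_space_sum: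
  "p \<in> carrier A \<Longrightarrow> (\<And>i. i \<in> I \<Longrightarrow> u i \<in> tangent_space A p) \<Longrightarrow> (\<lambda>f. \<Sum>i\<in>I. u i f) \<in> tangent_space A p"
  by (induction I rule: infinite_finite_induct) (auto intro: tangent_space_zero tangent_space_add)

text \<open>The Jacobian matrices of the two changes of coordinates are inverse to each other:
  expand a coordinate vector of \<open>c\<close> in the basis of \<open>d\<close> and apply it to
  the coordinates of \<open>c\<close>.\<close>

lemma coord_vec_change:
  assumes "c \<in> A" "p \<in> fst c" "d \<in> A" "p \<in> fst d"
  shows "(\<Sum>a\<in>UNIV. coord_vec A c i p (\<lambda>q. snd d q $ a) * coord_vec A d a p (\<lambda>q. snd c q $ j)) = (if i = j then 1 else 0)"
  using tangent_apply[OF coord_vec_tangent[OF assms(1,2)] assms(3,4), of i "\<lambda>q. snd c q $ j"]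
    coord_diff_coord_vec[OF assms(1,2)] by (simp add: coord_diff_def)

section \<open>Vector fields and the Lie bracket\<close>

lemma vector_field_openin: "vector_field A U X \<Longrightarrow> openin (mtop A) U"
  by (simp add: vector_field_def)

lemma vector_field_tangent: "vector_field A U X \<Longrightarrow> p \<in> U \<Longrightarrow> X p \<in> tangent_space A p"
  by (simp add: vector_field_def)

lemma vector_field_apply: "vector_field A U X \<Longrightarrow> V \<subseteq> U \<Longrightarrow> smooth_fun A V f \<Longrightarrow> smooth_fun A V (\<lambda>q. X q f)"
  by (simp add: vector_field_def)

lemma vector_field_subset:
  assumes "vector_field A U X" "openin (mtop A) V" "V \<subseteq> U"
  shows "vector_field A V X"
  unfolding vector_field_def
  using assms(2,3) vector_field_tangent[OF assms(1)] vector_field_apply[OF assms(1)] by auto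

lemma vector_field_smooth_at:
  assumes "vector_field A U X" "p \<in> U" "smooth_at A p f"
  shows "smooth_at A p (\<lambda>q. X q f)"
proof -
  obtain W where W: "p \<in> W" "smooth_fun A W f" using assms(3) by (auto simp: smooth_at_def)
  have "smooth_fun A (W \<inter> U) (\<lambda>q. X q f)"
    by (rule vector_field_apply[OF assms(1)]) (use W assms(1) in \<open>auto intro: smooth_fun_Int1 vector_field_openin\<close>)
  then show ?thesis using W assms(2) by (auto intro: smooth_atI)
qed

text \<open>The gluing principle for fields that are known only chart by chart, such as the values
  of the Levi-Civita connection.\<close>

lemma vector_fieldI_local:
  assumes U: "openin (mtop A) U"
    and loc: "\<And>p. p \<in> U \<Longrightarrow> \<exists>V Y. p \<in> V \<and> vector_field A V Y \<and> (\<forall>q\<in>V \<inter> U. X q = Y q)"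
  shows "vector_field A U X"
  unfolding vector_field_def
proof (intro conjI U ballI allI impI)
  fix p assume p: "p \<in> U"
  then obtain V Y where "p \<in> V" "vector_field A V Y" "\<forall>q\<in>V \<inter> U. X q = Y q" using loc by blast
  then show "X p \<in> tangent_space A p" using p vector_field_tangent by auto
next
  fix W f assume W: "W \<subseteq> U \<and> smooth_fun A W f"
  show "smooth_fun A W (\<lambda>q. X q f)"
  proof (rule smooth_fun_local)
    show "openin (mtop A) W" using W smooth_fun_openin by blast
    fix p assume p: "p \<in> W"
    then obtain V Y where V: "p \<in> V" "vector_field A V Y" "\<forall>q\<in>V \<inter> U. X q = Y q" using loc W by blast
    have "smooth_fun A (W \<inter> V) (\<lambda>q. Y q f)"
      by (rule vector_field_apply[OF V(2)]) (use W V in \<open>auto intro: smooth_fun_Int1 vector_field_openin\<close>)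
    then have "smooth_fun A (W \<inter> V) (\<lambda>q. X q f)"
      by (rule smooth_fun_cong) (use V W in auto)
    then show "\<exists>V. p \<in> V \<and> smooth_fun A V (\<lambda>q. X q f)" using p V(1) by blast
  qed
qed

lemma vector_field_add:
  assumes "vector_field A U X" "vector_field A U Y"
  shows "vector_field A U (\<lambda>q f. X q f + Y q f)"
  using assms unfolding vector_field_def by (auto intro: tangent_space_add smooth_fun_add)

lemma vector_field_scale:
  assumes "vector_field A U X" "smooth_fun A U h"
  shows "vector_field A U (\<lambda>q f. h q * X q f)"
  using assms unfolding vector_field_def
  by (auto intro!: tangent_space_scale smooth_fun_mult intro: smooth_fun_subset smooth_fun_openin)

lemma vector_field_zero: "openin (mtop A) U \<Longrightarrow> vector_field A U (\<lambda>q f. 0)"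
  unfolding vector_field_def
  by (auto simp: openin_mtop intro: tangent_space_zero smooth_fun_const smooth_fun_openin)

lemma vector_field_sum:
  "openin (mtop A) U \<Longrightarrow> (\<And>i. i \<in> I \<Longrightarrow> vector_field A U (X i)) \<Longrightarrow> vector_field A U (\<lambda>q f. \<Sum>i\<in>I. X i q f)"
  by (induction I rule: infinite_finite_induct) (auto intro: vector_field_zero vector_field_add)

lemma vector_field_coord:
  assumes c: "c \<in> A"
  shows "vector_field A (fst c) (coord_vec A c i)"
  unfolding vector_field_def
proof (intro conjI ballI allI impI)
  show "openin (mtop A) (fst c)" by (rule openin_chart[OF c])
  show "coord_vec A c i p \<in> tangent_space A p" if "p \<in> fst c" for p
    by (rule coord_vec_tangent[OF c that])
  fix V f assume V: "V \<subseteq> fst c \<and> smooth_fun A V f"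
  then have o: "openin (mtop A) V" and eq: "V \<inter> fst c = V" by (auto intro: smooth_fun_openin)
  have S: "open (snd c ` V)" using open_chart_image[OF o c] eq by simp
  show "smooth_fun A V (\<lambda>q. coord_vec A c i q f)"
  proof (rule smooth_funI_chart[OF c o])
    show "V \<subseteq> fst c" using V by simp
    show "smooth_on (snd c ` V) (chart_rep c (\<lambda>q. coord_vec A c i q f))"
    proof (rule smooth_on_cong[OF S])
      show "smooth_on (snd c ` V) (\<lambda>x. frechet_derivative (chart_rep c f) (at x) (axis i 1))"
        using V c eq by (intro smooth_on_frechet_derivative) (force simp: smooth_fun_iff)
      fix x assume "x \<in> snd c ` V"
      then obtain q where q: "q \<in> V" "x = snd c q" by blast
      then have "smooth_at A q f" "q \<in> fst c" using V smooth_atI by auto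
      then show "frechet_derivative (chart_rep c f) (at x) (axis i 1) = chart_rep c (\<lambda>q. coord_vec A c i q f) x"
        using q c by (simp add: coord_vec_def coord_deriv_eq)
    qed
  qed
qed

lemma vector_field_component:
  assumes "vector_field A U X" "c \<in> A"
  shows "smooth_fun A (U \<inter> fst c) (\<lambda>q. coord_diff c k (X q))"
  unfolding coord_diff_def
  by (rule vector_field_apply[OF assms(1)])
    (use assms in \<open>auto intro: smooth_fun_Int2 smooth_fun_coord vector_field_openin\<close>)

lemma vector_field_comb:
  assumes "c \<in> A" "openin (mtop A) U" "U \<subseteq> fst c" "\<And>k. smooth_fun A U (a k)"
  shows "vector_field A U (\<lambda>q f. \<Sum>k\<in>UNIV. a k q * coord_vec A c k q f)"
  by (intro vector_field_sum vector_field_scale vector_field_subset[OF vector_field_coord] assms)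

text \<open>On the image of a neighbourhood where \<open>f\<close> is smooth, the coordinate
  expression of a coordinate derivative is a directional derivative of \<open>chart_rep c f\<close>,
  so symmetry of second derivatives applies.\<close>

lemma coord_vec_commute:
  assumes c: "c \<in> A" "p \<in> fst c" and f: "smooth_at A p f"
  shows "coord_vec A c i p (\<lambda>q. coord_vec A c j q f) = coord_vec A c j p (\<lambda>q. coord_vec A c i q f)"
proof -
  obtain W where W: "p \<in> W" "smooth_fun A W f" using f by (auto simp: smooth_at_def)
  let ?V = "W \<inter> fst c" and ?S = "snd c ` (W \<inter> fst c)"
  have S: "open ?S" by (rule open_chart_image[OF smooth_fun_openin[OF W(2)] c(1)])
  have pS: "snd c p \<in> ?S" using W c by auto
  have s: "smooth_on ?S (chart_rep c f)" using W(2) c by (simp add: smooth_fun_iff)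
  have *: "coord_vec A c i p (\<lambda>q. coord_vec A c j q f) =
      frechet_derivative (\<lambda>x. frechet_derivative (chart_rep c f) (at x) (axis j 1)) (at (snd c p)) (axis i 1)" for i j
  proof -
    have "frechet_derivative (chart_rep c (\<lambda>q. coord_vec A c j q f)) (at (snd c p)) =
        frechet_derivative (\<lambda>x. frechet_derivative (chart_rep c f) (at x) (axis j 1)) (at (snd c p))"
    proof (rule differentiable_cong_open[OF S pS])
      show "(\<lambda>x. frechet_derivative (chart_rep c f) (at x) (axis j 1)) differentiable (at (snd c p))"
        by (rule smooth_on_differentiable[OF smooth_on_frechet_derivative[OF s] pS])
      fix x assume "x \<in> ?S"
      then obtain q where q: "q \<in> W" "q \<in> fst c" "x = snd c q" by blast
      then have "smooth_at A q f" using W smooth_atI by auto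
      then show "frechet_derivative (chart_rep c f) (at x) (axis j 1) = chart_rep c (\<lambda>q. coord_vec A c j q f) x"
        using q c by (simp add: coord_vec_def coord_deriv_eq)
    qed
    then show ?thesis
      using vector_field_smooth_at[OF vector_field_coord[OF c(1)] c(2) f, of j]
      unfolding coord_vec_def[of A c i] by (simp add: coord_deriv_eq)
  qed
  show ?thesis unfolding * by (rule frechet_derivative_commute[OF s S pS])
qed

lemma lie_bracket_apply:
  "smooth_at A p f \<Longrightarrow> lie_bracket A X Y p f = X p (\<lambda>q. Y q f) - Y p (\<lambda>q. X q f)"
  by (simp add: lie_bracket_def)

lemma tangent_vector_field_expand:
  assumes v: "v \<in> tangent_space A p" and Y: "vector_field A U Y" "p \<in> U" and c: "c \<in> A" "p \<in> fst c"
    and f: "smooth_at A p f"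
  shows "v (\<lambda>q. Y q f) = (\<Sum>k\<in>UNIV. v (\<lambda>q. coord_diff c k (Y q)) * coord_vec A c k p f
      + coord_diff c k (Y p) * v (\<lambda>q. coord_vec A c k q f))"
proof -
  have s: "smooth_at A p (\<lambda>q. coord_diff c k (Y q))" "smooth_at A p (\<lambda>q. coord_vec A c k q f)" for k
    using vector_field_component[OF Y(1) c(1)] Y c f
    by (auto intro: smooth_atI vector_field_smooth_at vector_field_coord)
  have "v (\<lambda>q. Y q f) = v (\<lambda>q. \<Sum>k\<in>UNIV. coord_diff c k (Y q) * coord_vec A c k q f)"
  proof (rule tangent_cong[OF v, of "U \<inter> fst c"])
    show "openin (mtop A) (U \<inter> fst c)" using Y c by (blast intro: openin_Int vector_field_openin openin_chart)
    show "Y q f = (\<Sum>k\<in>UNIV. coord_diff c k (Y q) * coord_vec A c k q f)" if "q \<in> U \<inter> fst c" for q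
      using tangent_apply[OF vector_field_tangent[OF Y(1)] c(1)] that by blast
  qed (use Y c in auto)
  also have "\<dots> = (\<Sum>k\<in>UNIV. v (\<lambda>q. coord_diff c k (Y q) * coord_vec A c k q f))"
    by (rule tangent_sum[OF v smooth_at_mult[OF s]])
  finally show ?thesis by (simp add: tangent_mult[OF v s])
qed

text \<open>Expanding both fields leaves second-order terms in \<open>f\<close>; these cancel by
  \<open>coord_vec_commute\<close>, and only derivatives of the components survive. This is also why
  the bracket is again a tangent vector.\<close>

lemma lie_bracket_expand:
  assumes X: "vector_field A U X" "p \<in> U" and Y: "vector_field A U Y" and c: "c \<in> A" "p \<in> fst c"
  shows "lie_bracket A X Y p = (\<lambda>f. \<Sum>k\<in>UNIV.
    (X p (\<lambda>q. coord_diff c k (Y q)) - Y p (\<lambda>q. coord_diff c k (X q))) * coord_vec A c k p f)"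
proof
  fix f
  note tX = vector_field_tangent[OF X] and tY = vector_field_tangent[OF Y X(2)]
  show "lie_bracket A X Y p f = (\<Sum>k\<in>UNIV.
    (X p (\<lambda>q. coord_diff c k (Y q)) - Y p (\<lambda>q. coord_diff c k (X q))) * coord_vec A c k p f)"
  proof (cases "smooth_at A p f")
    case True
    have "(\<Sum>k\<in>UNIV. coord_diff c k (Y p) * X p (\<lambda>q. coord_vec A c k q f))
        = (\<Sum>k\<in>UNIV. \<Sum>i\<in>UNIV. coord_diff c k (Y p) * (coord_diff c i (X p) * coord_vec A c i p (\<lambda>q. coord_vec A c k q f)))"
      by (subst tangent_apply[OF tX c]) (simp add: sum_distrib_left)
    also have "\<dots> = (\<Sum>i\<in>UNIV. \<Sum>k\<in>UNIV. coord_diff c i (X p) * (coord_diff c k (Y p) * coord_vec A c k p (\<lambda>q. coord_vec A c i q f)))"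
      by (subst sum.swap) (simp add: coord_vec_commute[OF c True, of _ _] mult.left_commute)
    also have "\<dots> = (\<Sum>k\<in>UNIV. coord_diff c k (X p) * Y p (\<lambda>q. coord_vec A c k q f))"
      by (subst tangent_apply[OF tY c]) (simp add: sum_distrib_left)
    finally show ?thesis
      by (simp add: lie_bracket_apply[OF True] tangent_vector_field_expand[OF tX Y X(2) c True]
          tangent_vector_field_expand[OF tY X c True] sum.distrib sum_subtractf left_diff_distrib)
  next
    case False
    then show ?thesis by (simp add: lie_bracket_def tangent_not_smooth[OF coord_vec_tangent[OF c] False])
  qed
qed

lemma coord_diff_lie_bracket:
  assumes "vector_field A U X" "p \<in> U" "vector_field A U Y" "c \<in> A" "p \<in> fst c"
  shows "coord_diff c k (lie_bracket A X Y p) = X p (\<lambda>q. coord_diff c k (Y q)) - Y p (\<lambda>q. coord_diff c k (X q))"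
  unfolding lie_bracket_expand[OF assms] by (rule coord_diff_comb[OF assms(4,5)])

lemma vector_field_lie_bracket:
  assumes X: "vector_field A U X" and Y: "vector_field A U Y"
  shows "vector_field A U (lie_bracket A X Y)"
  unfolding vector_field_def
proof (intro conjI ballI allI impI)
  show "openin (mtop A) U" by (rule vector_field_openin[OF X])
  show "lie_bracket A X Y p \<in> tangent_space A p" if p: "p \<in> U" for p
  proof -
    have "p \<in> carrier A" using p vector_field_openin[OF X] by (auto simp: openin_mtop)
    then obtain c where c: "c \<in> A" "p \<in> fst c" using carrier_chart by blast
    then show ?thesis unfolding lie_bracket_expand[OF X p Y c] by (rule tangent_combI)
  qed
  fix V f assume V: "V \<subseteq> U \<and> smooth_fun A V f"
  then have "smooth_fun A V (\<lambda>q. X q (\<lambda>r. Y r f) - Y q (\<lambda>r. X r f))"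
    by (intro smooth_fun_diff vector_field_apply[OF X] vector_field_apply[OF Y]) auto
  then show "smooth_fun A V (\<lambda>q. lie_bracket A X Y q f)"
    by (rule smooth_fun_cong) (use V in \<open>auto simp: lie_bracket_apply smooth_atI\<close>)
qed

lemma lie_bracket_coord_vec:
  assumes "c \<in> A" "p \<in> fst c"
  shows "lie_bracket A (coord_vec A c i) (coord_vec A c j) p = (\<lambda>f. 0)"
  using coord_vec_commute[OF assms] by (auto simp: lie_bracket_def)

lemma local_extension:
  assumes "v \<in> tangent_space A p"
  obtains U where "p \<in> U" "vector_field A U (local_extension A p v)" "local_extension A p v p = v"
proof -
  obtain c where c: "c \<in> A" "p \<in> fst c" using carrier_chart[OF tangent_carrier[OF assms]] by blast
  \<comment> \<open>The field with constant components in one chart witnesses the choice made in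
    \<open>local_extension\<close>.\<close>
  let ?X = "\<lambda>q f. \<Sum>k\<in>UNIV. coord_diff c k v * coord_vec A c k q f"
  have "vector_field A (fst c) ?X"
    by (rule vector_field_comb) (auto intro: c openin_chart smooth_fun_const)
  moreover have "?X p = v" using tangent_expand[OF assms c] by simp
  ultimately have "\<exists>X. X p = v \<and> (\<exists>U. p \<in> U \<and> vector_field A U X)"
    by (intro exI[of _ ?X] conjI exI[of _ "fst c"] c(2))
  from someI_ex[OF this] show ?thesis
    using that unfolding local_extension_def by blast
qed

end

section \<open>Connections in coordinates\<close>

lemma sum_rotate3:
  fixes f :: "'a \<Rightarrow> 'b \<Rightarrow> 'c \<Rightarrow> 'd::comm_monoid_add"
  shows "(\<Sum>j\<in>J. \<Sum>k\<in>K. \<Sum>i\<in>I. f i j k) = (\<Sum>i\<in>I. \<Sum>j\<in>J. \<Sum>k\<in>K. f i j k)"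
  by (simp add: sum.swap[of _ I K] sum.swap[of _ I J])

text \<open>Levi-Civita connections will be built chart by chart, so the axioms of a connection are
  needed for the fields defined on open subsets of a set \<open>W\<close>.\<close>

locale local_connection = smooth_atlas A
  for A :: "('m, 'n::finite) chart set" +
  fixes D :: "('m \<Rightarrow> 'm tvec) \<Rightarrow> ('m \<Rightarrow> 'm tvec) \<Rightarrow> 'm \<Rightarrow> 'm tvec" and W :: "'m set"
  assumes conn_field: "U \<subseteq> W \<Longrightarrow> vector_field A U X \<Longrightarrow> vector_field A U Y \<Longrightarrow> vector_field A U (D X Y)"
    and conn_cong: "U \<subseteq> W \<Longrightarrow> vector_field A U X \<Longrightarrow> vector_field A U X' \<Longrightarrow>
      vector_field A U Y \<Longrightarrow> vector_field A U Y' \<Longrightarrow> (\<And>p. p \<in> U \<Longrightarrow> X p = X' p \<and> Y p = Y' p) \<Longrightarrow>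
      p \<in> U \<Longrightarrow> D X Y p = D X' Y' p"
    and conn_add_left: "U \<subseteq> W \<Longrightarrow> vector_field A U X \<Longrightarrow> vector_field A U X' \<Longrightarrow> vector_field A U Y \<Longrightarrow>
      p \<in> U \<Longrightarrow> D (\<lambda>q f. X q f + X' q f) Y p = (\<lambda>f. D X Y p f + D X' Y p f)"
    and conn_scale_left: "U \<subseteq> W \<Longrightarrow> smooth_fun A U h \<Longrightarrow> vector_field A U X \<Longrightarrow> vector_field A U Y \<Longrightarrow>
      p \<in> U \<Longrightarrow> D (\<lambda>q f. h q * X q f) Y p = (\<lambda>f. h p * D X Y p f)"
    and conn_add_right: "U \<subseteq> W \<Longrightarrow> vector_field A U X \<Longrightarrow> vector_field A U Y \<Longrightarrow> vector_field A U Y' \<Longrightarrow>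
      p \<in> U \<Longrightarrow> D X (\<lambda>q f. Y q f + Y' q f) p = (\<lambda>f. D X Y p f + D X Y' p f)"
    and conn_leibniz: "U \<subseteq> W \<Longrightarrow> smooth_fun A U h \<Longrightarrow> vector_field A U X \<Longrightarrow> vector_field A U Y \<Longrightarrow>
      p \<in> U \<Longrightarrow> D X (\<lambda>q f. h q * Y q f) p = (\<lambda>f. X p h * Y p f + h p * D X Y p f)"
begin

lemma conn_zero_left:
  assumes "U \<subseteq> W" "vector_field A U Y" "p \<in> U"
  shows "D (\<lambda>q f. 0) Y p = (\<lambda>f. 0)"
proof -
  have "vector_field A U (\<lambda>q f. 0)" by (rule vector_field_zero[OF vector_field_openin[OF assms(2)]])
  from conn_add_left[OF assms(1) this this assms(2,3)] show ?thesis by (simp add: fun_eq_iff)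
qed

lemma conn_zero_right:
  assumes "U \<subseteq> W" "vector_field A U X" "p \<in> U"
  shows "D X (\<lambda>q f. 0) p = (\<lambda>f. 0)"
proof -
  have "vector_field A U (\<lambda>q f. 0)" by (rule vector_field_zero[OF vector_field_openin[OF assms(2)]])
  from conn_add_right[OF assms(1,2) this this assms(3)] show ?thesis by (simp add: fun_eq_iff)
qed

lemma conn_sum_left:
  assumes U: "U \<subseteq> W" and Y: "vector_field A U Y" and p: "p \<in> U" and I: "finite I"
    and h: "\<And>i. i \<in> I \<Longrightarrow> smooth_fun A U (h i)" and X: "\<And>i. i \<in> I \<Longrightarrow> vector_field A U (X i)"
  shows "D (\<lambda>q f. \<Sum>i\<in>I. h i q * X i q f) Y p = (\<lambda>f. \<Sum>i\<in>I. h i p * D (X i) Y p f)"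
  using I h X
proof (induction I)
  case empty
  then show ?case using conn_zero_left[OF U Y p] by simp
next
  case (insert i I)
  have "vector_field A U (\<lambda>q f. \<Sum>i\<in>I. h i q * X i q f)"
    by (intro vector_field_sum vector_field_scale insert.prems vector_field_openin[OF Y]) auto
  moreover have "vector_field A U (\<lambda>q f. h i q * X i q f)"
    by (intro vector_field_scale insert.prems) auto
  ultimately have "D (\<lambda>q f. h i q * X i q f + (\<Sum>i\<in>I. h i q * X i q f)) Y p
      = (\<lambda>f. D (\<lambda>q f. h i q * X i q f) Y p f + D (\<lambda>q f. \<Sum>i\<in>I. h i q * X i q f) Y p f)"
    by (intro conn_add_left[OF U _ _ Y p])
  moreover have "D (\<lambda>q f. h i q * X i q f) Y p = (\<lambda>f. h i p * D (X i) Y p f)"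
    by (rule conn_scale_left[OF U _ _ Y p]) (simp_all add: insert.prems)
  moreover have "D (\<lambda>q f. \<Sum>i\<in>I. h i q * X i q f) Y p = (\<lambda>f. \<Sum>i\<in>I. h i p * D (X i) Y p f)"
    by (rule insert.IH) (simp_all add: insert.prems)
  ultimately show ?case using insert.hyps by simp
qed

lemma conn_sum_right:
  assumes U: "U \<subseteq> W" and X: "vector_field A U X" and p: "p \<in> U" and I: "finite I"
    and h: "\<And>i. i \<in> I \<Longrightarrow> smooth_fun A U (h i)" and Y: "\<And>i. i \<in> I \<Longrightarrow> vector_field A U (Y i)"
  shows "D X (\<lambda>q f. \<Sum>i\<in>I. h i q * Y i q f) p = (\<lambda>f. \<Sum>i\<in>I. X p (h i) * Y i p f + h i p * D X (Y i) p f)"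
  using I h Y
proof (induction I)
  case empty
  then show ?case using conn_zero_right[OF U X p] by simp
next
  case (insert i I)
  have "vector_field A U (\<lambda>q f. \<Sum>i\<in>I. h i q * Y i q f)"
    by (intro vector_field_sum vector_field_scale insert.prems vector_field_openin[OF X]) auto
  moreover have "vector_field A U (\<lambda>q f. h i q * Y i q f)"
    by (intro vector_field_scale insert.prems) auto
  ultimately have "D X (\<lambda>q f. h i q * Y i q f + (\<Sum>i\<in>I. h i q * Y i q f)) p
      = (\<lambda>f. D X (\<lambda>q f. h i q * Y i q f) p f + D X (\<lambda>q f. \<Sum>i\<in>I. h i q * Y i q f) p f)"
    by (intro conn_add_right[OF U X _ _ p])
  moreover have "D X (\<lambda>q f. h i q * Y i q f) p = (\<lambda>f. X p (h i) * Y i p f + h i p * D X (Y i) p f)"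
    by (rule conn_leibniz[OF U _ X _ p]) (simp_all add: insert.prems)
  moreover have "D X (\<lambda>q f. \<Sum>i\<in>I. h i q * Y i q f) p = (\<lambda>f. \<Sum>i\<in>I. X p (h i) * Y i p f + h i p * D X (Y i) p f)"
    by (rule insert.IH) (simp_all add: insert.prems)
  ultimately show ?case using insert.hyps by simp
qed

text \<open>Linearity in \<open>X\<close> and the Leibniz rule in \<open>Y\<close>, applied to
  coordinate expansions. The expansions agree with the fields only on the chart domain, so
  everything is restricted there and exchanged by \<open>conn_cong\<close>.\<close>

lemma coord_diff_conn:
  assumes U: "U \<subseteq> W" and X: "vector_field A U X" and Y: "vector_field A U Y" and p: "p \<in> U"
    and c: "c \<in> A" "p \<in> fst c"
  shows "coord_diff c k (D X Y p) = X p (\<lambda>q. coord_diff c k (Y q))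
    + (\<Sum>i\<in>UNIV. \<Sum>j\<in>UNIV. coord_diff c i (X p) * coord_diff c j (Y p) * christoffel A D c i j k p)"
proof -
  define V where "V = U \<inter> fst c"
  have oV: "openin (mtop A) V" unfolding V_def by (intro openin_Int vector_field_openin[OF X] openin_chart c)
  have V: "V \<subseteq> W" "V \<subseteq> U" "V \<subseteq> fst c" "p \<in> V" using U p c by (auto simp: V_def)
  note XV = vector_field_subset[OF X oV V(2)] and YV = vector_field_subset[OF Y oV V(2)]
  have E: "vector_field A V (coord_vec A c i)" for i
    by (rule vector_field_subset[OF vector_field_coord[OF c(1)] oV V(3)])
  have comp: "smooth_fun A V (\<lambda>q. coord_diff c i (X q))" "smooth_fun A V (\<lambda>q. coord_diff c i (Y q))" for i
    using vector_field_component[OF X c(1)] vector_field_component[OF Y c(1)] by (simp_all add: V_def)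
  let ?X = "\<lambda>q f. \<Sum>i\<in>UNIV. coord_diff c i (X q) * coord_vec A c i q f"
  let ?Y = "\<lambda>q f. \<Sum>i\<in>UNIV. coord_diff c i (Y q) * coord_vec A c i q f"
  have X': "vector_field A V ?X" and Y': "vector_field A V ?Y"
    by (rule vector_field_comb[OF c(1) oV V(3) comp(1)] vector_field_comb[OF c(1) oV V(3) comp(2)])+
  have eq: "X q = ?X q" "Y q = ?Y q" if "q \<in> V" for q
    using tangent_expand[OF vector_field_tangent[OF XV that] c(1)]
      tangent_expand[OF vector_field_tangent[OF YV that] c(1)] that V(3) by auto
  have "D X Y p = D ?X Y p"
    by (rule conn_cong[OF V(1) XV X' YV YV _ V(4)]) (use eq in blast)
  also have "\<dots> = (\<lambda>f. \<Sum>i\<in>UNIV. coord_diff c i (X p) * D (coord_vec A c i) Y p f)"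
    by (rule conn_sum_left[OF V(1) YV V(4)]) (auto intro: comp E)
  finally have 1: "D X Y p = (\<lambda>f. \<Sum>i\<in>UNIV. coord_diff c i (X p) * D (coord_vec A c i) Y p f)" .
  have 2: "D (coord_vec A c i) Y p = (\<lambda>f. \<Sum>j\<in>UNIV. coord_vec A c i p (\<lambda>q. coord_diff c j (Y q)) * coord_vec A c j p f
      + coord_diff c j (Y p) * D (coord_vec A c i) (coord_vec A c j) p f)" for i
  proof -
    have "D (coord_vec A c i) Y p = D (coord_vec A c i) ?Y p"
      by (rule conn_cong[OF V(1) E E YV Y' _ V(4)]) (use eq in blast)
    also have "\<dots> = (\<lambda>f. \<Sum>j\<in>UNIV. coord_vec A c i p (\<lambda>q. coord_diff c j (Y q)) * coord_vec A c j p f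
      + coord_diff c j (Y p) * D (coord_vec A c i) (coord_vec A c j) p f)"
      by (rule conn_sum_right[OF V(1) E V(4)]) (auto intro: comp E)
    finally show ?thesis .
  qed
  have 3: "coord_diff c k (D (coord_vec A c i) Y p) = coord_vec A c i p (\<lambda>q. coord_diff c k (Y q))
      + (\<Sum>j\<in>UNIV. coord_diff c j (Y p) * christoffel A D c i j k p)" for i
  proof -
    have "coord_diff c k (D (coord_vec A c i) Y p) =
        (\<Sum>j\<in>UNIV. coord_vec A c i p (\<lambda>q. coord_diff c j (Y q)) * coord_diff c k (coord_vec A c j p))
        + (\<Sum>j\<in>UNIV. coord_diff c j (Y p) * christoffel A D c i j k p)"
      unfolding 2 by (simp add: coord_diff_def christoffel_def sum.distrib)
    then show ?thesis by (simp add: coord_diff_coord_vec[OF c] if_distrib[of "\<lambda>x. _ * x"] cong: if_cong)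
  qed
  have "coord_diff c k (D X Y p) = (\<Sum>i\<in>UNIV. coord_diff c i (X p) * coord_diff c k (D (coord_vec A c i) Y p))"
    unfolding 1 by (simp add: coord_diff_def)
  also have "\<dots> = (\<Sum>i\<in>UNIV. coord_diff c i (X p) * coord_vec A c i p (\<lambda>q. coord_diff c k (Y q)))
    + (\<Sum>i\<in>UNIV. \<Sum>j\<in>UNIV. coord_diff c i (X p) * coord_diff c j (Y p) * christoffel A D c i j k p)"
    unfolding 3 by (simp add: distrib_left sum.distrib sum_distrib_left mult.assoc)
  also have "(\<Sum>i\<in>UNIV. coord_diff c i (X p) * coord_vec A c i p (\<lambda>q. coord_diff c k (Y q)))
      = X p (\<lambda>q. coord_diff c k (Y q))"
    by (rule tangent_apply[OF vector_field_tangent[OF X p] c, symmetric])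
  finally show ?thesis .
qed

lemma christoffel_smooth:
  assumes "c \<in> A" "openin (mtop A) U" "U \<subseteq> fst c" "U \<subseteq> W"
  shows "smooth_fun A U (christoffel A D c i j k)"
proof -
  have E: "vector_field A U (coord_vec A c i)" for i
    by (rule vector_field_subset[OF vector_field_coord[OF assms(1)] assms(2,3)])
  have "smooth_fun A (U \<inter> fst c) (\<lambda>q. coord_diff c k (D (coord_vec A c i) (coord_vec A c j) q))"
    by (rule vector_field_component[OF conn_field[OF assms(4) E E] assms(1)])
  then show ?thesis using assms(3) by (simp add: christoffel_def[abs_def] Int_absorb2)
qed

end

locale atlas_connection = smooth_atlas A
  for A :: "('m, 'n::finite) chart set" +
  fixes D :: "('m \<Rightarrow> 'm tvec) \<Rightarrow> ('m \<Rightarrow> 'm tvec) \<Rightarrow> 'm \<Rightarrow> 'm tvec"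
  assumes conn: "connection A D"

sublocale atlas_connection \<subseteq> local_connection A D UNIV
proof
  note C = conn[unfolded connection_def]
  note c1 = C[THEN conjunct1, rule_format]
    and c2 = C[THEN conjunct2, THEN conjunct1, rule_format]
    and c3 = C[THEN conjunct2, THEN conjunct2, THEN conjunct1, rule_format]
    and c4 = C[THEN conjunct2, THEN conjunct2, THEN conjunct2, THEN conjunct1, rule_format]
    and c5 = C[THEN conjunct2, THEN conjunct2, THEN conjunct2, THEN conjunct2, THEN conjunct1, rule_format]
    and c6 = C[THEN conjunct2, THEN conjunct2, THEN conjunct2, THEN conjunct2, THEN conjunct2, rule_format]
  fix U h X X' Y Y' p
  show "vector_field A U X \<Longrightarrow> vector_field A U Y \<Longrightarrow> vector_field A U (D X Y)"
    by (rule c1) simp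
  show "vector_field A U X \<Longrightarrow> vector_field A U X' \<Longrightarrow> vector_field A U Y \<Longrightarrow> vector_field A U Y' \<Longrightarrow>
      (\<And>p. p \<in> U \<Longrightarrow> X p = X' p \<and> Y p = Y' p) \<Longrightarrow> p \<in> U \<Longrightarrow> D X Y p = D X' Y' p"
    by (rule c2[of U X X' Y Y']) simp_all
  show "vector_field A U X \<Longrightarrow> vector_field A U X' \<Longrightarrow> vector_field A U Y \<Longrightarrow>
      p \<in> U \<Longrightarrow> D (\<lambda>q f. X q f + X' q f) Y p = (\<lambda>f. D X Y p f + D X' Y p f)"
    by (rule c3[of U X X' Y]) simp_all
  show "smooth_fun A U h \<Longrightarrow> vector_field A U X \<Longrightarrow> vector_field A U Y \<Longrightarrow>
      p \<in> U \<Longrightarrow> D (\<lambda>q f. h q * X q f) Y p = (\<lambda>f. h p * D X Y p f)"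
    by (rule c4[of U h X Y]) simp_all
  show "vector_field A U X \<Longrightarrow> vector_field A U Y \<Longrightarrow> vector_field A U Y' \<Longrightarrow>
      p \<in> U \<Longrightarrow> D X (\<lambda>q f. Y q f + Y' q f) p = (\<lambda>f. D X Y p f + D X Y' p f)"
    by (rule c5[of U X Y Y']) simp_all
  show "smooth_fun A U h \<Longrightarrow> vector_field A U X \<Longrightarrow> vector_field A U Y \<Longrightarrow>
      p \<in> U \<Longrightarrow> D X (\<lambda>q f. h q * Y q f) p = (\<lambda>f. X p h * Y p f + h p * D X Y p f)"
    by (rule c6[of U h X Y]) simp_all
qed

section \<open>Curvature, trace and Ricci tensor in coordinates\<close>

context atlas_connection
begin

text \<open>The component of R(d_i, d_j) d_k along d_l, where d_i are the coordinate fields; these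
  commute, so no bracket term occurs.\<close>

definition curv_coeff :: "('m, 'n) chart \<Rightarrow> 'n \<Rightarrow> 'n \<Rightarrow> 'n \<Rightarrow> 'n \<Rightarrow> 'm \<Rightarrow> real" where
  "curv_coeff c i j k l p =
     coord_vec A c i p (christoffel A D c j k l) - coord_vec A c j p (christoffel A D c i k l)
     + (\<Sum>m\<in>UNIV. christoffel A D c j k m p * christoffel A D c i m l p
          - christoffel A D c i k m p * christoffel A D c j m l p)"

text \<open>The first lower index is contracted with the upper one, because the Ricci tensor is the
  trace over the first argument of the curvature.\<close>

definition ricci_coeff :: "('m, 'n) chart \<Rightarrow> 'n \<Rightarrow> 'n \<Rightarrow> 'm \<Rightarrow> real" where
  "ricci_coeff c i j p = (\<Sum>l\<in>UNIV. curv_coeff c l i j l p)"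

lemma christoffel_smooth_at: "c \<in> A \<Longrightarrow> p \<in> fst c \<Longrightarrow> smooth_at A p (christoffel A D c i j k)"
  by (rule smooth_atI[OF christoffel_smooth[OF _ openin_chart subset_refl]]) auto

text \<open>The product rule applied to \<open>coord_diff_conn\<close>; it supplies the derivative
  of a covariant derivative that occurs in the curvature.\<close>

lemma tangent_coord_diff_conn:
  assumes v: "v \<in> tangent_space A p" and Y: "vector_field A U Y" and Z: "vector_field A U Z"
    and p: "p \<in> U" and c: "c \<in> A" "p \<in> fst c"
  shows "v (\<lambda>q. coord_diff c l (D Y Z q)) = v (\<lambda>q. Y q (\<lambda>r. coord_diff c l (Z r)))
    + (\<Sum>j\<in>UNIV. \<Sum>k\<in>UNIV.
        (v (\<lambda>q. coord_diff c j (Y q)) * coord_diff c k (Z p) + coord_diff c j (Y p) * v (\<lambda>q. coord_diff c k (Z q)))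
          * christoffel A D c j k l p
        + coord_diff c j (Y p) * coord_diff c k (Z p) * v (christoffel A D c j k l))"
proof -
  have comp: "smooth_at A p (\<lambda>q. coord_diff c k (Y q))" "smooth_at A p (\<lambda>q. coord_diff c k (Z q))" for k
    using vector_field_component[OF Y c(1)] vector_field_component[OF Z c(1)] p c by (auto intro: smooth_atI)
  note G = christoffel_smooth_at[OF c]
  have s: "smooth_at A p (\<lambda>q. coord_diff c j (Y q) * coord_diff c k (Z q) * christoffel A D c j k l q)" for j k
    by (intro smooth_at_mult comp G)
  have "v (\<lambda>q. coord_diff c l (D Y Z q)) = v (\<lambda>q. Y q (\<lambda>r. coord_diff c l (Z r))
      + (\<Sum>j\<in>UNIV. \<Sum>k\<in>UNIV. coord_diff c j (Y q) * coord_diff c k (Z q) * christoffel A D c j k l q))"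
    by (rule tangent_cong[OF v, of "U \<inter> fst c"])
      (use coord_diff_conn[OF _ Y Z _ c(1)] openin_Int[OF vector_field_openin[OF Y] openin_chart[OF c(1)]] p c in auto)
  also have "\<dots> = v (\<lambda>q. Y q (\<lambda>r. coord_diff c l (Z r)))
      + v (\<lambda>q. \<Sum>j\<in>UNIV. \<Sum>k\<in>UNIV. coord_diff c j (Y q) * coord_diff c k (Z q) * christoffel A D c j k l q)"
    by (intro tangent_add[OF v] vector_field_smooth_at[OF Y p] comp smooth_at_sum s in_carrier[OF c])
  also have "v (\<lambda>q. \<Sum>j\<in>UNIV. \<Sum>k\<in>UNIV. coord_diff c j (Y q) * coord_diff c k (Z q) * christoffel A D c j k l q)
      = (\<Sum>j\<in>UNIV. \<Sum>k\<in>UNIV. v (\<lambda>q. coord_diff c j (Y q) * coord_diff c k (Z q) * christoffel A D c j k l q))"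
    by (subst tangent_sum[OF v]) (auto intro!: smooth_at_sum s in_carrier[OF c] sum.cong tangent_sum[OF v])
  also have "\<dots> = (\<Sum>j\<in>UNIV. \<Sum>k\<in>UNIV.
        (v (\<lambda>q. coord_diff c j (Y q)) * coord_diff c k (Z p) + coord_diff c j (Y p) * v (\<lambda>q. coord_diff c k (Z q)))
          * christoffel A D c j k l p
        + coord_diff c j (Y p) * coord_diff c k (Z p) * v (christoffel A D c j k l))"
    by (simp add: tangent_mult[OF v smooth_at_mult[OF comp] G] tangent_mult[OF v comp])
  finally show ?thesis .
qed

text \<open>Tensoriality of the curvature. The first derivatives of \<open>Z\<close> cancel between
  the two orders of differentiation; the second derivatives of \<open>Z\<close> and the derivatives
  of \<open>X\<close> and \<open>Y\<close> cancel against the bracket term. Only the values of the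
  fields at \<open>p\<close> remain.\<close>

lemma coord_diff_curvature:
  assumes X: "vector_field A U X" and Y: "vector_field A U Y" and Z: "vector_field A U Z"
    and p: "p \<in> U" and c: "c \<in> A" "p \<in> fst c"
  shows "coord_diff c l (curvature A D X Y Z p) = (\<Sum>i\<in>UNIV. \<Sum>j\<in>UNIV. \<Sum>k\<in>UNIV.
    coord_diff c i (X p) * coord_diff c j (Y p) * coord_diff c k (Z p) * curv_coeff c i j k l p)"
proof -
  note tX = vector_field_tangent[OF X p] and tY = vector_field_tangent[OF Y p]
  define x y z where "x = (\<lambda>i. coord_diff c i (X p))" and "y = (\<lambda>i. coord_diff c i (Y p))" and "z = (\<lambda>i. coord_diff c i (Z p))"
  define a b where "a = (\<lambda>j. X p (\<lambda>q. coord_diff c j (Y q)))" and "b = (\<lambda>j. Y p (\<lambda>q. coord_diff c j (X q)))"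
  define u v where "u = (\<lambda>j. X p (\<lambda>q. coord_diff c j (Z q)))" and "v = (\<lambda>j. Y p (\<lambda>q. coord_diff c j (Z q)))"
  define G where "G = (\<lambda>j k l. christoffel A D c j k l p)"
  define dG where "dG = (\<lambda>i j k. coord_vec A c i p (christoffel A D c j k l))"
  note defs = x_def y_def z_def a_def b_def u_def v_def G_def dG_def
  have XG: "X p (christoffel A D c j k l) = (\<Sum>i\<in>UNIV. x i * dG i j k)"
    "Y p (christoffel A D c j k l) = (\<Sum>i\<in>UNIV. y i * dG i j k)" for j k
    unfolding defs by (rule tangent_apply[OF tX c] tangent_apply[OF tY c])+
  have DYZ: "coord_diff c m (D Y Z p) = v m + (\<Sum>j\<in>UNIV. \<Sum>k\<in>UNIV. y j * z k * G j k m)" for m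
    unfolding defs by (rule coord_diff_conn[OF _ Y Z p c]) simp
  have DXZ: "coord_diff c m (D X Z p) = u m + (\<Sum>j\<in>UNIV. \<Sum>k\<in>UNIV. x j * z k * G j k m)" for m
    unfolding defs by (rule coord_diff_conn[OF _ X Z p c]) simp
  have 1: "coord_diff c l (D X (D Y Z) p) = X p (\<lambda>q. Y q (\<lambda>r. coord_diff c l (Z r)))
    + (\<Sum>j\<in>UNIV. \<Sum>k\<in>UNIV. (a j * z k + y j * u k) * G j k l + y j * z k * (\<Sum>i\<in>UNIV. x i * dG i j k))
    + (\<Sum>i\<in>UNIV. \<Sum>m\<in>UNIV. x i * (v m + (\<Sum>j\<in>UNIV. \<Sum>k\<in>UNIV. y j * z k * G j k m)) * G i m l)"
    using coord_diff_conn[OF _ X conn_field[OF _ Y Z] p c, of l] tangent_coord_diff_conn[OF tX Y Z p c, of l]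
    unfolding DYZ XG unfolding defs by simp
  have 2: "coord_diff c l (D Y (D X Z) p) = Y p (\<lambda>q. X q (\<lambda>r. coord_diff c l (Z r)))
    + (\<Sum>j\<in>UNIV. \<Sum>k\<in>UNIV. (b j * z k + x j * v k) * G j k l + x j * z k * (\<Sum>i\<in>UNIV. y i * dG i j k))
    + (\<Sum>i\<in>UNIV. \<Sum>m\<in>UNIV. y i * (u m + (\<Sum>j\<in>UNIV. \<Sum>k\<in>UNIV. x j * z k * G j k m)) * G i m l)"
    using coord_diff_conn[OF _ Y conn_field[OF _ X Z] p c, of l] tangent_coord_diff_conn[OF tY X Z p c, of l]
    unfolding DXZ XG unfolding defs by simp
  have Zl: "smooth_at A p (\<lambda>q. coord_diff c l (Z q))"
    using vector_field_component[OF Z c(1)] p c by (auto intro: smooth_atI)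
  have 3: "coord_diff c l (D (lie_bracket A X Y) Z p) = X p (\<lambda>q. Y q (\<lambda>r. coord_diff c l (Z r)))
    - Y p (\<lambda>q. X q (\<lambda>r. coord_diff c l (Z r))) + (\<Sum>j\<in>UNIV. \<Sum>k\<in>UNIV. (a j - b j) * z k * G j k l)"
    using coord_diff_conn[OF _ vector_field_lie_bracket[OF X Y] Z p c, of l]
    unfolding lie_bracket_apply[OF Zl] coord_diff_lie_bracket[OF X p Y c] unfolding defs by simp
  \<comment> \<open>\<open>R1\<close> to \<open>R4\<close> relabel the surviving sums so that in
    each of them \<open>x\<close>, \<open>y\<close>, \<open>z\<close> carry the indices
    \<open>i\<close>, \<open>j\<close>, \<open>k\<close>.\<close>
  have R1: "(\<Sum>j\<in>UNIV. \<Sum>k\<in>UNIV. y j * z k * (\<Sum>i\<in>UNIV. x i * dG i j k))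
      = (\<Sum>i\<in>UNIV. \<Sum>j\<in>UNIV. \<Sum>k\<in>UNIV. x i * y j * z k * dG i j k)"
    unfolding sum_distrib_left by (subst sum_rotate3) (simp add: ac_simps)
  have R2: "(\<Sum>j\<in>UNIV. \<Sum>k\<in>UNIV. x j * z k * (\<Sum>i\<in>UNIV. y i * dG i j k))
      = (\<Sum>i\<in>UNIV. \<Sum>j\<in>UNIV. \<Sum>k\<in>UNIV. x i * y j * z k * dG j i k)"
    unfolding sum_distrib_left by (rule sum.cong[OF refl], subst sum.swap) (simp add: ac_simps)
  have R3: "(\<Sum>i\<in>UNIV. \<Sum>m\<in>UNIV. x i * (\<Sum>j\<in>UNIV. \<Sum>k\<in>UNIV. y j * z k * G j k m) * G i m l)
      = (\<Sum>i\<in>UNIV. \<Sum>j\<in>UNIV. \<Sum>k\<in>UNIV. x i * y j * z k * (\<Sum>m\<in>UNIV. G j k m * G i m l))"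
    unfolding sum_distrib_left sum_distrib_right
    by (rule sum.cong[OF refl], subst sum_rotate3[symmetric]) (simp add: ac_simps)
  have R4: "(\<Sum>i\<in>UNIV. \<Sum>m\<in>UNIV. y i * (\<Sum>j\<in>UNIV. \<Sum>k\<in>UNIV. x j * z k * G j k m) * G i m l)
      = (\<Sum>i\<in>UNIV. \<Sum>j\<in>UNIV. \<Sum>k\<in>UNIV. x i * y j * z k * (\<Sum>m\<in>UNIV. G i k m * G j m l))"
    (is "?lhs = _")
  proof -
    have "?lhs = (\<Sum>j\<in>UNIV. \<Sum>i\<in>UNIV. \<Sum>k\<in>UNIV. x i * y j * z k * (\<Sum>m\<in>UNIV. G i k m * G j m l))"
      unfolding sum_distrib_left sum_distrib_right
      by (rule sum.cong[OF refl], subst sum_rotate3[symmetric]) (simp add: ac_simps)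
    also have "\<dots> = (\<Sum>i\<in>UNIV. \<Sum>j\<in>UNIV. \<Sum>k\<in>UNIV. x i * y j * z k * (\<Sum>m\<in>UNIV. G i k m * G j m l))"
      by (rule sum.swap)
    finally show ?thesis .
  qed
  have "coord_diff c l (curvature A D X Y Z p) = coord_diff c l (D X (D Y Z) p)
      - coord_diff c l (D Y (D X Z) p) - coord_diff c l (D (lie_bracket A X Y) Z p)"
    by (simp add: coord_diff_def curvature_def)
  also have "\<dots> = (\<Sum>i\<in>UNIV. \<Sum>j\<in>UNIV. \<Sum>k\<in>UNIV. x i * y j * z k * dG i j k)
      - (\<Sum>i\<in>UNIV. \<Sum>j\<in>UNIV. \<Sum>k\<in>UNIV. x i * y j * z k * dG j i k)
      + ((\<Sum>i\<in>UNIV. \<Sum>j\<in>UNIV. \<Sum>k\<in>UNIV. x i * y j * z k * (\<Sum>m\<in>UNIV. G j k m * G i m l))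
      - (\<Sum>i\<in>UNIV. \<Sum>j\<in>UNIV. \<Sum>k\<in>UNIV. x i * y j * z k * (\<Sum>m\<in>UNIV. G i k m * G j m l)))"
    unfolding 1 2 3 R1[symmetric] R2[symmetric] R3[symmetric] R4[symmetric]
    by (simp add: sum.distrib sum_subtractf distrib_left distrib_right left_diff_distrib right_diff_distrib)
  also have "\<dots> = (\<Sum>i\<in>UNIV. \<Sum>j\<in>UNIV. \<Sum>k\<in>UNIV. x i * y j * z k * (dG i j k - dG j i k
      + (\<Sum>m\<in>UNIV. G j k m * G i m l - G i k m * G j m l)))"
    by (simp add: sum.distrib sum_subtractf distrib_left right_diff_distrib)
  finally show ?thesis by (simp add: defs curv_coeff_def)
qed

lemma curvature_tangent:
  assumes "vector_field A U X" "vector_field A U Y" "vector_field A U Z" "p \<in> U"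
  shows "curvature A D X Y Z p \<in> tangent_space A p"
proof -
  have "vector_field A U (D X (D Y Z))" "vector_field A U (D Y (D X Z))" "vector_field A U (D (lie_bracket A X Y) Z)"
    by (simp_all add: conn_field vector_field_lie_bracket assms)
  note t = this[THEN vector_field_tangent[OF _ assms(4)]]
  show ?thesis
    using tangent_space_add[OF t(1) tangent_space_add[OF tangent_space_scale[OF t(2), of "-1"] tangent_space_scale[OF t(3), of "-1"]]]
    unfolding curvature_def by (simp add: algebra_simps)
qed

text \<open>On the common domain of the three chosen extensions the curvature depends only on their
  values at \<open>p\<close>, so the choice is immaterial.\<close>

lemma curvature_at:
  assumes "x \<in> tangent_space A p" "y \<in> tangent_space A p" "z \<in> tangent_space A p"
  shows "curvature_at A D p x y z \<in> tangent_space A p"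
    and "c \<in> A \<Longrightarrow> p \<in> fst c \<Longrightarrow> coord_diff c l (curvature_at A D p x y z) = (\<Sum>i\<in>UNIV. \<Sum>j\<in>UNIV. \<Sum>k\<in>UNIV.
      coord_diff c i x * coord_diff c j y * coord_diff c k z * curv_coeff c i j k l p)"
proof -
  let ?e = "local_extension A p"
  obtain U1 where U1: "p \<in> U1" "vector_field A U1 (?e x)" "?e x p = x" by (rule local_extension[OF assms(1)])
  obtain U2 where U2: "p \<in> U2" "vector_field A U2 (?e y)" "?e y p = y" by (rule local_extension[OF assms(2)])
  obtain U3 where U3: "p \<in> U3" "vector_field A U3 (?e z)" "?e z p = z" by (rule local_extension[OF assms(3)])
  let ?U = "U1 \<inter> (U2 \<inter> U3)"
  have o: "openin (mtop A) ?U" by (intro openin_Int vector_field_openin[OF U1(2)] vector_field_openin[OF U2(2)] vector_field_openin[OF U3(2)])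
  have v: "vector_field A ?U (?e x)" "vector_field A ?U (?e y)" "vector_field A ?U (?e z)"
    by (rule vector_field_subset[OF U1(2) o] vector_field_subset[OF U2(2) o] vector_field_subset[OF U3(2) o]; blast)+
  have p: "p \<in> ?U" using U1 U2 U3 by simp
  show "curvature_at A D p x y z \<in> tangent_space A p"
    unfolding curvature_at_def by (rule curvature_tangent[OF v p])
  show "coord_diff c l (curvature_at A D p x y z) = (\<Sum>i\<in>UNIV. \<Sum>j\<in>UNIV. \<Sum>k\<in>UNIV.
      coord_diff c i x * coord_diff c j y * coord_diff c k z * curv_coeff c i j k l p)" if "c \<in> A" "p \<in> fst c"
    unfolding curvature_at_def coord_diff_curvature[OF v p that] by (simp add: U1 U2 U3)
qed

text \<open>\<open>tangent_trace\<close> uses the chart picked at \<open>p\<close>. Passing to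
  \<open>c\<close> conjugates the matrix by the Jacobian, which drops out of the trace by
  \<open>coord_vec_change\<close>. The indices of \<open>M\<close> are transposed:
  \<open>M i k\<close> is the k-th component of the image of the i-th coordinate vector.\<close>

lemma tangent_trace_chart:
  assumes c: "c \<in> A" "p \<in> fst c"
    and L: "\<And>v. v \<in> tangent_space A p \<Longrightarrow> L v \<in> tangent_space A p"
    and M: "\<And>v k. v \<in> tangent_space A p \<Longrightarrow> coord_diff c k (L v) = (\<Sum>i\<in>UNIV. coord_diff c i v * M i k)"
  shows "tangent_trace A p L = (\<Sum>i\<in>UNIV. M i i)"
proof -
  define e where "e = chart_at A p"
  have e: "e \<in> A" "p \<in> fst e" using chart_at[OF in_carrier[OF c]] by (simp_all add: e_def)
  note t = coord_vec_tangent[OF e]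
  have "tangent_trace A p L = (\<Sum>l\<in>UNIV. coord_diff e l (L (coord_vec A e l p)))"
    by (simp add: tangent_trace_def trace_def e_def Let_def)
  also have "\<dots> = (\<Sum>l\<in>UNIV. \<Sum>a\<in>UNIV. (\<Sum>i\<in>UNIV. coord_diff c i (coord_vec A e l p) * M i a) * coord_vec A c a p (\<lambda>q. snd e q $ l))"
    unfolding coord_diff_def[of e] by (subst tangent_apply[OF L[OF t] c]) (simp add: M[OF t])
  also have "\<dots> = (\<Sum>l\<in>UNIV. \<Sum>a\<in>UNIV. \<Sum>i\<in>UNIV. M i a * (coord_vec A c a p (\<lambda>q. snd e q $ l) * coord_vec A e l p (\<lambda>q. snd c q $ i)))"
    unfolding sum_distrib_right by (simp add: coord_diff_def ac_simps)
  also have "\<dots> = (\<Sum>a\<in>UNIV. \<Sum>i\<in>UNIV. \<Sum>l\<in>UNIV. M i a * (coord_vec A c a p (\<lambda>q. snd e q $ l) * coord_vec A e l p (\<lambda>q. snd c q $ i)))"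
    by (rule sum_rotate3[symmetric])
  also have "\<dots> = (\<Sum>a\<in>UNIV. \<Sum>i\<in>UNIV. M i a * (if a = i then 1 else 0))"
    by (simp add: sum_distrib_left[symmetric] coord_vec_change[OF c e])
  also have "\<dots> = (\<Sum>i\<in>UNIV. M i i)"
    by (simp add: if_distrib[of "\<lambda>x. _ * x"] cong: if_cong)
  finally show ?thesis .
qed

lemma ricci_component:
  assumes x: "x \<in> tangent_space A p" and y: "y \<in> tangent_space A p" and c: "c \<in> A" "p \<in> fst c"
  shows "ricci A D p x y = (\<Sum>i\<in>UNIV. \<Sum>j\<in>UNIV. coord_diff c i x * coord_diff c j y * ricci_coeff c i j p)"
proof -
  have "ricci A D p x y = (\<Sum>l\<in>UNIV. \<Sum>i\<in>UNIV. \<Sum>j\<in>UNIV. coord_diff c i x * coord_diff c j y * curv_coeff c l i j l p)"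
    unfolding ricci_def
    by (rule tangent_trace_chart[OF c, where M = "\<lambda>l k. \<Sum>i\<in>UNIV. \<Sum>j\<in>UNIV. coord_diff c i x * coord_diff c j y * curv_coeff c l i j k p"])
      (simp_all add: curvature_at[OF _ x y] c sum_distrib_left mult.assoc)
  also have "\<dots> = (\<Sum>i\<in>UNIV. \<Sum>j\<in>UNIV. \<Sum>l\<in>UNIV. coord_diff c i x * coord_diff c j y * curv_coeff c l i j l p)"
    by (rule sum_rotate3[symmetric])
  finally show ?thesis by (simp add: ricci_coeff_def sum_distrib_left)
qed

end

section \<open>The Levi-Civita connection\<close>

context smooth_atlas
begin

lemma tensor_add_left:
  "symmetric_tensor_field A \<Phi> \<Longrightarrow> u \<in> tangent_space A p \<Longrightarrow> u' \<in> tangent_space A p \<Longrightarrow> v \<in> tangent_space A p \<Longrightarrow>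
    \<Phi> p (\<lambda>f. u f + u' f) v = \<Phi> p u v + \<Phi> p u' v"
  using tangent_carrier[of u p] unfolding symmetric_tensor_field_def by simp

lemma tensor_scale_left:
  "symmetric_tensor_field A \<Phi> \<Longrightarrow> u \<in> tangent_space A p \<Longrightarrow> v \<in> tangent_space A p \<Longrightarrow>
    \<Phi> p (\<lambda>f. a * u f) v = a * \<Phi> p u v"
  using tangent_carrier[of u p] unfolding symmetric_tensor_field_def by simp

lemma tensor_sym:
  assumes "symmetric_tensor_field A \<Phi>" "u \<in> tangent_space A p" "v \<in> tangent_space A p"
  shows "\<Phi> p u v = \<Phi> p v u"
  using assms tangent_carrier[OF assms(2)] unfolding symmetric_tensor_field_def by blast

lemma tensor_smooth:
  "symmetric_tensor_field A \<Phi> \<Longrightarrow> vector_field A U X \<Longrightarrow> vector_field A U Y \<Longrightarrow> smooth_fun A U (\<lambda>p. \<Phi> p (X p) (Y p))"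
  unfolding symmetric_tensor_field_def by simp

lemma tensor_zero_left:
  "symmetric_tensor_field A \<Phi> \<Longrightarrow> v \<in> tangent_space A p \<Longrightarrow> \<Phi> p (\<lambda>f. 0) v = 0"
  using tensor_scale_left[of \<Phi> v p v 0] by simp

lemma tensor_sum_left:
  assumes \<Phi>: "symmetric_tensor_field A \<Phi>" and v: "v \<in> tangent_space A p"
    and u: "\<And>i. i \<in> I \<Longrightarrow> u i \<in> tangent_space A p"
  shows "\<Phi> p (\<lambda>f. \<Sum>i\<in>I. a i * u i f) v = (\<Sum>i\<in>I. a i * \<Phi> p (u i) v)"
  using u
proof (induction I rule: infinite_finite_induct)
  case (insert i I)
  have "(\<lambda>f. a i * u i f) \<in> tangent_space A p" "(\<lambda>f. \<Sum>i\<in>I. a i * u i f) \<in> tangent_space A p"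
    using insert.prems tangent_carrier[OF v] by (auto intro!: tangent_space_scale tangent_space_sum)
  then show ?case
    using insert tensor_add_left[OF \<Phi> _ _ v, of "\<lambda>f. a i * u i f" "\<lambda>f. \<Sum>i\<in>I. a i * u i f"]
      tensor_scale_left[OF \<Phi> _ v, of "u i" "a i"] by simp
qed (simp_all add: tensor_zero_left[OF \<Phi> v])

lemma tensor_expand:
  assumes \<Phi>: "symmetric_tensor_field A \<Phi>" and u: "u \<in> tangent_space A p" and v: "v \<in> tangent_space A p"
    and c: "c \<in> A" "p \<in> fst c"
  shows "\<Phi> p u v = (\<Sum>a\<in>UNIV. \<Sum>b\<in>UNIV. coord_diff c a u * coord_diff c b v * \<Phi> p (coord_vec A c a p) (coord_vec A c b p))"
proof -
  note E = coord_vec_tangent[OF c]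
  have 1: "\<Phi> p u w = (\<Sum>a\<in>UNIV. coord_diff c a u * \<Phi> p (coord_vec A c a p) w)"
    if u: "u \<in> tangent_space A p" and w: "w \<in> tangent_space A p" for u w
  proof -
    have "\<Phi> p u w = \<Phi> p (\<lambda>f. \<Sum>a\<in>UNIV. coord_diff c a u * coord_vec A c a p f) w"
      using tangent_expand[OF u c] by simp
    also have "\<dots> = (\<Sum>a\<in>UNIV. coord_diff c a u * \<Phi> p (coord_vec A c a p) w)"
      by (rule tensor_sum_left[OF \<Phi> w E])
    finally show ?thesis .
  qed
  \<comment> \<open>\<open>symmetric_tensor_field\<close> states linearity in the first argument
    only; linearity in the second is obtained through symmetry.\<close>
  have "\<Phi> p (coord_vec A c a p) v = (\<Sum>b\<in>UNIV. coord_diff c b v * \<Phi> p (coord_vec A c a p) (coord_vec A c b p))" for a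
    by (simp add: tensor_sym[OF \<Phi> E v] 1[OF v E] tensor_sym[OF \<Phi> E E])
  then show ?thesis using 1[OF u v] by (simp add: sum_distrib_left mult.assoc)
qed

end

text \<open>The inverse matrix is part of the data. For the modified extension it is explicit, so
  its smoothness and the nondegeneracy of the metric are read off directly, without
  determinants.\<close>

locale metric_atlas = smooth_atlas A
  for A :: "('m, 'n::finite) chart set" +
  fixes g :: "'m \<Rightarrow> 'm tvec \<Rightarrow> 'm tvec \<Rightarrow> real"
    and ginv :: "('m, 'n) chart \<Rightarrow> 'n \<Rightarrow> 'n \<Rightarrow> 'm \<Rightarrow> real"
  assumes metric: "symmetric_tensor_field A g"
    and ginv_smooth: "c \<in> A \<Longrightarrow> smooth_fun A (fst c) (ginv c a b)"
    and ginv_sym: "c \<in> A \<Longrightarrow> p \<in> fst c \<Longrightarrow> ginv c a b p = ginv c b a p"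
    and ginv: "c \<in> A \<Longrightarrow> p \<in> fst c \<Longrightarrow>
      (\<Sum>d\<in>UNIV. g p (coord_vec A c a p) (coord_vec A c d p) * ginv c d b p) = (if a = b then 1 else 0)"
begin

definition gcomp :: "('m, 'n) chart \<Rightarrow> 'n \<Rightarrow> 'n \<Rightarrow> 'm \<Rightarrow> real" where
  "gcomp c a b p = g p (coord_vec A c a p) (coord_vec A c b p)"

text \<open>The Christoffel symbols of the first kind; \<open>lc_symbol\<close> raises the last
  index.\<close>

definition lc_lower :: "('m, 'n) chart \<Rightarrow> 'n \<Rightarrow> 'n \<Rightarrow> 'n \<Rightarrow> 'm \<Rightarrow> real" where
  "lc_lower c a b d p = (coord_vec A c a p (gcomp c b d) + coord_vec A c b p (gcomp c a d) - coord_vec A c d p (gcomp c a b)) / 2"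

definition lc_symbol :: "('m, 'n) chart \<Rightarrow> 'n \<Rightarrow> 'n \<Rightarrow> 'n \<Rightarrow> 'm \<Rightarrow> real" where
  "lc_symbol c a b k p = (\<Sum>d\<in>UNIV. lc_lower c a b d p * ginv c d k p)"

text \<open>The coordinate formula \<open>coord_diff_conn\<close>, with the Levi-Civita symbols
  inserted, taken as the definition of a connection over one chart.\<close>

definition chart_conn :: "('m, 'n) chart \<Rightarrow> ('m \<Rightarrow> 'm tvec) \<Rightarrow> ('m \<Rightarrow> 'm tvec) \<Rightarrow> 'm \<Rightarrow> 'm tvec" where
  "chart_conn c X Y p = (\<lambda>f. \<Sum>k\<in>UNIV. (X p (\<lambda>q. coord_diff c k (Y q))
    + (\<Sum>i\<in>UNIV. \<Sum>j\<in>UNIV. coord_diff c i (X p) * coord_diff c j (Y p) * lc_symbol c i j k p)) * coord_vec A c k p f)"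

lemma gcomp_sym: "c \<in> A \<Longrightarrow> p \<in> fst c \<Longrightarrow> gcomp c a b p = gcomp c b a p"
  unfolding gcomp_def by (intro tensor_sym[OF metric] coord_vec_tangent)

lemma gcomp_smooth: "c \<in> A \<Longrightarrow> smooth_fun A (fst c) (gcomp c a b)"
  unfolding gcomp_def[abs_def] by (intro tensor_smooth[OF metric] vector_field_coord)

lemma gcomp_ginv: "c \<in> A \<Longrightarrow> p \<in> fst c \<Longrightarrow> (\<Sum>d\<in>UNIV. gcomp c a d p * ginv c d b p) = (if a = b then 1 else 0)"
  unfolding gcomp_def by (rule ginv)

lemma gcomp_sym_deriv:
  assumes "c \<in> A" "p \<in> fst c"
  shows "coord_vec A c i p (gcomp c a b) = coord_vec A c i p (gcomp c b a)"
  by (rule tangent_cong[OF coord_vec_tangent[OF assms] openin_chart[OF assms(1)] assms(2) gcomp_sym[OF assms(1)]])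

lemma lc_symbol_sym: "c \<in> A \<Longrightarrow> p \<in> fst c \<Longrightarrow> lc_symbol c a b k p = lc_symbol c b a k p"
  unfolding lc_symbol_def lc_lower_def by (simp add: gcomp_sym_deriv[of c p _ a b] add.commute)

lemma lc_symbol_smooth: "c \<in> A \<Longrightarrow> smooth_fun A (fst c) (lc_symbol c a b k)"
  unfolding lc_symbol_def[abs_def] lc_lower_def divide_inverse mult.commute[of _ "inverse 2"]
  by (intro smooth_fun_intros ginv_smooth openin_chart vector_field_apply[OF vector_field_coord] gcomp_smooth) auto

lemma lc_lower_eq:
  assumes "c \<in> A" "p \<in> fst c"
  shows "(\<Sum>k\<in>UNIV. lc_symbol c a b k p * gcomp c k d p) = lc_lower c a b d p"
proof -
  have "(\<Sum>k\<in>UNIV. lc_symbol c a b k p * gcomp c k d p)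
      = (\<Sum>k\<in>UNIV. \<Sum>e\<in>UNIV. lc_lower c a b e p * (gcomp c d k p * ginv c k e p))"
    unfolding lc_symbol_def sum_distrib_right
    by (simp add: gcomp_sym[OF assms, of _ d] ginv_sym[OF assms] mult_ac)
  also have "\<dots> = (\<Sum>e\<in>UNIV. lc_lower c a b e p * (if d = e then 1 else 0))"
    by (subst sum.swap) (simp add: gcomp_ginv[OF assms] flip: sum_distrib_left)
  finally show ?thesis by (simp add: if_distrib[of "\<lambda>x. _ * x"] cong: if_cong)
qed

text \<open>Metric compatibility in coordinates: the two lowered symbols share the derivative along
  \<open>i\<close>, and their other terms cancel by symmetry of the metric.\<close>

lemma gcomp_deriv:
  assumes "c \<in> A" "p \<in> fst c"
  shows "coord_vec A c i p (gcomp c a b) = lc_lower c i a b p + lc_lower c i b a p"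
  unfolding lc_lower_def using gcomp_sym_deriv[OF assms] by (simp add: field_simps)

lemma coord_diff_chart_conn:
  "c \<in> A \<Longrightarrow> p \<in> fst c \<Longrightarrow> coord_diff c k (chart_conn c X Y p) = X p (\<lambda>q. coord_diff c k (Y q))
    + (\<Sum>i\<in>UNIV. \<Sum>j\<in>UNIV. coord_diff c i (X p) * coord_diff c j (Y p) * lc_symbol c i j k p)"
  unfolding chart_conn_def by (rule coord_diff_comb)

lemma chart_conn_tangent: "c \<in> A \<Longrightarrow> p \<in> fst c \<Longrightarrow> chart_conn c X Y p \<in> tangent_space A p"
  unfolding chart_conn_def by (rule tangent_combI)

lemma component_smooth:
  assumes "c \<in> A" "U \<subseteq> fst c" "vector_field A U X"
  shows "smooth_fun A U (\<lambda>q. coord_diff c k (X q))"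
  using vector_field_component[OF assms(3,1), of k] assms(2) by (simp add: Int_absorb2)

lemma chart_conn_local_connection:
  assumes c: "c \<in> A"
  shows "local_connection A (chart_conn c) (fst c)"
proof
  fix U X Y p assume U: "U \<subseteq> fst c" and X: "vector_field A U X" and Y: "vector_field A U Y"
  have o: "openin (mtop A) U" by (rule vector_field_openin[OF X])
  show "vector_field A U (chart_conn c X Y)"
    unfolding chart_conn_def[abs_def]
    by (rule vector_field_comb[OF c o U],
        intro smooth_fun_intros vector_field_apply[OF X subset_refl] component_smooth[OF c U] X Y o
          smooth_fun_subset[OF lc_symbol_smooth[OF c] o U])
  fix X' Y'
  assume X': "vector_field A U X'"
  assume p: "p \<in> U"
  have pc: "p \<in> fst c" using p U by auto
  note t = chart_conn_tangent[OF c pc] and cd = coord_diff_chart_conn[OF c pc]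
  show "chart_conn c (\<lambda>q f. X q f + X' q f) Y p = (\<lambda>f. chart_conn c X Y p f + chart_conn c X' Y p f)"
  proof (rule tangent_eqI[OF t tangent_space_add[OF t t] c pc])
    fix k
    have a: "coord_diff c k (\<lambda>f. u f + v f) = coord_diff c k u + coord_diff c k v" for k u v
      by (simp add: coord_diff_def)
    show "coord_diff c k (chart_conn c (\<lambda>q f. X q f + X' q f) Y p)
        = coord_diff c k (\<lambda>f. chart_conn c X Y p f + chart_conn c X' Y p f)"
      unfolding a cd by (simp add: distrib_right sum.distrib)
  qed
next
  fix U and X X' Y Y' :: "'m \<Rightarrow> 'm tvec" and p
  assume U: "U \<subseteq> fst c" and X: "vector_field A U X" and p: "p \<in> U"
    and eq: "\<And>p. p \<in> U \<Longrightarrow> X p = X' p \<and> Y p = Y' p"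
  have "X p (\<lambda>q. coord_diff c k (Y q)) = X p (\<lambda>q. coord_diff c k (Y' q))" for k
    by (rule tangent_cong[OF vector_field_tangent[OF X p] vector_field_openin[OF X] p]) (simp add: eq)
  then show "chart_conn c X Y p = chart_conn c X' Y' p"
    using eq[OF p] by (simp add: chart_conn_def)
next
  fix U h and X Y :: "'m \<Rightarrow> 'm tvec" and p
  assume U: "U \<subseteq> fst c" and p: "p \<in> U"
  have a: "coord_diff c k (\<lambda>f. h p * u f) = h p * coord_diff c k u" for k u
    by (simp add: coord_diff_def)
  show "chart_conn c (\<lambda>q f. h q * X q f) Y p = (\<lambda>f. h p * chart_conn c X Y p f)"
    unfolding chart_conn_def a by (rule ext) (simp add: sum_distrib_left sum_distrib_right distrib_left distrib_right mult_ac)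
next
  fix U X Y Y' p
  assume U: "U \<subseteq> fst c" and X: "vector_field A U X" and Y: "vector_field A U Y" and Y': "vector_field A U Y'"
    and p: "p \<in> U"
  have a: "coord_diff c k (\<lambda>f. u f + v f) = coord_diff c k u + coord_diff c k v" for k u v
    by (simp add: coord_diff_def)
  have b: "X p (\<lambda>q. coord_diff c k (Y q) + coord_diff c k (Y' q)) = X p (\<lambda>q. coord_diff c k (Y q)) + X p (\<lambda>q. coord_diff c k (Y' q))" for k
    by (intro tangent_add[OF vector_field_tangent[OF X p]] smooth_atI[OF component_smooth[OF c U] p] Y Y')
  show "chart_conn c X (\<lambda>q f. Y q f + Y' q f) p = (\<lambda>f. chart_conn c X Y p f + chart_conn c X Y' p f)"
    unfolding chart_conn_def a b by (rule ext) (simp add: sum.distrib distrib_left distrib_right add_ac)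
next
  fix U h X Y p
  assume U: "U \<subseteq> fst c" and h: "smooth_fun A U h" and X: "vector_field A U X" and Y: "vector_field A U Y" and p: "p \<in> U"
  have pc: "p \<in> fst c" using p U by auto
  have a: "coord_diff c k (\<lambda>f. h q * u f) = h q * coord_diff c k u" for k u q
    by (simp add: coord_diff_def)
  have b: "X p (\<lambda>q. h q * coord_diff c k (Y q)) = X p h * coord_diff c k (Y p) + h p * X p (\<lambda>q. coord_diff c k (Y q))" for k
    by (intro tangent_mult[OF vector_field_tangent[OF X p]] smooth_atI[OF component_smooth[OF c U] p] Y smooth_atI[OF h p])
  have e: "Y p f = (\<Sum>k\<in>UNIV. coord_diff c k (Y p) * coord_vec A c k p f)" for f
    by (rule tangent_apply[OF vector_field_tangent[OF Y p] c pc])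
  define S where "S = (\<lambda>k. \<Sum>i\<in>UNIV. \<Sum>j\<in>UNIV. coord_diff c i (X p) * coord_diff c j (Y p) * lc_symbol c i j k p)"
  have S: "(\<Sum>i\<in>UNIV. \<Sum>j\<in>UNIV. coord_diff c i (X p) * (h p * coord_diff c j (Y p)) * lc_symbol c i j k p) = h p * S k" for k
    unfolding S_def by (simp add: sum_distrib_left mult_ac)
  have "chart_conn c X (\<lambda>q f. h q * Y q f) p f = X p h * Y p f + h p * chart_conn c X Y p f" for f
  proof -
    have "chart_conn c X (\<lambda>q f. h q * Y q f) p f = (\<Sum>k\<in>UNIV.
        X p h * (coord_diff c k (Y p) * coord_vec A c k p f)
        + h p * ((X p (\<lambda>q. coord_diff c k (Y q)) + S k) * coord_vec A c k p f))"
      unfolding chart_conn_def a b S by (rule sum.cong[OF refl]) algebra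
    also have "\<dots> = X p h * Y p f + h p * chart_conn c X Y p f"
      unfolding chart_conn_def S_def e[of f] by (simp add: sum.distrib sum_distrib_left)
    finally show ?thesis .
  qed
  then show "chart_conn c X (\<lambda>q f. h q * Y q f) p = (\<lambda>f. X p h * Y p f + h p * chart_conn c X Y p f)"
    by (rule ext)
qed

lemma chart_conn_torsion_free:
  assumes c: "c \<in> A" and U: "U \<subseteq> fst c" and X: "vector_field A U X" and Y: "vector_field A U Y" and p: "p \<in> U"
  shows "(\<lambda>f. chart_conn c X Y p f - chart_conn c Y X p f) = lie_bracket A X Y p"
proof -
  have pc: "p \<in> fst c" using p U by auto
  have "(\<Sum>i\<in>UNIV. \<Sum>j\<in>UNIV. coord_diff c i (Y p) * coord_diff c j (X p) * lc_symbol c i j k p)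
      = (\<Sum>i\<in>UNIV. \<Sum>j\<in>UNIV. coord_diff c i (X p) * coord_diff c j (Y p) * lc_symbol c i j k p)" for k
    by (subst sum.swap) (simp add: lc_symbol_sym[OF c pc, of _ _ k] mult_ac)
  then show ?thesis
    unfolding lie_bracket_expand[OF X p Y c pc] chart_conn_def
    by (simp add: sum_subtractf[symmetric] left_diff_distrib[symmetric])
qed

text \<open>In components the left side is differentiated by the product rule.
  \<open>gcomp_deriv\<close> splits the derivative of each metric coefficient into two lowered
  symbols, one for each term on the right.\<close>

lemma chart_conn_metric:
  assumes c: "c \<in> A" and U: "U \<subseteq> fst c" and X: "vector_field A U X" and Y: "vector_field A U Y" and Z: "vector_field A U Z"
    and p: "p \<in> U"
  shows "X p (\<lambda>q. g q (Y q) (Z q)) = g p (chart_conn c X Y p) (Z p) + g p (Y p) (chart_conn c X Z p)"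
proof -
  have pc: "p \<in> fst c" using p U by auto
  note tX = vector_field_tangent[OF X p]
  define x y z where "x = (\<lambda>i. coord_diff c i (X p))" and "y = (\<lambda>i. coord_diff c i (Y p))" and "z = (\<lambda>i. coord_diff c i (Z p))"
  define u v where "u = (\<lambda>j. X p (\<lambda>q. coord_diff c j (Y q)))" and "v = (\<lambda>j. X p (\<lambda>q. coord_diff c j (Z q)))"
  define G where "G = (\<lambda>a b. gcomp c a b p)"
  note s = smooth_atI[OF component_smooth[OF c U Y] p] smooth_atI[OF component_smooth[OF c U Z] p]
    smooth_atI[OF gcomp_smooth[OF c] pc]
  have ss: "smooth_at A p (\<lambda>q. coord_diff c a (Y q) * coord_diff c b (Z q) * gcomp c a b q)" for a b
    by (intro smooth_at_mult s)
  have Gsym: "G a b = G b a" for a b unfolding G_def by (rule gcomp_sym[OF c pc])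
  have "X p (\<lambda>q. g q (Y q) (Z q)) = X p (\<lambda>q. \<Sum>a\<in>UNIV. \<Sum>b\<in>UNIV. coord_diff c a (Y q) * coord_diff c b (Z q) * gcomp c a b q)"
  proof (rule tangent_cong[OF tX vector_field_openin[OF X] p])
    fix q assume q: "q \<in> U"
    then have qc: "q \<in> fst c" using U by auto
    show "g q (Y q) (Z q) = (\<Sum>a\<in>UNIV. \<Sum>b\<in>UNIV. coord_diff c a (Y q) * coord_diff c b (Z q) * gcomp c a b q)"
      unfolding gcomp_def by (rule tensor_expand[OF metric vector_field_tangent[OF Y q] vector_field_tangent[OF Z q] c qc])
  qed
  also have "\<dots> = (\<Sum>a\<in>UNIV. \<Sum>b\<in>UNIV. X p (\<lambda>q. coord_diff c a (Y q) * coord_diff c b (Z q) * gcomp c a b q))"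
    by (subst tangent_sum[OF tX]) (auto intro!: smooth_at_sum ss in_carrier[OF c pc] sum.cong tangent_sum[OF tX])
  also have "\<dots> = (\<Sum>a\<in>UNIV. \<Sum>b\<in>UNIV. (u a * z b + y a * v b) * G a b + y a * z b * (\<Sum>i\<in>UNIV. x i * (lc_lower c i a b p + lc_lower c i b a p)))"
    using tangent_apply[OF tX c pc, of "gcomp c _ _"]
    by (simp add: tangent_mult[OF tX smooth_at_mult[OF s(1,2)] s(3)] tangent_mult[OF tX s(1,2)] gcomp_deriv[OF c pc]
        u_def v_def x_def y_def z_def G_def)
  finally have 1: "X p (\<lambda>q. g q (Y q) (Z q)) = (\<Sum>a\<in>UNIV. \<Sum>b\<in>UNIV. u a * z b * G a b) + (\<Sum>a\<in>UNIV. \<Sum>b\<in>UNIV. y a * v b * G a b)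
     + ((\<Sum>a\<in>UNIV. \<Sum>b\<in>UNIV. \<Sum>i\<in>UNIV. x i * y a * z b * lc_lower c i a b p)
     + (\<Sum>a\<in>UNIV. \<Sum>b\<in>UNIV. \<Sum>i\<in>UNIV. x i * y a * z b * lc_lower c i b a p))"
    by (simp add: sum.distrib distrib_left distrib_right sum_distrib_left mult_ac)
  \<comment> \<open>The field and the vector are arbitrary because the formula is used twice: for
    \<open>Y\<close> paired with \<open>Z\<close>, and through symmetry of the metric for
    \<open>Z\<close> paired with \<open>Y\<close>.\<close>
  have main: "g p (chart_conn c X Y p) w = (\<Sum>a\<in>UNIV. \<Sum>b\<in>UNIV. X p (\<lambda>q. coord_diff c a (Y q)) * coord_diff c b w * G a b)
      + (\<Sum>a\<in>UNIV. \<Sum>b\<in>UNIV. \<Sum>i\<in>UNIV. x i * coord_diff c a (Y p) * coord_diff c b w * lc_lower c i a b p)"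
    if w: "w \<in> tangent_space A p" for Y w
  proof -
    have "g p (chart_conn c X Y p) w = (\<Sum>k\<in>UNIV. \<Sum>b\<in>UNIV. coord_diff c k (chart_conn c X Y p) * coord_diff c b w * G k b)"
      unfolding G_def gcomp_def by (rule tensor_expand[OF metric chart_conn_tangent[OF c pc] w c pc])
    also have "\<dots> = (\<Sum>a\<in>UNIV. \<Sum>b\<in>UNIV. X p (\<lambda>q. coord_diff c a (Y q)) * coord_diff c b w * G a b)
      + (\<Sum>k\<in>UNIV. \<Sum>b\<in>UNIV. (\<Sum>i\<in>UNIV. \<Sum>j\<in>UNIV. x i * coord_diff c j (Y p) * lc_symbol c i j k p) * coord_diff c b w * G k b)"
      unfolding coord_diff_chart_conn[OF c pc] x_def by (simp add: distrib_right sum.distrib)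
    also have "(\<Sum>k\<in>UNIV. \<Sum>b\<in>UNIV. (\<Sum>i\<in>UNIV. \<Sum>j\<in>UNIV. x i * coord_diff c j (Y p) * lc_symbol c i j k p) * coord_diff c b w * G k b)
      = (\<Sum>b\<in>UNIV. \<Sum>i\<in>UNIV. \<Sum>j\<in>UNIV. \<Sum>k\<in>UNIV. x i * coord_diff c j (Y p) * coord_diff c b w * (lc_symbol c i j k p * G k b))"
      unfolding sum_distrib_right
      by (subst sum.swap, rule sum.cong[OF refl], subst sum_rotate3[symmetric]) (simp add: mult_ac)
    also have "\<dots> = (\<Sum>b\<in>UNIV. \<Sum>i\<in>UNIV. \<Sum>j\<in>UNIV. x i * coord_diff c j (Y p) * coord_diff c b w * lc_lower c i j b p)"
      by (simp add: lc_lower_eq[OF c pc] G_def flip: sum_distrib_left)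
    also have "\<dots> = (\<Sum>j\<in>UNIV. \<Sum>b\<in>UNIV. \<Sum>i\<in>UNIV. x i * coord_diff c j (Y p) * coord_diff c b w * lc_lower c i j b p)"
      by (rule sum_rotate3)
    finally show ?thesis .
  qed
  have tY: "Y p \<in> tangent_space A p" and tZ: "Z p \<in> tangent_space A p"
    by (rule vector_field_tangent[OF Y p] vector_field_tangent[OF Z p])+
  have 2: "g p (chart_conn c X Y p) (Z p) = (\<Sum>a\<in>UNIV. \<Sum>b\<in>UNIV. u a * z b * G a b)
      + (\<Sum>a\<in>UNIV. \<Sum>b\<in>UNIV. \<Sum>i\<in>UNIV. x i * y a * z b * lc_lower c i a b p)"
    unfolding main[OF tZ] u_def y_def z_def by simp
  have "g p (Y p) (chart_conn c X Z p) = (\<Sum>a\<in>UNIV. \<Sum>b\<in>UNIV. v a * y b * G a b)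
      + (\<Sum>a\<in>UNIV. \<Sum>b\<in>UNIV. \<Sum>i\<in>UNIV. x i * z a * y b * lc_lower c i a b p)"
    unfolding tensor_sym[OF metric tY chart_conn_tangent[OF c pc]] main[OF tY] v_def y_def z_def by simp
  also have "(\<Sum>a\<in>UNIV. \<Sum>b\<in>UNIV. v a * y b * G a b) = (\<Sum>a\<in>UNIV. \<Sum>b\<in>UNIV. y a * v b * G a b)"
    by (subst sum.swap) (simp add: Gsym mult_ac)
  also have "(\<Sum>a\<in>UNIV. \<Sum>b\<in>UNIV. \<Sum>i\<in>UNIV. x i * z a * y b * lc_lower c i a b p)
      = (\<Sum>a\<in>UNIV. \<Sum>b\<in>UNIV. \<Sum>i\<in>UNIV. x i * y a * z b * lc_lower c i b a p)"
    by (subst sum.swap) (simp add: mult_ac)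
  finally show ?thesis unfolding 1 2 by simp
qed

section \<open>Uniqueness, gluing and the global Levi-Civita connection\<close>

lemma christoffel_unique:
  assumes D: "local_connection A D W" and U: "openin (mtop A) U" "U \<subseteq> fst c" "U \<subseteq> W" and c: "c \<in> A" and p: "p \<in> U"
    and torsion: "\<And>X Y. vector_field A U X \<Longrightarrow> vector_field A U Y \<Longrightarrow> (\<lambda>f. D X Y p f - D Y X p f) = lie_bracket A X Y p"
    and compat: "\<And>X Y Z. vector_field A U X \<Longrightarrow> vector_field A U Y \<Longrightarrow> vector_field A U Z \<Longrightarrow>
      X p (\<lambda>q. g q (Y q) (Z q)) = g p (D X Y p) (Z p) + g p (Y p) (D X Z p)"
  shows "christoffel A D c i j k p = lc_symbol c i j k p"
proof -
  interpret D: local_connection A D W by fact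
  have pc: "p \<in> fst c" using p U by auto
  have E: "vector_field A U (coord_vec A c i)" for i
    by (rule vector_field_subset[OF vector_field_coord[OF c] U(1,2)])
  define Gam where "Gam = (\<lambda>i j k. christoffel A D c i j k p)"
  define Q where "Q = (\<lambda>i j l. \<Sum>k\<in>UNIV. Gam i j k * gcomp c k l p)"
  have tE: "coord_vec A c i p \<in> tangent_space A p" for i by (rule coord_vec_tangent[OF c pc])
  have tD: "D (coord_vec A c i) (coord_vec A c j) p \<in> tangent_space A p" for i j
    by (rule vector_field_tangent[OF D.conn_field[OF U(3) E E] p])
  have Gsym: "Gam i j k = Gam j i k" for i j k
    using fun_cong[OF torsion[OF E[of i] E[of j]], of "\<lambda>q. snd c q $ k"]
    unfolding lie_bracket_coord_vec[OF c pc] by (simp add: Gam_def christoffel_def coord_diff_def)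
  have gD: "g p (D (coord_vec A c i) (coord_vec A c j) p) (coord_vec A c l p) = Q i j l" for i j l
    unfolding tensor_expand[OF metric tD tE c pc] coord_diff_coord_vec[OF c pc] Q_def Gam_def christoffel_def gcomp_def
    by (simp add: if_distrib[of "\<lambda>x. _ * x"] if_distrib[of "\<lambda>x. x * _"] cong: if_cong)
  have gd: "coord_vec A c i p (gcomp c j l) = Q i j l + Q i l j" for i j l
    using compat[OF E[of i] E[of j] E[of l]] unfolding gD tensor_sym[OF metric tE tD] by (simp add: gcomp_def[abs_def])
  \<comment> \<open>The Koszul argument: each derivative of the metric is a sum of two lowered
    symbols \<open>Q\<close>, and these are symmetric in the first two indices. In the combination
    defining \<open>lc_lower\<close> all terms cancel except two copies of
    \<open>Q i j l\<close>.\<close>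
  have "lc_lower c i j l p = Q i j l" for i j l
    unfolding lc_lower_def gd using Gsym by (simp add: Q_def)
  then have "lc_symbol c i j k p = (\<Sum>l\<in>UNIV. \<Sum>m\<in>UNIV. Gam i j m * (gcomp c m l p * ginv c l k p))"
    by (simp add: lc_symbol_def Q_def sum_distrib_right mult.assoc)
  also have "\<dots> = (\<Sum>m\<in>UNIV. Gam i j m * (if m = k then 1 else 0))"
    by (subst sum.swap) (simp add: gcomp_ginv[OF c pc] flip: sum_distrib_left)
  also have "\<dots> = Gam i j k" by (simp add: if_distrib[of "\<lambda>x. _ * x"] cong: if_cong)
  finally show ?thesis by (simp add: Gam_def)
qed

text \<open>On the overlap the connection built in \<open>d\<close> is torsion free and metric, so
  by uniqueness its symbols in the chart \<open>c\<close> are the Levi-Civita symbols there. Both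
  sides then have the same components in \<open>c\<close>.\<close>

lemma chart_conn_eq:
  assumes c: "c \<in> A" and d: "d \<in> A" and X: "vector_field A U X" and Y: "vector_field A U Y"
    and p: "p \<in> U" "p \<in> fst c" "p \<in> fst d"
  shows "chart_conn c X Y p = chart_conn d X Y p"
proof -
  interpret d: local_connection A "chart_conn d" "fst d" by (rule chart_conn_local_connection[OF d])
  let ?V = "U \<inter> (fst c \<inter> fst d)"
  have o: "openin (mtop A) ?V" by (intro openin_Int vector_field_openin[OF X] openin_chart c d)
  have XV: "vector_field A ?V X" and YV: "vector_field A ?V Y"
    by (rule vector_field_subset[OF X o] vector_field_subset[OF Y o]; blast)+
  have V: "?V \<subseteq> fst d" "?V \<subseteq> fst c" "p \<in> ?V" using p by auto
  have G: "christoffel A (chart_conn d) c i j k p = lc_symbol c i j k p" for i j k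
    by (rule christoffel_unique[OF d.local_connection_axioms o V(2,1) c V(3)])
      (intro chart_conn_torsion_free[OF d V(1) _ _ V(3)] chart_conn_metric[OF d V(1) _ _ _ V(3)]; assumption)+
  show ?thesis
  proof (rule tangent_eqI[OF chart_conn_tangent[OF c p(2)] chart_conn_tangent[OF d p(3)] c p(2)])
    show "coord_diff c k (chart_conn c X Y p) = coord_diff c k (chart_conn d X Y p)" for k
      unfolding coord_diff_chart_conn[OF c p(2)] d.coord_diff_conn[OF V(1) XV YV V(3) c p(2)] G ..
  qed
qed

text \<open>At each point the connection of the chart picked there is used. The axioms that compare
  values at one point are inherited from that chart alone.\<close>

lemma levi_civita_exists: "is_levi_civita A g (\<lambda>X Y p. chart_conn (chart_at A p) X Y p)"
proof -
  let ?D = "\<lambda>X Y p. chart_conn (chart_at A p) X Y p"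
  have loc: "chart_at A p \<in> A" "p \<in> U \<inter> fst (chart_at A p)" "openin (mtop A) (U \<inter> fst (chart_at A p))"
    if "openin (mtop A) U" "p \<in> U" for U p
    using chart_at[of p] that openin_Int[OF that(1) openin_chart[of "chart_at A p"]] by (auto simp: openin_mtop)
  have vs: "vector_field A (U \<inter> fst c) X" if "openin (mtop A) (U \<inter> fst c)" "vector_field A U X" for U X and c :: "('m, 'n) chart"
    using vector_field_subset[OF that(2,1)] by blast
  have conn: "connection A ?D"
    unfolding connection_def
  proof (intro conjI allI impI ballI; elim conjE)
    fix U X Y assume X: "vector_field A U X" and Y: "vector_field A U Y"
    note o = vector_field_openin[OF X]
    \<comment> \<open>Smoothness is the one axiom that sees the picked chart vary with the point.
      Near \<open>p\<close> all the chart connections agree with the one picked at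
      \<open>p\<close>.\<close>
    show "vector_field A U (?D X Y)"
    proof (rule vector_fieldI_local[OF o])
      fix p assume p: "p \<in> U"
      let ?c = "chart_at A p"
      note l = loc[OF o p]
      interpret local_connection A "chart_conn ?c" "fst ?c" by (rule chart_conn_local_connection[OF l(1)])
      have "vector_field A (U \<inter> fst ?c) (chart_conn ?c X Y)"
        by (rule conn_field[OF Int_lower2 vs[OF l(3) X] vs[OF l(3) Y]])
      moreover have "?D X Y q = chart_conn ?c X Y q" if "q \<in> U \<inter> fst ?c" for q
        using that loc[OF o, of q] by (intro chart_conn_eq[OF _ l(1) X Y]) auto
      ultimately show "\<exists>V Z. p \<in> V \<and> vector_field A V Z \<and> (\<forall>q\<in>V \<inter> U. ?D X Y q = Z q)"
        using l(2) by (intro exI[of _ "U \<inter> fst ?c"] exI[of _ "chart_conn ?c X Y"]) auto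
    qed
  next
    fix U X X' Y Y' p
    assume X: "vector_field A U X" "vector_field A U X'" and Y: "vector_field A U Y" "vector_field A U Y'"
      and eq: "\<forall>p\<in>U. X p = X' p \<and> Y p = Y' p" and p: "p \<in> U"
    note l = loc[OF vector_field_openin[OF X(1)] p] and v = vs[OF loc(3)[OF vector_field_openin[OF X(1)] p]]
    interpret local_connection A "chart_conn (chart_at A p)" "fst (chart_at A p)"
      by (rule chart_conn_local_connection[OF l(1)])
    show "?D X Y p = ?D X' Y' p"
      by (rule conn_cong[OF Int_lower2 v[OF X(1)] v[OF X(2)] v[OF Y(1)] v[OF Y(2)] _ l(2)]) (use eq in auto)
  next
    fix U X X' Y p
    assume X: "vector_field A U X" "vector_field A U X'" and Y: "vector_field A U Y" and p: "p \<in> U"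
    note l = loc[OF vector_field_openin[OF X(1)] p] and v = vs[OF loc(3)[OF vector_field_openin[OF X(1)] p]]
    interpret local_connection A "chart_conn (chart_at A p)" "fst (chart_at A p)"
      by (rule chart_conn_local_connection[OF l(1)])
    show "?D (\<lambda>q f. X q f + X' q f) Y p = (\<lambda>f. ?D X Y p f + ?D X' Y p f)"
      by (rule conn_add_left[OF Int_lower2 v[OF X(1)] v[OF X(2)] v[OF Y] l(2)])
  next
    fix U h X Y p
    assume h: "smooth_fun A U h" and X: "vector_field A U X" and Y: "vector_field A U Y" and p: "p \<in> U"
    note l = loc[OF vector_field_openin[OF X(1)] p] and v = vs[OF loc(3)[OF vector_field_openin[OF X(1)] p]]
    interpret local_connection A "chart_conn (chart_at A p)" "fst (chart_at A p)"
      by (rule chart_conn_local_connection[OF l(1)])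
    show "?D (\<lambda>q f. h q * X q f) Y p = (\<lambda>f. h p * ?D X Y p f)"
      by (rule conn_scale_left[OF Int_lower2 smooth_fun_subset[OF h l(3) Int_lower1] v[OF X] v[OF Y] l(2)])
  next
    fix U X Y Y' p
    assume X: "vector_field A U X" and Y: "vector_field A U Y" "vector_field A U Y'" and p: "p \<in> U"
    note l = loc[OF vector_field_openin[OF X(1)] p] and v = vs[OF loc(3)[OF vector_field_openin[OF X(1)] p]]
    interpret local_connection A "chart_conn (chart_at A p)" "fst (chart_at A p)"
      by (rule chart_conn_local_connection[OF l(1)])
    show "?D X (\<lambda>q f. Y q f + Y' q f) p = (\<lambda>f. ?D X Y p f + ?D X Y' p f)"
      by (rule conn_add_right[OF Int_lower2 v[OF X] v[OF Y(1)] v[OF Y(2)] l(2)])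
  next
    fix U h X Y p
    assume h: "smooth_fun A U h" and X: "vector_field A U X" and Y: "vector_field A U Y" and p: "p \<in> U"
    note l = loc[OF vector_field_openin[OF X(1)] p] and v = vs[OF loc(3)[OF vector_field_openin[OF X(1)] p]]
    interpret local_connection A "chart_conn (chart_at A p)" "fst (chart_at A p)"
      by (rule chart_conn_local_connection[OF l(1)])
    show "?D X (\<lambda>q f. h q * Y q f) p = (\<lambda>f. X p h * Y p f + h p * ?D X Y p f)"
      by (rule conn_leibniz[OF Int_lower2 smooth_fun_subset[OF h l(3) Int_lower1] v[OF X] v[OF Y] l(2)])
  qed
  have "torsion_free A ?D"
    unfolding torsion_free_def
  proof (intro allI impI ballI; elim conjE)
    fix U X Y p assume X: "vector_field A U X" and Y: "vector_field A U Y" and p: "p \<in> U"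
    note l = loc[OF vector_field_openin[OF X(1)] p] and v = vs[OF loc(3)[OF vector_field_openin[OF X(1)] p]]
    show "(\<lambda>f. ?D X Y p f - ?D Y X p f) = lie_bracket A X Y p"
      by (rule chart_conn_torsion_free[OF l(1) Int_lower2 v[OF X] v[OF Y] l(2)])
  qed
  moreover have "X p (\<lambda>q. g q (Y q) (Z q)) = g p (?D X Y p) (Z p) + g p (Y p) (?D X Z p)"
    if X: "vector_field A U X" and Y: "vector_field A U Y" and Z: "vector_field A U Z" and p: "p \<in> U" for U X Y Z p
  proof -
    note l = loc[OF vector_field_openin[OF X(1)] p] and v = vs[OF loc(3)[OF vector_field_openin[OF X(1)] p]]
    show ?thesis by (rule chart_conn_metric[OF l(1) Int_lower2 v[OF X] v[OF Y] v[OF Z] l(2)])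
  qed
  ultimately show ?thesis unfolding is_levi_civita_def using conn by blast
qed

lemma levi_civita: "is_levi_civita A g (levi_civita A g)"
  unfolding levi_civita_def by (rule someI[of "is_levi_civita A g", OF levi_civita_exists])

lemma levi_civita_connection: "atlas_connection A (levi_civita A g)"
  using levi_civita smooth_atlas_axioms
  by (auto simp: is_levi_civita_def atlas_connection_def atlas_connection_axioms_def)

text \<open>Torsion freeness and compatibility determine the symbols, so the arbitrary choice inside
  \<open>levi_civita\<close> does not affect them.\<close>

lemma christoffel_levi_civita:
  assumes c: "c \<in> A" "p \<in> fst c"
  shows "christoffel A (levi_civita A g) c i j k p = lc_symbol c i j k p"
proof -
  interpret L: atlas_connection A "levi_civita A g" by (rule levi_civita_connection)
  show ?thesis
  proof (rule christoffel_unique[OF L.local_connection_axioms openin_chart[OF c(1)] subset_refl subset_UNIV c])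
    show "(\<lambda>f. levi_civita A g X Y p f - levi_civita A g Y X p f) = lie_bracket A X Y p"
      if "vector_field A (fst c) X" "vector_field A (fst c) Y" for X Y
      using levi_civita that c(2) unfolding is_levi_civita_def torsion_free_def by blast
    show "X p (\<lambda>q. g q (Y q) (Z q)) = g p (levi_civita A g X Y p) (Z p) + g p (Y p) (levi_civita A g X Z p)"
      if "vector_field A (fst c) X" "vector_field A (fst c) Y" "vector_field A (fst c) Z" for X Y Z
      using levi_civita that c(2) unfolding is_levi_civita_def by blast
  qed
qed

lemma metric_nondegenerate:
  assumes u: "u \<in> tangent_space A p" and 0: "\<And>v. v \<in> tangent_space A p \<Longrightarrow> g p u v = 0"
  shows "u = (\<lambda>f. 0)"
proof -
  obtain c where c: "c \<in> A" "p \<in> fst c" using carrier_chart[OF tangent_carrier[OF u]] by blast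
  note tE = coord_vec_tangent[OF c]
  have "coord_diff c k u = 0" for k
  proof -
    have "(\<Sum>a\<in>UNIV. coord_diff c a u * gcomp c a b p) = 0" for b
      using 0[OF tE[of b]] unfolding tensor_expand[OF metric u tE c] coord_diff_coord_vec[OF c] gcomp_def
      by (simp add: if_distrib[of "\<lambda>x. _ * x"] if_distrib[of "\<lambda>x. x * _"] cong: if_cong)
    then have "0 = (\<Sum>b\<in>UNIV. (\<Sum>a\<in>UNIV. coord_diff c a u * gcomp c a b p) * ginv c b k p)" by simp
    also have "\<dots> = (\<Sum>b\<in>UNIV. \<Sum>a\<in>UNIV. coord_diff c a u * (gcomp c a b p * ginv c b k p))"
      by (simp add: sum_distrib_right mult.assoc)
    also have "\<dots> = (\<Sum>a\<in>UNIV. coord_diff c a u * (if a = k then 1 else 0))"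
      by (subst sum.swap) (simp add: gcomp_ginv[OF c] flip: sum_distrib_left)
    finally show ?thesis by (simp add: if_distrib[of "\<lambda>x. _ * x"] cong: if_cong)
  qed
  then show ?thesis using tangent_expand[OF u c] by simp
qed

lemma metric_pseudo_riemannian: "pseudo_riemannian_metric A g"
  unfolding pseudo_riemannian_metric_def using metric metric_nondegenerate by blast

end

section \<open>The cotangent bundle\<close>

lemma sum_UNIV_sum:
  fixes f :: "'a::finite + 'b::finite \<Rightarrow> 'c::comm_monoid_add"
  shows "(\<Sum>a\<in>UNIV. f a) = (\<Sum>i\<in>UNIV. f (Inl i)) + (\<Sum>i\<in>UNIV. f (Inr i))"
  by (simp add: UNIV_Plus_UNIV[symmetric] sum.Plus comp_def del: UNIV_Plus_UNIV)

definition base_part :: "real ^ ('n + 'n) \<Rightarrow> real ^ 'n::finite" where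
  "base_part z = (\<chi> i. z $ Inl i)"

lemma base_part_nth [simp]: "base_part z $ i = z $ Inl i"
  by (simp add: base_part_def)

lemma bounded_linear_base_part: "bounded_linear base_part"
  by (rule linear_conv_bounded_linear[THEN iffD1])
    (auto intro!: linearI simp: vec_eq_iff)

lemma base_part_axis [simp]:
  "base_part (axis (Inl i) 1) = axis i 1" "base_part (axis (Inr i) 1) = 0"
  by (auto simp: vec_eq_iff axis_def)

lemma cotangent_chart_Inl [simp]: "snd (cotangent_chart A c) P $ Inl i = snd c (fst P) $ i"
  by (simp add: cotangent_chart_def split_def)

lemma cotangent_chart_Inr [simp]: "snd (cotangent_chart A c) P $ Inr i = snd P (coord_vec A c i (fst P))"
  by (simp add: cotangent_chart_def split_def)

lemma base_part_cotangent_chart [simp]: "base_part (snd (cotangent_chart A c) P) = snd c (fst P)"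
  by (simp add: vec_eq_iff)

lemma fst_cotangent_chart: "P \<in> fst (cotangent_chart A c) \<longleftrightarrow> fst P \<in> fst c \<and> snd P \<in> cotangent_space A (fst P)"
  by (cases P) (simp add: cotangent_chart_def)

context smooth_atlas
begin

lemma covector_sum:
  assumes \<omega>: "\<omega> \<in> cotangent_space A p" and p: "p \<in> carrier A"
    and u: "\<And>i. i \<in> I \<Longrightarrow> u i \<in> tangent_space A p"
  shows "\<omega> (\<lambda>f. \<Sum>i\<in>I. a i * u i f) = (\<Sum>i\<in>I. a i * \<omega> (u i))"
proof -
  have add: "\<omega> (\<lambda>f. u f + v f) = \<omega> u + \<omega> v" if "u \<in> tangent_space A p" "v \<in> tangent_space A p" for u v
    using \<omega> that by (simp add: cotangent_space_def)
  have scale: "\<omega> (\<lambda>f. a * u f) = a * \<omega> u" if "u \<in> tangent_space A p" for u a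
    using \<omega> that by (simp add: cotangent_space_def)
  have zero: "\<omega> (\<lambda>f. 0) = 0"
    using scale[OF tangent_space_zero[OF p], of 0] by simp
  show ?thesis
    using u
  proof (induction I rule: infinite_finite_induct)
    case (insert i I)
    have "(\<lambda>f. a i * u i f) \<in> tangent_space A p" "(\<lambda>f. \<Sum>i\<in>I. a i * u i f) \<in> tangent_space A p"
      using insert.prems p by (auto intro!: tangent_space_scale tangent_space_sum)
    then show ?case
      using insert add[of "\<lambda>f. a i * u i f" "\<lambda>f. \<Sum>i\<in>I. a i * u i f"] scale[of "u i" "a i"] by simp
  qed (simp_all add: zero)
qed

lemma covector_expand:
  assumes \<omega>: "\<omega> \<in> cotangent_space A p" and v: "v \<in> tangent_space A p" and c: "c \<in> A" "p \<in> fst c"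
  shows "\<omega> v = (\<Sum>i\<in>UNIV. coord_diff c i v * \<omega> (coord_vec A c i p))"
proof -
  have "\<omega> v = \<omega> (\<lambda>f. \<Sum>i\<in>UNIV. coord_diff c i v * coord_vec A c i p f)"
    using tangent_expand[OF v c] by simp
  also have "\<dots> = (\<Sum>i\<in>UNIV. coord_diff c i v * \<omega> (coord_vec A c i p))"
    by (rule covector_sum[OF \<omega> in_carrier[OF c] coord_vec_tangent[OF c]])
  finally show ?thesis .
qed

text \<open>Inverts the bundle chart on a fibre: \<open>y\<close> prescribes the values on the
  coordinate vectors. The default 0 off the tangent space is the one demanded by
  \<open>cotangent_space\<close>.\<close>

definition covector_of :: "('m, 'n) chart \<Rightarrow> 'm \<Rightarrow> ('n \<Rightarrow> real) \<Rightarrow> 'm covec" where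
  "covector_of c p y = (\<lambda>v. if v \<in> tangent_space A p then \<Sum>i\<in>UNIV. y i * coord_diff c i v else 0)"

lemma covector_of:
  assumes c: "c \<in> A" "p \<in> fst c"
  shows "covector_of c p y \<in> cotangent_space A p" "covector_of c p y (coord_vec A c i p) = y i"
proof -
  show "covector_of c p y \<in> cotangent_space A p"
    unfolding cotangent_space_def covector_of_def
    by (auto simp: tangent_space_add tangent_space_scale coord_diff_def distrib_left sum.distrib sum_distrib_left mult_ac)
  show "covector_of c p y (coord_vec A c i p) = y i"
    by (simp add: covector_of_def coord_vec_tangent[OF c] coord_diff_coord_vec[OF c]
        if_distrib[of "\<lambda>x. _ * x"] cong: if_cong)
qed

text \<open>Equal fibre coordinates determine the covector on the tangent space by linearity;
  elsewhere both covectors are 0, so they are equal as HOL functions.\<close>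

lemma cotangent_chart_inj:
  assumes c: "c \<in> A"
  shows "inj_on (snd (cotangent_chart A c)) (fst (cotangent_chart A c))"
proof (rule inj_onI)
  fix P Q assume P: "P \<in> fst (cotangent_chart A c)" and Q: "Q \<in> fst (cotangent_chart A c)"
    and eq: "snd (cotangent_chart A c) P = snd (cotangent_chart A c) Q"
  have "snd c (fst P) = snd c (fst Q)" using arg_cong[OF eq, of base_part] by simp
  then have p: "fst P = fst Q"
    using inj_onD[OF chart_inj[OF c]] P Q by (auto simp: fst_cotangent_chart)
  have y: "snd P (coord_vec A c i (fst P)) = snd Q (coord_vec A c i (fst P))" for i
    using arg_cong[OF eq, of "\<lambda>z. z $ Inr i"] p by simp
  have "snd P v = snd Q v" for v
  proof (cases "v \<in> tangent_space A (fst P)")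
    case True
    then show ?thesis
      using covector_expand[OF _ True c, of "snd P"] covector_expand[OF _ True c, of "snd Q"] P Q p y
      by (simp add: fst_cotangent_chart)
  next
    case False
    then show ?thesis using P Q p by (simp add: fst_cotangent_chart cotangent_space_def)
  qed
  then show "P = Q" using p by (simp add: prod_eq_iff fun_eq_iff)
qed

text \<open>The image of the part over \<open>V\<close> is a full cylinder, since
  \<open>covector_of\<close> realises all fibre coordinates. Openness in the bundle thereby reduces
  to openness in the base.\<close>

lemma cotangent_chart_image:
  assumes c: "c \<in> A" and V: "V \<subseteq> fst c"
  shows "snd (cotangent_chart A c) ` {P. fst P \<in> V \<and> snd P \<in> cotangent_space A (fst P)} = base_part -` (snd c ` V)"
proof (intro subset_antisym subsetI)
  fix z assume "z \<in> base_part -` (snd c ` V)"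
  then obtain p where p: "p \<in> V" "base_part z = snd c p" by auto
  let ?P = "(p, covector_of c p (\<lambda>i. z $ Inr i))"
  have pc: "p \<in> fst c" using p V by auto
  have "z = snd (cotangent_chart A c) ?P"
  proof (rule vec_eq_iff[THEN iffD2, rule_format])
    fix k
    show "z $ k = snd (cotangent_chart A c) ?P $ k"
      using arg_cong[OF p(2), of "\<lambda>x. x $ _"] covector_of(2)[OF c pc] by (cases k) auto
  qed
  then show "z \<in> snd (cotangent_chart A c) ` {P. fst P \<in> V \<and> snd P \<in> cotangent_space A (fst P)}"
    by (rule image_eqI) (use p covector_of(1)[OF c pc] in auto)
qed auto

lemma open_base_part_vimage: "open S \<Longrightarrow> open (base_part -` S)"
  by (rule open_vimage[OF _ linear_continuous_on[OF bounded_linear_base_part]])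

lemma smooth_on_base_part:
  assumes "open S" "smooth_on S (f :: real ^ 'n \<Rightarrow> real)"
  shows "smooth_on (base_part -` S) (\<lambda>z. f (base_part z))"
  by (rule smooth_on_compose[OF open_base_part_vimage[OF assms(1)] _ smooth_on_linear[OF bounded_linear_base_part] assms(2)]) auto

text \<open>Under a change of chart the base coordinates change as on the base, and the fibre
  coordinates change linearly with Jacobian coefficients that are smooth functions of the base
  point.\<close>

lemma cotangent_smooth_atlas: "smooth_atlas (cotangent_atlas A)"
proof
  fix C assume "C \<in> cotangent_atlas A"
  then obtain c where c: "c \<in> A" and C: "C = cotangent_chart A c" by (auto simp: cotangent_atlas_def)
  show "inj_on (snd C) (fst C)" unfolding C by (rule cotangent_chart_inj[OF c])
  have "fst C = {P. fst P \<in> fst c \<and> snd P \<in> cotangent_space A (fst P)}"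
    by (auto simp: C fst_cotangent_chart)
  then show "open (snd C ` fst C)"
    using cotangent_chart_image[OF c subset_refl] open_base_part_vimage[OF chart_image_open[OF c]] by (simp add: C)
next
  fix C C' assume "C \<in> cotangent_atlas A" "C' \<in> cotangent_atlas A"
  then obtain c d where c: "c \<in> A" and C: "C = cotangent_chart A c" and d: "d \<in> A" and C': "C' = cotangent_chart A d"
    by (auto simp: cotangent_atlas_def)
  let ?S = "base_part -` (snd c ` (fst c \<inter> fst d)) :: (real ^ ('n + 'n)) set"
  have "fst C \<inter> fst C' = {P. fst P \<in> fst c \<inter> fst d \<and> snd P \<in> cotangent_space A (fst P)}"
    by (auto simp: C C' fst_cotangent_chart)
  then have im: "snd C ` (fst C \<inter> fst C') = ?S"
    using cotangent_chart_image[OF c, of "fst c \<inter> fst d"] by (simp add: C)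
  have S: "open ?S" by (rule open_base_part_vimage[OF overlap_open[OF c d]])
  show "open (snd C ` (fst C \<inter> fst C'))" unfolding im by (rule S)
  have inv: "inv_into (fst C) (snd C) (snd C P) = P" if "P \<in> fst C" for P
    unfolding C by (rule inv_into_f_f[OF cotangent_chart_inj[OF c]]) (use that in \<open>simp add: C\<close>)
  have pull: "smooth_on ?S (\<lambda>z. chart_rep c f (base_part z))" if "smooth_fun A (fst c \<inter> fst d) f" for f :: "'m \<Rightarrow> real"
  proof (rule smooth_on_base_part[OF overlap_open[OF c d]])
    have "fst c \<inter> fst d \<inter> fst c = fst c \<inter> fst d" by auto
    then show "smooth_on (snd c ` (fst c \<inter> fst d)) (chart_rep c f)"
      using that c unfolding smooth_fun_iff by metis
  qed
  have smooth_Inl: "smooth_on ?S (\<lambda>z. chart_rep c (\<lambda>q. snd d q $ i) (base_part z))" for i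
    by (rule pull[OF smooth_fun_Int2[OF smooth_fun_coord[OF d] openin_chart[OF c]]])
  have J: "smooth_fun A (fst c \<inter> fst d) (\<lambda>q. coord_diff c i (coord_vec A d a q))" for i a
    using vector_field_component[OF vector_field_coord[OF d] c] by (simp add: Int_commute)
  \<comment> \<open>The transformation law of covector components: a Jacobian entry pulled back from
    the base times a linear coordinate function.\<close>
  have smooth_Inr: "smooth_on ?S (\<lambda>z. \<Sum>i\<in>UNIV. chart_rep c (\<lambda>q. coord_diff c i (coord_vec A d a q)) (base_part z) * z $ Inr i)" for a
    unfolding smooth_on_def
    by (intro allI Ck_on_sum Ck_on_mult S smooth_onD[OF pull[OF J]] Ck_on_linear bounded_linear_vec_nth) auto
  show "smooth_on (snd C ` (fst C \<inter> fst C')) (chart_rep C (snd C'))"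
    unfolding im
  proof (rule smooth_on_vecI[OF S])
    fix k
    show "smooth_on ?S (\<lambda>z. chart_rep C (snd C') z $ k)"
    proof (cases k)
      case (Inl i)
      show ?thesis
      proof (rule smooth_on_cong[OF S _ smooth_Inl[of i]])
        fix z assume "z \<in> ?S"
        then obtain P where P: "P \<in> fst C" "z = snd C P" unfolding im[symmetric] by auto
        then have "fst P \<in> fst c" by (simp add: C fst_cotangent_chart)
        then show "chart_rep c (\<lambda>q. snd d q $ i) (base_part z) = chart_rep C (snd C') z $ k"
          unfolding chart_rep_def[of C] P(2) inv[OF P(1)] Inl using c by (simp add: C C')
      qed
    next
      case (Inr a)
      show ?thesis
      proof (rule smooth_on_cong[OF S _ smooth_Inr[of a]])
        fix z assume "z \<in> ?S"
        then obtain P where P: "P \<in> fst C" "P \<in> fst C'" "z = snd C P" unfolding im[symmetric] by auto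
        then have p: "fst P \<in> fst c" "fst P \<in> fst d" "snd P \<in> cotangent_space A (fst P)"
          by (simp_all add: C C' fst_cotangent_chart)
        show "(\<Sum>i\<in>UNIV. chart_rep c (\<lambda>q. coord_diff c i (coord_vec A d a q)) (base_part z) * z $ Inr i) = chart_rep C (snd C') z $ k"
          using covector_expand[OF p(3) coord_vec_tangent[OF d p(2)] c p(1)] p(1) c
          unfolding chart_rep_def[of C] P(3) inv[OF P(1)] Inr by (simp add: C C')
      qed
    qed
  qed
qed

lemma carrier_cotangent: "P \<in> carrier (cotangent_atlas A) \<longleftrightarrow> fst P \<in> carrier A \<and> snd P \<in> cotangent_space A (fst P)"
  unfolding carrier_def split_def cotangent_atlas_def by (auto simp: fst_cotangent_chart)

lemma cotangent_chart_in_atlas: "c \<in> A \<Longrightarrow> cotangent_chart A c \<in> cotangent_atlas A"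
  by (simp add: cotangent_atlas_def)

lemma zero_covector: "(\<lambda>v. 0) \<in> cotangent_space A p"
  by (simp add: cotangent_space_def)

end

locale cotangent_bundle = smooth_atlas A for A :: "('m, 'n::finite) chart set"

sublocale cotangent_bundle \<subseteq> T: smooth_atlas "cotangent_atlas A"
  by (rule cotangent_smooth_atlas)

section \<open>Pullbacks from the base and fibre coordinates\<close>

context cotangent_bundle
begin

lemma chart_rep_pullback:
  assumes "c \<in> A" "P \<in> fst (cotangent_chart A c)"
  shows "chart_rep (cotangent_chart A c) (\<lambda>P. f (fst P)) (snd (cotangent_chart A c) P) = f (fst P)"
    and "chart_rep c f (base_part (snd (cotangent_chart A c) P)) = f (fst P)"
  using assms T.chart_rep_at[OF cotangent_chart_in_atlas[OF assms(1)] assms(2)] by (simp_all add: fst_cotangent_chart)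

text \<open>In bundle charts a pulled-back function is its base expression composed with the linear
  map \<open>base_part\<close>.\<close>

lemma smooth_fun_pullback:
  assumes f: "smooth_fun A W f"
  shows "smooth_fun (cotangent_atlas A) {P \<in> carrier (cotangent_atlas A). fst P \<in> W} (\<lambda>P. f (fst P))"
    (is "smooth_fun _ ?W _")
  unfolding T.smooth_fun_iff T.openin_mtop
proof (intro conjI ballI)
  have W: "openin (mtop A) W" by (rule smooth_fun_openin[OF f])
  show "?W \<subseteq> carrier (cotangent_atlas A)" by auto
  fix C assume "C \<in> cotangent_atlas A"
  then obtain c where c: "c \<in> A" and C: "C = cotangent_chart A c" by (auto simp: cotangent_atlas_def)
  have "?W \<inter> fst C = {P. fst P \<in> W \<inter> fst c \<and> snd P \<in> cotangent_space A (fst P)}"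
    using in_carrier[OF c] by (auto simp: C fst_cotangent_chart carrier_cotangent)
  then have im: "snd C ` (?W \<inter> fst C) = base_part -` (snd c ` (W \<inter> fst c))"
    using cotangent_chart_image[OF c, of "W \<inter> fst c"] by (simp add: C)
  have o: "open (snd c ` (W \<inter> fst c))" by (rule open_chart_image[OF W c])
  show "open (snd C ` (?W \<inter> fst C))" unfolding im by (rule open_base_part_vimage[OF o])
  have "smooth_on (base_part -` (snd c ` (W \<inter> fst c))) (\<lambda>z. chart_rep c f (base_part z))"
    by (rule smooth_on_base_part[OF o]) (use f c in \<open>auto simp: smooth_fun_iff\<close>)
  then show "smooth_on (snd C ` (?W \<inter> fst C)) (chart_rep C (\<lambda>P. f (fst P)))"
    unfolding im[symmetric]
  proof (rule smooth_on_cong[rotated 2])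
    show "open (snd C ` (?W \<inter> fst C))" unfolding im by (rule open_base_part_vimage[OF o])
    fix z assume "z \<in> snd C ` (?W \<inter> fst C)"
    then obtain Q where "Q \<in> fst C" "z = snd C Q" by blast
    then show "chart_rep c f (base_part z) = chart_rep C (\<lambda>P. f (fst P)) z"
      using chart_rep_pullback[OF c, of Q f] by (simp add: C)
  qed
qed

lemma smooth_fun_pullback_chart:
  assumes c: "c \<in> A" and f: "smooth_fun A (fst c) f"
  shows "smooth_fun (cotangent_atlas A) (fst (cotangent_chart A c)) (\<lambda>P. f (fst P))"
  by (rule T.smooth_fun_subset[OF smooth_fun_pullback[OF f] T.openin_chart[OF cotangent_chart_in_atlas[OF c]]])
    (use in_carrier[OF c] in \<open>auto simp: fst_cotangent_chart carrier_cotangent\<close>)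

lemma smooth_at_pullback:
  assumes "P \<in> carrier (cotangent_atlas A)" "smooth_at A (fst P) f"
  shows "smooth_at (cotangent_atlas A) P (\<lambda>P. f (fst P))"
proof -
  obtain W where W: "fst P \<in> W" "smooth_fun A W f" using assms(2) by (auto simp: smooth_at_def)
  show ?thesis by (rule T.smooth_atI[OF smooth_fun_pullback[OF W(2)]]) (simp add: assms(1) W(1))
qed

lemma coord_vec_pullback:
  assumes c: "c \<in> A" and P: "P \<in> fst (cotangent_chart A c)" and f: "smooth_at A (fst P) f"
  shows "coord_vec (cotangent_atlas A) (cotangent_chart A c) (Inl i) P (\<lambda>P. f (fst P)) = coord_vec A c i (fst P) f"
    and "coord_vec (cotangent_atlas A) (cotangent_chart A c) (Inr i) P (\<lambda>P. f (fst P)) = 0"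
proof -
  let ?C = "cotangent_chart A c"
  have C: "?C \<in> cotangent_atlas A" by (rule cotangent_chart_in_atlas[OF c])
  have p: "fst P \<in> fst c" using P by (simp add: fst_cotangent_chart)
  note d = smooth_at_rep_differentiable[OF c p f]
  have "((\<lambda>z. chart_rep c f (base_part z)) has_derivative
      (\<lambda>w. frechet_derivative (chart_rep c f) (at (snd c (fst P))) (base_part w))) (at (snd ?C P))"
    by (rule has_derivative_compose[where g = "chart_rep c f" and s = UNIV])
      (use has_derivative_frechet[OF d] in \<open>auto intro: bounded_linear_imp_has_derivative bounded_linear_base_part\<close>)
  then have "(chart_rep ?C (\<lambda>P. f (fst P)) has_derivative
      (\<lambda>w. frechet_derivative (chart_rep c f) (at (snd c (fst P))) (base_part w))) (at (snd ?C P))"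
  proof (rule has_derivative_transform_within_open[OF _ T.chart_image_open[OF C]])
    fix z assume "z \<in> snd ?C ` fst ?C"
    then obtain Q where "Q \<in> fst ?C" "z = snd ?C Q" by blast
    then show "chart_rep c f (base_part z) = chart_rep ?C (\<lambda>P. f (fst P)) z"
      using chart_rep_pullback[OF c, of Q f] by simp
  qed (use P in simp)
  note e = frechet_derivative_eqI[OF this]
  have s: "smooth_at (cotangent_atlas A) P (\<lambda>P. f (fst P))"
    by (rule smooth_at_pullback[OF T.in_carrier[OF C P] f])
  show "coord_vec (cotangent_atlas A) ?C (Inl i) P (\<lambda>P. f (fst P)) = coord_vec A c i (fst P) f"
    "coord_vec (cotangent_atlas A) ?C (Inr i) P (\<lambda>P. f (fst P)) = 0"
    using s f linear_0[OF linear_frechet_derivative[OF d]]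
    by (simp_all add: coord_vec_def T.coord_deriv_eq coord_deriv_eq e)
qed

lemma tangent_pullback:
  assumes c: "c \<in> A" and P: "P \<in> fst (cotangent_chart A c)" and f: "smooth_at A (fst P) f"
    and \<xi>: "\<xi> \<in> tangent_space (cotangent_atlas A) P"
  shows "\<xi> (\<lambda>P. f (fst P)) = (\<Sum>i\<in>UNIV. coord_diff (cotangent_chart A c) (Inl i) \<xi> * coord_vec A c i (fst P) f)"
  using T.tangent_apply[OF \<xi> cotangent_chart_in_atlas[OF c] P] by (simp add: sum_UNIV_sum coord_vec_pullback[OF c P f])

definition momentum :: "('m, 'n) chart \<Rightarrow> 'n \<Rightarrow> 'm \<times> 'm covec \<Rightarrow> real" where
  "momentum c i P = snd P (coord_vec A c i (fst P))"

lemma momentum_smooth: "c \<in> A \<Longrightarrow> smooth_fun (cotangent_atlas A) (fst (cotangent_chart A c)) (momentum c i)"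
  using T.smooth_fun_coord[OF cotangent_chart_in_atlas, of c "Inr i"] by (simp add: momentum_def[abs_def])

lemma coord_diff_momentum: "coord_diff (cotangent_chart A c) (Inr i) \<xi> = \<xi> (momentum c i)"
  by (simp add: coord_diff_def momentum_def[abs_def])

lemma coord_vec_momentum:
  assumes "c \<in> A" "P \<in> fst (cotangent_chart A c)"
  shows "coord_vec (cotangent_atlas A) (cotangent_chart A c) (Inl i) P (momentum c j) = 0"
    and "coord_vec (cotangent_atlas A) (cotangent_chart A c) (Inr i) P (momentum c j) = (if i = j then 1 else 0)"
  using T.coord_diff_coord_vec[OF cotangent_chart_in_atlas[OF assms(1)] assms(2)]
  by (simp_all flip: coord_diff_momentum)

lemma momentum_change:
  assumes c: "c \<in> A" "P \<in> fst (cotangent_chart A c)" and d: "d \<in> A" "P \<in> fst (cotangent_chart A d)"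
  shows "momentum d a P = (\<Sum>i\<in>UNIV. coord_diff c i (coord_vec A d a (fst P)) * momentum c i P)"
  unfolding momentum_def using assms
  by (intro covector_expand coord_vec_tangent) (auto simp: fst_cotangent_chart)

end

section \<open>The modified Riemannian extension as a tensor field\<close>

lemma sum_sym_half:
  fixes B :: "'n \<Rightarrow> 'n::finite \<Rightarrow> real"
  assumes "\<And>i j. B i j = B j i"
  shows "(\<Sum>i\<in>UNIV. \<Sum>j\<in>UNIV. B i j * ((a i * b j + a j * b i) / 2)) = (\<Sum>i\<in>UNIV. \<Sum>j\<in>UNIV. B i j * a i * b j)"
proof -
  have "(\<Sum>i\<in>UNIV. \<Sum>j\<in>UNIV. B i j * a j * b i) = (\<Sum>i\<in>UNIV. \<Sum>j\<in>UNIV. B i j * a i * b j)"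
    by (subst sum.swap) (simp add: assms)
  moreover have "(\<Sum>i\<in>UNIV. \<Sum>j\<in>UNIV. B i j * ((a i * b j + a j * b i) / 2))
      = ((\<Sum>i\<in>UNIV. \<Sum>j\<in>UNIV. B i j * a i * b j) + (\<Sum>i\<in>UNIV. \<Sum>j\<in>UNIV. B i j * a j * b i)) / 2"
    by (simp add: sum.distrib add_divide_distrib distrib_left sum_divide_distrib mult.assoc)
  ultimately show ?thesis by simp
qed

text \<open>Transforming the coefficients of a bilinear form by \<open>J\<close> amounts to
  transforming its two arguments.\<close>

lemma sum_bilinear_change:
  fixes Q :: "'n \<Rightarrow> 'n::finite \<Rightarrow> real"
  shows "(\<Sum>a\<in>UNIV. \<Sum>b\<in>UNIV. (\<Sum>i\<in>UNIV. \<Sum>j\<in>UNIV. J i a * J j b * Q i j) * (x a * y b))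
    = (\<Sum>i\<in>UNIV. \<Sum>j\<in>UNIV. Q i j * ((\<Sum>a\<in>UNIV. J i a * x a) * (\<Sum>b\<in>UNIV. J j b * y b)))"
proof -
  have "(\<Sum>a\<in>UNIV. \<Sum>b\<in>UNIV. (\<Sum>i\<in>UNIV. \<Sum>j\<in>UNIV. J i a * J j b * Q i j) * (x a * y b))
      = (\<Sum>a\<in>UNIV. \<Sum>b\<in>UNIV. \<Sum>i\<in>UNIV. \<Sum>j\<in>UNIV. Q i j * (J i a * x a) * (J j b * y b))"
    unfolding sum_distrib_right by (simp add: mult_ac)
  also have "\<dots> = (\<Sum>i\<in>UNIV. \<Sum>a\<in>UNIV. \<Sum>b\<in>UNIV. \<Sum>j\<in>UNIV. Q i j * (J i a * x a) * (J j b * y b))"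
    by (rule sum_rotate3)
  also have "\<dots> = (\<Sum>i\<in>UNIV. \<Sum>j\<in>UNIV. \<Sum>a\<in>UNIV. \<Sum>b\<in>UNIV. Q i j * (J i a * x a) * (J j b * y b))"
    by (rule sum.cong[OF refl], rule sum_rotate3)
  also have "\<dots> = (\<Sum>i\<in>UNIV. \<Sum>j\<in>UNIV. Q i j * ((\<Sum>a\<in>UNIV. J i a * x a) * (\<Sum>b\<in>UNIV. J j b * y b)))"
    unfolding sum_product unfolding sum_distrib_left by (simp add: mult.assoc)
  finally show ?thesis .
qed

locale modified_extension = atlas_connection A D
  for A :: "('m, 'n::finite) chart set"
    and D :: "('m \<Rightarrow> 'm tvec) \<Rightarrow> ('m \<Rightarrow> 'm tvec) \<Rightarrow> 'm \<Rightarrow> 'm tvec" +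
  fixes \<Phi> :: "'m \<Rightarrow> 'm tvec \<Rightarrow> 'm tvec \<Rightarrow> real" and \<kappa> :: real
  assumes torsion_free: "torsion_free A D" and \<Phi>: "symmetric_tensor_field A \<Phi>"

sublocale modified_extension \<subseteq> cotangent_bundle A
  by unfold_locales

context modified_extension
begin

abbreviation "TA \<equiv> cotangent_atlas A"
abbreviation "TC \<equiv> cotangent_chart A"
abbreviation "g \<equiv> modified_riemannian_extension A D \<Phi> \<kappa>"
abbreviation "\<Gamma> \<equiv> christoffel A D"

definition \<Phi>_coeff :: "('m, 'n) chart \<Rightarrow> 'n \<Rightarrow> 'n \<Rightarrow> 'm \<Rightarrow> real" where
  "\<Phi>_coeff c i j p = \<Phi> p (coord_vec A c i p) (coord_vec A c j p)"

definition mre_coeff :: "('m, 'n) chart \<Rightarrow> 'n \<Rightarrow> 'n \<Rightarrow> 'm \<times> 'm covec \<Rightarrow> real" where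
  "mre_coeff c i j P = \<kappa> * momentum c i P * momentum c j P + \<Phi>_coeff c i j (fst P)
     - 2 * (\<Sum>k\<in>UNIV. momentum c k P * \<Gamma> c i j k (fst P))"

lemma base_point: "P \<in> fst (TC c) \<Longrightarrow> fst P \<in> fst c"
  by (simp add: fst_cotangent_chart)

lemma TC_in_TA: "c \<in> A \<Longrightarrow> TC c \<in> TA"
  by (rule cotangent_chart_in_atlas)

lemma TA_charts: "C \<in> TA \<Longrightarrow> \<exists>c\<in>A. C = TC c"
  by (auto simp: cotangent_atlas_def)

lemma christoffel_sym:
  assumes "c \<in> A" "p \<in> fst c"
  shows "\<Gamma> c i j k p = \<Gamma> c j i k p"
proof -
  have "(\<lambda>f. D (coord_vec A c i) (coord_vec A c j) p f - D (coord_vec A c j) (coord_vec A c i) p f)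
      = lie_bracket A (coord_vec A c i) (coord_vec A c j) p"
    using torsion_free vector_field_coord[OF assms(1)] assms(2) unfolding torsion_free_def by blast
  from fun_cong[OF this, of "\<lambda>q. snd c q $ k"] show ?thesis
    by (simp add: christoffel_def coord_diff_def lie_bracket_coord_vec[OF assms])
qed

lemma \<Phi>_coeff_sym: "c \<in> A \<Longrightarrow> p \<in> fst c \<Longrightarrow> \<Phi>_coeff c i j p = \<Phi>_coeff c j i p"
  unfolding \<Phi>_coeff_def by (intro tensor_sym[OF \<Phi>] coord_vec_tangent)

lemma \<Phi>_coeff_smooth: "c \<in> A \<Longrightarrow> smooth_fun A (fst c) (\<Phi>_coeff c i j)"
  unfolding \<Phi>_coeff_def[abs_def] by (intro tensor_smooth[OF \<Phi>] vector_field_coord)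

lemma mre_coeff_sym: "c \<in> A \<Longrightarrow> P \<in> fst (TC c) \<Longrightarrow> mre_coeff c i j P = mre_coeff c j i P"
  using christoffel_sym[of c "fst P" i j] \<Phi>_coeff_sym[of c "fst P" i j] base_point[of P c] by (simp add: mre_coeff_def)

lemma mre_coeff_smooth:
  assumes c: "c \<in> A"
  shows "smooth_fun TA (fst (TC c)) (mre_coeff c i j)"
  unfolding mre_coeff_def[abs_def]
  by (intro T.smooth_fun_intros momentum_smooth c smooth_fun_pullback_chart \<Phi>_coeff_smooth
      christoffel_smooth openin_chart T.openin_chart TC_in_TA) auto

lemma mre_in_chart_eq:
  assumes "c \<in> A" "P \<in> fst (TC c)"
  shows "mre_in_chart A D \<Phi> \<kappa> c P \<xi> \<eta> =
    (\<Sum>i\<in>UNIV. coord_diff (TC c) (Inl i) \<xi> * coord_diff (TC c) (Inr i) \<eta> + coord_diff (TC c) (Inr i) \<xi> * coord_diff (TC c) (Inl i) \<eta>)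
    + (\<Sum>i\<in>UNIV. \<Sum>j\<in>UNIV. mre_coeff c i j P * coord_diff (TC c) (Inl i) \<xi> * coord_diff (TC c) (Inl j) \<eta>)"
proof -
  have "mre_in_chart A D \<Phi> \<kappa> c P \<xi> \<eta> =
    (\<Sum>i\<in>UNIV. coord_diff (TC c) (Inl i) \<xi> * coord_diff (TC c) (Inr i) \<eta> + coord_diff (TC c) (Inr i) \<xi> * coord_diff (TC c) (Inl i) \<eta>)
    + (\<Sum>i\<in>UNIV. \<Sum>j\<in>UNIV. mre_coeff c i j P *
      ((coord_diff (TC c) (Inl i) \<xi> * coord_diff (TC c) (Inl j) \<eta> + coord_diff (TC c) (Inl j) \<xi> * coord_diff (TC c) (Inl i) \<eta>) / 2))"
    by (simp add: mre_in_chart_def sym_prod_def mre_coeff_def \<Phi>_coeff_def momentum_def Let_def sum_distrib_left add_divide_distrib)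
  then show ?thesis
    unfolding sum_sym_half[of "\<lambda>i j. mre_coeff c i j P", OF mre_coeff_sym[OF assms]] by simp
qed

text \<open>The c-term and the \<Phi>-term are tensorial. Each of the two mixed sums of base and
  fibre differentials acquires the same term \<open>Z\<close> in the second derivatives of the
  change of coordinates, and the inhomogeneous part of the law for Christoffel symbols contributes
  \<open>-2 * Z\<close>.\<close>

lemma mre_in_chart_change:
  assumes c: "c \<in> A" "P \<in> fst (TC c)" and d: "d \<in> A" "P \<in> fst (TC d)"
    and \<xi>: "\<xi> \<in> tangent_space TA P" and \<eta>: "\<eta> \<in> tangent_space TA P"
  shows "mre_in_chart A D \<Phi> \<kappa> d P \<xi> \<eta> = mre_in_chart A D \<Phi> \<kappa> c P \<xi> \<eta>"
proof -
  define p where "p = fst P"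
  have pc: "p \<in> fst c" and pd: "p \<in> fst d" using c d by (simp_all add: p_def base_point)
  define J where "J = (\<lambda>i a. coord_diff c i (coord_vec A d a p))"
  \<comment> \<open>The second derivatives of the coordinates of \<open>c\<close> with respect to
    those of \<open>d\<close>; their symmetry makes the two correction terms coincide.\<close>
  define H where "H = (\<lambda>i b a. coord_vec A d b p (\<lambda>q. coord_diff c i (coord_vec A d a q)))"
  define y yd where "y = (\<lambda>i. momentum c i P)" and "yd = (\<lambda>a. momentum d a P)"
  have Hsym: "H i b a = H i a b" for i a b
    unfolding H_def coord_diff_def by (rule coord_vec_commute[OF d(1) pd smooth_at_coord[OF c(1) pc]])
  have Js: "smooth_at A p (\<lambda>q. coord_diff c i (coord_vec A d a q))" for i a
    using vector_field_component[OF vector_field_coord[OF d(1)] c(1)] pc pd by (auto intro: smooth_atI)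
  have yd: "yd a = (\<Sum>i\<in>UNIV. J i a * y i)" for a
    unfolding yd_def y_def J_def p_def by (rule momentum_change[OF c d])
  have comp: "coord_diff (TC c) (Inl i) \<zeta> = (\<Sum>a\<in>UNIV. J i a * coord_diff (TC d) (Inl a) \<zeta>)"
    if \<zeta>: "\<zeta> \<in> tangent_space TA P" for \<zeta> i
    using tangent_pullback[OF d, of "\<lambda>q. snd c q $ i" \<zeta>] \<zeta> smooth_at_coord[OF c(1) pc]
    by (simp add: coord_diff_def J_def p_def mult.commute)
  \<comment> \<open>Differentiating the linear law for the fibre coordinates: besides the Jacobian
    term, the derivative of the Jacobian along the base appears.\<close>
  have comp': "coord_diff (TC d) (Inr a) \<zeta> = (\<Sum>i\<in>UNIV. J i a * coord_diff (TC c) (Inr i) \<zeta>)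
      + (\<Sum>b\<in>UNIV. \<Sum>i\<in>UNIV. coord_diff (TC d) (Inl b) \<zeta> * (H i b a * y i))"
    if \<zeta>: "\<zeta> \<in> tangent_space TA P" for \<zeta> a
  proof -
    have Ps: "smooth_at TA P (\<lambda>Q. coord_diff c i (coord_vec A d a (fst Q)))" for i
      by (rule smooth_at_pullback[OF T.in_carrier[OF TC_in_TA[OF c(1)] c(2)] Js[unfolded p_def]])
    note ms = T.smooth_atI[OF momentum_smooth[OF c(1)] c(2)]
    have "\<zeta> (momentum d a) = \<zeta> (\<lambda>Q. \<Sum>i\<in>UNIV. coord_diff c i (coord_vec A d a (fst Q)) * momentum c i Q)"
      by (rule T.tangent_cong[OF \<zeta> openin_Int[OF T.openin_chart[OF TC_in_TA[OF c(1)]] T.openin_chart[OF TC_in_TA[OF d(1)]]]])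
        (use c d in \<open>auto intro!: momentum_change\<close>)
    also have "\<dots> = (\<Sum>i\<in>UNIV. \<zeta> (\<lambda>Q. coord_diff c i (coord_vec A d a (fst Q)) * momentum c i Q))"
      by (rule T.tangent_sum[OF \<zeta> T.smooth_at_mult[OF Ps ms]])
    also have "\<dots> = (\<Sum>i\<in>UNIV. \<zeta> (\<lambda>Q. coord_diff c i (coord_vec A d a (fst Q))) * y i + J i a * \<zeta> (momentum c i))"
      unfolding T.tangent_mult[OF \<zeta> Ps ms] y_def J_def p_def ..
    also have "\<dots> = (\<Sum>i\<in>UNIV. J i a * \<zeta> (momentum c i)) + (\<Sum>i\<in>UNIV. \<Sum>b\<in>UNIV. coord_diff (TC d) (Inl b) \<zeta> * (H i b a * y i))"
      unfolding tangent_pullback[OF d Js[unfolded p_def] \<zeta>] H_def p_def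
      by (simp add: sum.distrib sum_distrib_right mult.assoc)
    also have "(\<Sum>i\<in>UNIV. \<Sum>b\<in>UNIV. coord_diff (TC d) (Inl b) \<zeta> * (H i b a * y i))
        = (\<Sum>b\<in>UNIV. \<Sum>i\<in>UNIV. coord_diff (TC d) (Inl b) \<zeta> * (H i b a * y i))"
      by (rule sum.swap)
    finally show ?thesis unfolding coord_diff_momentum .
  qed
  define x u x' u' where "x = (\<lambda>a. coord_diff (TC d) (Inl a) \<xi>)" and "u = (\<lambda>a. coord_diff (TC d) (Inl a) \<eta>)"
    and "x' = (\<lambda>i. coord_diff (TC c) (Inr i) \<xi>)" and "u' = (\<lambda>i. coord_diff (TC c) (Inr i) \<eta>)"
  define X U where "X = (\<lambda>i. \<Sum>a\<in>UNIV. J i a * x a)" and "U = (\<lambda>i. \<Sum>a\<in>UNIV. J i a * u a)"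
  define Z where "Z = (\<Sum>a\<in>UNIV. \<Sum>b\<in>UNIV. \<Sum>i\<in>UNIV. x a * (u b * (H i b a * y i)))"
  have XU: "coord_diff (TC c) (Inl i) \<xi> = X i" "coord_diff (TC c) (Inl i) \<eta> = U i" for i
    unfolding comp[OF \<xi>] comp[OF \<eta>] X_def U_def x_def u_def by simp_all
  have lin: "(\<Sum>a\<in>UNIV. x a * (\<Sum>i\<in>UNIV. J i a * v i)) = (\<Sum>i\<in>UNIV. X i * v i)"
    "(\<Sum>a\<in>UNIV. u a * (\<Sum>i\<in>UNIV. J i a * v i)) = (\<Sum>i\<in>UNIV. U i * v i)" for v
    unfolding X_def U_def sum_distrib_left sum_distrib_right by (subst sum.swap, simp add: mult_ac)+
  have T1: "(\<Sum>a\<in>UNIV. x a * coord_diff (TC d) (Inr a) \<eta>) = (\<Sum>i\<in>UNIV. X i * u' i) + Z"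
    unfolding comp'[OF \<eta>] Z_def lin(1)[symmetric] u'_def u_def by (simp add: distrib_left sum.distrib sum_distrib_left)
  have T2: "(\<Sum>a\<in>UNIV. coord_diff (TC d) (Inr a) \<xi> * u a) = (\<Sum>i\<in>UNIV. x' i * U i) + Z"
  proof -
    have "(\<Sum>a\<in>UNIV. coord_diff (TC d) (Inr a) \<xi> * u a) = (\<Sum>a\<in>UNIV. u a * (\<Sum>i\<in>UNIV. J i a * x' i))
        + (\<Sum>a\<in>UNIV. \<Sum>b\<in>UNIV. \<Sum>i\<in>UNIV. u a * (x b * (H i b a * y i)))"
      unfolding comp'[OF \<xi>] x'_def x_def by (simp add: distrib_left distrib_right sum.distrib sum_distrib_left sum_distrib_right mult_ac)
    also have "(\<Sum>a\<in>UNIV. \<Sum>b\<in>UNIV. \<Sum>i\<in>UNIV. u a * (x b * (H i b a * y i))) = Z"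
      unfolding Z_def by (subst sum.swap) (simp add: Hsym mult_ac)
    finally show ?thesis unfolding lin(2) by (simp add: mult.commute)
  qed
  have T3: "(\<Sum>a\<in>UNIV. \<Sum>b\<in>UNIV. yd a * yd b * (x a * u b)) = (\<Sum>i\<in>UNIV. \<Sum>j\<in>UNIV. y i * y j * (X i * U j))"
  proof -
    have "(\<Sum>a\<in>UNIV. \<Sum>b\<in>UNIV. yd a * yd b * (x a * u b)) = (\<Sum>a\<in>UNIV. x a * yd a) * (\<Sum>b\<in>UNIV. u b * yd b)"
      unfolding sum_product by (simp add: mult_ac)
    also have "\<dots> = (\<Sum>i\<in>UNIV. X i * y i) * (\<Sum>j\<in>UNIV. U j * y j)"
      unfolding yd lin ..
    finally show ?thesis unfolding sum_product by (simp add: mult_ac)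
  qed
  have T4: "(\<Sum>a\<in>UNIV. \<Sum>b\<in>UNIV. \<Phi>_coeff d a b p * (x a * u b)) = (\<Sum>i\<in>UNIV. \<Sum>j\<in>UNIV. \<Phi>_coeff c i j p * (X i * U j))"
  proof -
    have "\<Phi>_coeff d a b p = (\<Sum>i\<in>UNIV. \<Sum>j\<in>UNIV. J i a * J j b * \<Phi>_coeff c i j p)" for a b
      unfolding \<Phi>_coeff_def J_def
      by (rule tensor_expand[OF \<Phi> coord_vec_tangent[OF d(1) pd] coord_vec_tangent[OF d(1) pd] c(1) pc])
    then show ?thesis by (simp only: sum_bilinear_change X_def U_def)
  qed
  \<comment> \<open>The law for Christoffel symbols, contracted with the fibre coordinates. It is
    obtained by computing the \<open>c\<close>-components of the covariant derivative of one
    coordinate field of \<open>d\<close> along another in two ways.\<close>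
  have Gam: "(\<Sum>e\<in>UNIV. yd e * \<Gamma> d a b e p) = (\<Sum>k\<in>UNIV. H k a b * y k)
      + (\<Sum>i\<in>UNIV. \<Sum>j\<in>UNIV. J i a * J j b * (\<Sum>k\<in>UNIV. y k * \<Gamma> c i j k p))" for a b
  proof -
    let ?W = "D (coord_vec A d a) (coord_vec A d b) p"
    have tW: "?W \<in> tangent_space A p"
      by (rule vector_field_tangent[OF conn_field[OF _ vector_field_coord[OF d(1)] vector_field_coord[OF d(1)]] pd]) simp
    have 1: "coord_diff c k ?W = (\<Sum>e\<in>UNIV. \<Gamma> d a b e p * J k e)" for k
      unfolding coord_diff_def[of c] J_def by (subst tangent_apply[OF tW d(1) pd]) (simp add: christoffel_def)
    have 2: "coord_diff c k ?W = H k a b + (\<Sum>i\<in>UNIV. \<Sum>j\<in>UNIV. J i a * J j b * \<Gamma> c i j k p)" for k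
      unfolding H_def J_def by (rule coord_diff_conn[OF _ vector_field_coord[OF d(1)] vector_field_coord[OF d(1)] pd c(1) pc]) simp
    have "(\<Sum>e\<in>UNIV. yd e * \<Gamma> d a b e p) = (\<Sum>k\<in>UNIV. coord_diff c k ?W * y k)"
      unfolding yd 1 sum_distrib_right by (subst sum.swap) (simp add: mult_ac)
    also have "\<dots> = (\<Sum>k\<in>UNIV. H k a b * y k) + (\<Sum>k\<in>UNIV. \<Sum>i\<in>UNIV. \<Sum>j\<in>UNIV. J i a * J j b * (y k * \<Gamma> c i j k p))"
      unfolding 2 distrib_right sum.distrib sum_distrib_right by (simp add: mult_ac)
    also have "(\<Sum>k\<in>UNIV. \<Sum>i\<in>UNIV. \<Sum>j\<in>UNIV. J i a * J j b * (y k * \<Gamma> c i j k p))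
        = (\<Sum>i\<in>UNIV. \<Sum>j\<in>UNIV. J i a * J j b * (\<Sum>k\<in>UNIV. y k * \<Gamma> c i j k p))"
      unfolding sum_distrib_left by (rule sum_rotate3[symmetric])
    finally show ?thesis .
  qed
  have T5: "(\<Sum>a\<in>UNIV. \<Sum>b\<in>UNIV. (\<Sum>e\<in>UNIV. yd e * \<Gamma> d a b e p) * (x a * u b))
      = Z + (\<Sum>i\<in>UNIV. \<Sum>j\<in>UNIV. (\<Sum>k\<in>UNIV. y k * \<Gamma> c i j k p) * (X i * U j))"
  proof -
    have "(\<Sum>a\<in>UNIV. \<Sum>b\<in>UNIV. (\<Sum>e\<in>UNIV. yd e * \<Gamma> d a b e p) * (x a * u b))
        = (\<Sum>a\<in>UNIV. \<Sum>b\<in>UNIV. (\<Sum>k\<in>UNIV. H k a b * y k) * (x a * u b))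
        + (\<Sum>a\<in>UNIV. \<Sum>b\<in>UNIV. (\<Sum>i\<in>UNIV. \<Sum>j\<in>UNIV. J i a * J j b * (\<Sum>k\<in>UNIV. y k * \<Gamma> c i j k p)) * (x a * u b))"
      unfolding Gam by (simp only: distrib_right sum.distrib)
    also have "(\<Sum>a\<in>UNIV. \<Sum>b\<in>UNIV. (\<Sum>k\<in>UNIV. H k a b * y k) * (x a * u b)) = Z"
      unfolding Z_def sum_distrib_right by (simp add: Hsym[of _ _ _] mult_ac)
    finally show ?thesis unfolding sum_bilinear_change X_def U_def .
  qed
  have combine: "(\<Sum>i\<in>UNIV. \<Sum>j\<in>UNIV. (\<kappa> * q i j + b i j - 2 * s i j) * v i * w j)
      = \<kappa> * (\<Sum>i\<in>UNIV. \<Sum>j\<in>UNIV. q i j * (v i * w j)) + (\<Sum>i\<in>UNIV. \<Sum>j\<in>UNIV. b i j * (v i * w j))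
      - 2 * (\<Sum>i\<in>UNIV. \<Sum>j\<in>UNIV. s i j * (v i * w j))" for q b s :: "'n \<Rightarrow> 'n \<Rightarrow> real" and v w
    by (simp add: left_diff_distrib distrib_right sum_subtractf sum.distrib sum_distrib_left mult.assoc)
  have quad: "(\<Sum>i\<in>UNIV. \<Sum>j\<in>UNIV. mre_coeff e i j P * v i * w j)
      = \<kappa> * (\<Sum>i\<in>UNIV. \<Sum>j\<in>UNIV. momentum e i P * momentum e j P * (v i * w j))
      + (\<Sum>i\<in>UNIV. \<Sum>j\<in>UNIV. \<Phi>_coeff e i j p * (v i * w j))
      - 2 * (\<Sum>i\<in>UNIV. \<Sum>j\<in>UNIV. (\<Sum>k\<in>UNIV. momentum e k P * \<Gamma> e i j k p) * (v i * w j))" for e v w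
    unfolding mre_coeff_def p_def mult.assoc[of \<kappa>] by (rule combine)
  have "mre_in_chart A D \<Phi> \<kappa> d P \<xi> \<eta> =
      (\<Sum>a\<in>UNIV. x a * coord_diff (TC d) (Inr a) \<eta>) + (\<Sum>a\<in>UNIV. coord_diff (TC d) (Inr a) \<xi> * u a)
      + (\<Sum>a\<in>UNIV. \<Sum>b\<in>UNIV. mre_coeff d a b P * x a * u b)"
    unfolding mre_in_chart_eq[OF d] x_def u_def by (simp add: sum.distrib)
  \<comment> \<open>Here \<open>T1\<close> and \<open>T2\<close> contribute one \<open>Z\<close>
    each, and \<open>T5\<close> enters with the factor -2.\<close>
  also have "\<dots> = (\<Sum>i\<in>UNIV. X i * u' i) + (\<Sum>i\<in>UNIV. x' i * U i) + (\<Sum>i\<in>UNIV. \<Sum>j\<in>UNIV. mre_coeff c i j P * X i * U j)"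
    unfolding T1 T2 quad yd_def[symmetric] y_def[symmetric]
    using T3 T4 T5 by (simp add: yd_def y_def)
  also have "\<dots> = mre_in_chart A D \<Phi> \<kappa> c P \<xi> \<eta>"
    unfolding mre_in_chart_eq[OF c] XU x'_def u'_def by (simp add: sum.distrib)
  finally show ?thesis .
qed

text \<open>Frees the metric from the chart picked in its definition: on tangent vectors any chart
  around the base point may be used.\<close>

lemma mre_eq:
  assumes c: "c \<in> A" "P \<in> fst (TC c)"
    and \<xi>: "\<xi> \<in> tangent_space TA P" and \<eta>: "\<eta> \<in> tangent_space TA P"
  shows "g P \<xi> \<eta> =
    (\<Sum>i\<in>UNIV. coord_diff (TC c) (Inl i) \<xi> * coord_diff (TC c) (Inr i) \<eta> + coord_diff (TC c) (Inr i) \<xi> * coord_diff (TC c) (Inl i) \<eta>)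
    + (\<Sum>i\<in>UNIV. \<Sum>j\<in>UNIV. mre_coeff c i j P * coord_diff (TC c) (Inl i) \<xi> * coord_diff (TC c) (Inl j) \<eta>)"
proof -
  have p: "fst P \<in> carrier A" using base_point[OF c(2)] in_carrier[OF c(1)] by blast
  have "P \<in> fst (TC (chart_at A (fst P)))"
    using c(2) chart_at(2)[OF p] by (simp add: fst_cotangent_chart)
  from mre_in_chart_change[OF c chart_at(1)[OF p] this \<xi> \<eta>] show ?thesis
    unfolding modified_riemannian_extension_def mre_in_chart_eq[OF c] .
qed

lemma mre_smooth:
  assumes X: "vector_field TA U X" and Y: "vector_field TA U Y"
  shows "smooth_fun TA U (\<lambda>P. g P (X P) (Y P))"
proof (rule T.smooth_fun_local[OF T.vector_field_openin[OF X]])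
  fix P assume P: "P \<in> U"
  then have "P \<in> carrier TA" using T.vector_field_openin[OF X] by (auto simp: T.openin_mtop)
  then obtain c where c: "c \<in> A" "P \<in> fst (TC c)" using T.carrier_chart TA_charts by blast
  note C = TC_in_TA[OF c(1)]
  let ?V = "U \<inter> fst (TC c)"
  have o: "openin (mtop TA) ?V" by (intro openin_Int T.vector_field_openin[OF X] T.openin_chart C)
  have "smooth_fun TA ?V (\<lambda>P.
    (\<Sum>i\<in>UNIV. coord_diff (TC c) (Inl i) (X P) * coord_diff (TC c) (Inr i) (Y P) + coord_diff (TC c) (Inr i) (X P) * coord_diff (TC c) (Inl i) (Y P))
    + (\<Sum>i\<in>UNIV. \<Sum>j\<in>UNIV. mre_coeff c i j P * coord_diff (TC c) (Inl i) (X P) * coord_diff (TC c) (Inl j) (Y P)))"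
    by (intro T.smooth_fun_add T.smooth_fun_mult T.smooth_fun_sum o T.vector_field_component[OF X C]
        T.vector_field_component[OF Y C] T.smooth_fun_subset[OF mre_coeff_smooth[OF c(1)] o Int_lower2])
  then have "smooth_fun TA ?V (\<lambda>P. g P (X P) (Y P))"
    by (rule T.smooth_fun_cong) (use mre_eq[OF c(1)] T.vector_field_tangent[OF X] T.vector_field_tangent[OF Y] in simp)
  then show "\<exists>V. P \<in> V \<and> smooth_fun TA V (\<lambda>P. g P (X P) (Y P))" using P c(2) by blast
qed

lemma mre_symmetric_tensor: "symmetric_tensor_field TA g"
  unfolding symmetric_tensor_field_def
proof (intro conjI ballI allI impI)
  fix P u u' v a
  assume P: "P \<in> carrier TA" and u: "u \<in> tangent_space TA P" and u': "u' \<in> tangent_space TA P" and v: "v \<in> tangent_space TA P"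
  obtain c where c: "c \<in> A" "P \<in> fst (TC c)" using T.carrier_chart[OF P] TA_charts by blast
  note eq = mre_eq[OF c]
  show "g P (\<lambda>f. u f + u' f) v = g P u v + g P u' v"
    unfolding eq[OF T.tangent_space_add[OF u u'] v] eq[OF u v] eq[OF u' v]
    by (simp add: coord_diff_def distrib_left distrib_right sum.distrib)
  show "g P (\<lambda>f. a * u f) v = a * g P u v"
    unfolding eq[OF T.tangent_space_scale[OF u] v] eq[OF u v]
    by (simp add: coord_diff_def distrib_left sum_distrib_left sum.distrib mult_ac)
  have "(\<Sum>i\<in>UNIV. \<Sum>j\<in>UNIV. mre_coeff c i j P * coord_diff (TC c) (Inl i) u * coord_diff (TC c) (Inl j) v)
      = (\<Sum>i\<in>UNIV. \<Sum>j\<in>UNIV. mre_coeff c i j P * coord_diff (TC c) (Inl i) v * coord_diff (TC c) (Inl j) u)"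
    by (subst sum.swap) (simp add: mre_coeff_sym[OF c] mult_ac)
  then show "g P u v = g P v u"
    unfolding eq[OF u v] eq[OF v u] by (simp add: mult.commute add.commute)
qed (auto intro: mre_smooth)

end

section \<open>The Ricci tensor of the modified Riemannian extension\<close>

lemma sum_kronecker:
  fixes f :: "'n::finite \<Rightarrow> real"
  shows "(\<Sum>k\<in>UNIV. (if i = k then 1 else 0) * f k) = f i" "(\<Sum>k\<in>UNIV. (if k = i then 1 else 0) * f k) = f i"
    "(\<Sum>k\<in>UNIV. f k * (if i = k then 1 else 0)) = f i" "(\<Sum>k\<in>UNIV. f k * (if k = i then 1 else 0)) = f i"
  by (simp_all add: if_distrib[of "\<lambda>x. _ * x"] if_distrib[of "\<lambda>x. x * _"] cong: if_cong)

text \<open>The Christoffel symbols of the metric with three unprimed indices turn out to be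
  \<open>\<Gamma>\<^sub>i\<^sub>j\<^sup>k - (c/2)(\<delta>\<^sub>i\<^sub>k x\<^sub>j\<^sub>' + \<delta>\<^sub>j\<^sub>k x\<^sub>i\<^sub>')\<close>.\<close>

definition horizontal_symbol :: "real \<Rightarrow> ('n \<Rightarrow> 'n \<Rightarrow> 'n \<Rightarrow> real) \<Rightarrow> ('n \<Rightarrow> real) \<Rightarrow> 'n \<Rightarrow> 'n \<Rightarrow> 'n \<Rightarrow> real" where
  "horizontal_symbol \<kappa> G y i j k = G i j k - \<kappa> / 2 * ((if i = k then 1 else 0) * y j + (if j = k then 1 else 0) * y i)"

lemma horizontal_symbol_contract:
  fixes y :: "'n::finite \<Rightarrow> real"
  shows "(\<Sum>l\<in>UNIV. horizontal_symbol \<kappa> G y i j l * f l) = (\<Sum>l\<in>UNIV. G i j l * f l) - \<kappa> / 2 * (y j * f i + y i * f j)"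
proof -
  have "horizontal_symbol \<kappa> G y i j l * f l = G i j l * f l
      - \<kappa> / 2 * (y j * ((if i = l then 1 else 0) * f l) + y i * ((if j = l then 1 else 0) * f l))" for l
    by (simp add: horizontal_symbol_def algebra_simps)
  then show ?thesis
    by (simp only: sum_subtractf sum.distrib sum_distrib_left[symmetric] sum_kronecker)
qed

text \<open>The factor n + 1: one Kronecker delta meets \<open>y k\<close> and gives a single
  \<open>y l\<close>, the other is a full trace and gives n copies.\<close>

lemma horizontal_symbol_trace:
  fixes y :: "'n::finite \<Rightarrow> real"
  shows "(\<Sum>k\<in>UNIV. horizontal_symbol \<kappa> G y l k k) = (\<Sum>k\<in>UNIV. G l k k) - \<kappa> / 2 * (real CARD('n) + 1) * y l"
proof -
  have "(\<Sum>k\<in>UNIV. (if l = k then 1 else 0) * y k + (if k = k then 1 else 0) * y l) = (real CARD('n) + 1) * y l"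
    by (simp only: sum.distrib sum_kronecker) (simp add: algebra_simps)
  then show ?thesis
    unfolding horizontal_symbol_def sum_subtractf sum_distrib_left[symmetric] by simp
qed

lemma horizontal_symbol_trace_product:
  fixes y :: "'n::finite \<Rightarrow> real"
  shows "(\<Sum>l\<in>UNIV. horizontal_symbol \<kappa> G y i j l * (\<Sum>k\<in>UNIV. horizontal_symbol \<kappa> G y l k k))
    = (\<Sum>l\<in>UNIV. G i j l * (\<Sum>k\<in>UNIV. G l k k)) - \<kappa> / 2 * (real CARD('n) + 1) * (\<Sum>l\<in>UNIV. G i j l * y l)
      - \<kappa> / 2 * (y j * (\<Sum>k\<in>UNIV. G i k k) + y i * (\<Sum>k\<in>UNIV. G j k k))
      + \<kappa> * \<kappa> / 2 * (real CARD('n) + 1) * (y i * y j)"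
proof -
  have split: "(\<Sum>l\<in>UNIV. G i j l * ((\<Sum>k\<in>UNIV. G l k k) - \<kappa> / 2 * (real CARD('n) + 1) * y l))
      = (\<Sum>l\<in>UNIV. G i j l * (\<Sum>k\<in>UNIV. G l k k)) - \<kappa> / 2 * (real CARD('n) + 1) * (\<Sum>l\<in>UNIV. G i j l * y l)"
    unfolding sum_distrib_left[of "\<kappa> / 2 * (real CARD('n) + 1)"] sum_subtractf[symmetric]
    by (rule sum.cong[OF refl]) (simp only: right_diff_distrib mult.left_commute)
  show ?thesis
    unfolding horizontal_symbol_trace horizontal_symbol_contract split by (simp add: field_simps)
qed

text \<open>The factor n + 3: of the four products of Kronecker deltas one is a full trace,
  contributing n, and the other three contribute 1 each. The mixed products yield single
  contractions and traces of \<open>G\<close>.\<close>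

lemma horizontal_symbol_square:
  fixes y :: "'n::finite \<Rightarrow> real"
  assumes G_sym: "\<And>i j k. G i j k = G j i k"
  shows "(\<Sum>l\<in>UNIV. \<Sum>m\<in>UNIV. horizontal_symbol \<kappa> G y l j m * horizontal_symbol \<kappa> G y i m l)
    = (\<Sum>l\<in>UNIV. \<Sum>m\<in>UNIV. G l j m * G i m l)
      - \<kappa> / 2 * (2 * (\<Sum>l\<in>UNIV. G i j l * y l) + y j * (\<Sum>k\<in>UNIV. G i k k) + y i * (\<Sum>k\<in>UNIV. G j k k))
      + \<kappa> * \<kappa> / 4 * (real CARD('n) + 3) * (y i * y j)"
proof -
  let ?h = "horizontal_symbol \<kappa> G y"
  have "(\<Sum>l\<in>UNIV. \<Sum>m\<in>UNIV. ?h l j m * ?h i m l)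
      = (\<Sum>l\<in>UNIV. \<Sum>m\<in>UNIV. G l j m * ?h i m l) - \<kappa> / 2 * (y j * (\<Sum>l\<in>UNIV. ?h i l l) + (\<Sum>l\<in>UNIV. ?h i j l * y l))"
    unfolding horizontal_symbol_contract[of _ _ _ _ _ "\<lambda>m. ?h i m _"]
    by (simp add: sum_subtractf sum.distrib sum_distrib_left distrib_left mult_ac)
  also have "(\<Sum>l\<in>UNIV. \<Sum>m\<in>UNIV. G l j m * ?h i m l) = (\<Sum>m\<in>UNIV. \<Sum>l\<in>UNIV. ?h i m l * G l j m)"
    by (subst sum.swap) (simp add: mult.commute)
  also have "\<dots> = (\<Sum>m\<in>UNIV. \<Sum>l\<in>UNIV. G i m l * G l j m) - \<kappa> / 2 * ((\<Sum>m\<in>UNIV. G i j m * y m) + y i * (\<Sum>m\<in>UNIV. G m j m))"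
    unfolding horizontal_symbol_contract[of _ _ _ _ _ "\<lambda>l. G l j _"]
    by (simp add: sum_subtractf sum.distrib sum_distrib_left distrib_left mult_ac)
  also have "(\<Sum>m\<in>UNIV. \<Sum>l\<in>UNIV. G i m l * G l j m) = (\<Sum>l\<in>UNIV. \<Sum>m\<in>UNIV. G l j m * G i m l)"
    by (subst sum.swap) (simp add: mult.commute)
  also have "(\<Sum>m\<in>UNIV. G m j m) = (\<Sum>k\<in>UNIV. G j k k)"
    by (simp add: G_sym[of _ j])
  finally have eq: "(\<Sum>l\<in>UNIV. \<Sum>m\<in>UNIV. ?h l j m * ?h i m l) = (\<Sum>l\<in>UNIV. \<Sum>m\<in>UNIV. G l j m * G i m l)
      - \<kappa> / 2 * ((\<Sum>m\<in>UNIV. G i j m * y m) + y i * (\<Sum>k\<in>UNIV. G j k k))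
      - \<kappa> / 2 * (y j * (\<Sum>l\<in>UNIV. ?h i l l) + (\<Sum>l\<in>UNIV. ?h i j l * y l))" .
  show ?thesis
    unfolding eq unfolding horizontal_symbol_trace horizontal_symbol_contract by (simp add: field_simps)
qed

section \<open>Components and inverse matrix of the modified extension\<close>

context modified_extension
begin

abbreviation "y \<equiv> momentum"
abbreviation "B \<equiv> mre_coeff"
abbreviation "E c a P \<equiv> coord_vec TA (TC c) a P"

text \<open>The last block is written through the metric rather than through \<open>B\<close>
  because the argument is a bundle chart, from which the underlying chart of the base is not
  recovered.\<close>

definition mre_inv :: "('m \<times> 'm covec, 'n + 'n) chart \<Rightarrow> 'n + 'n \<Rightarrow> 'n + 'n \<Rightarrow> 'm \<times> 'm covec \<Rightarrow> real" where
  "mre_inv C a b P = (case a of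
      Inl i \<Rightarrow> (case b of Inl j \<Rightarrow> 0 | Inr j \<Rightarrow> if i = j then 1 else 0)
    | Inr i \<Rightarrow> (case b of Inl j \<Rightarrow> if i = j then 1 else 0
        | Inr j \<Rightarrow> - g P (coord_vec TA C (Inl i) P) (coord_vec TA C (Inl j) P)))"

lemma mre_components:
  assumes c: "c \<in> A" "P \<in> fst (TC c)"
  shows "g P (E c (Inl i) P) (E c (Inl j) P) = B c i j P"
    and "g P (E c (Inl i) P) (E c (Inr j) P) = (if i = j then 1 else 0)"
    and "g P (E c (Inr i) P) (E c (Inl j) P) = (if i = j then 1 else 0)"
    and "g P (E c (Inr i) P) (E c (Inr j) P) = 0"
proof -
  note C = TC_in_TA[OF c(1)]
  note eq = mre_eq[OF c T.coord_vec_tangent[OF C c(2)] T.coord_vec_tangent[OF C c(2)]]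
  note cd = T.coord_diff_coord_vec[OF C c(2)]
  have [simp]: "(\<Sum>k\<in>UNIV. \<Sum>l\<in>UNIV. B c k l P * (if i = k then 1 else 0) * (if j = l then 1 else 0)) = B c i j P"
    by (simp only: sum_kronecker mult.assoc) (simp only: sum_distrib_left[symmetric] sum_kronecker mult.commute[of "B c _ _ P"] mult.assoc)
  show "g P (E c (Inl i) P) (E c (Inl j) P) = B c i j P"
    unfolding eq cd by simp
  show "g P (E c (Inl i) P) (E c (Inr j) P) = (if i = j then 1 else 0)"
    "g P (E c (Inr i) P) (E c (Inl j) P) = (if i = j then 1 else 0)"
    "g P (E c (Inr i) P) (E c (Inr j) P) = 0"
    unfolding eq cd by (simp_all add: sum_kronecker)
qed

lemma mre_metric_atlas: "metric_atlas TA g mre_inv"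
proof
  show "symmetric_tensor_field TA g" by (rule mre_symmetric_tensor)
  fix C a b assume C: "C \<in> TA"
  show "smooth_fun TA (fst C) (mre_inv C a b)"
    unfolding mre_inv_def[abs_def]
    by (cases a; cases b)
      (use T.smooth_fun_cmult[OF mre_smooth[OF T.vector_field_coord[OF C] T.vector_field_coord[OF C]], of "-1"] in
        \<open>auto intro: T.smooth_fun_const T.openin_chart[OF C]\<close>)
  fix P assume P: "P \<in> fst C"
  show "mre_inv C a b P = mre_inv C b a P"
    using T.tensor_sym[OF mre_symmetric_tensor T.coord_vec_tangent[OF C P] T.coord_vec_tangent[OF C P]]
    by (auto simp: mre_inv_def split: sum.split)
  obtain c where c: "c \<in> A" and Cc: "C = TC c" using TA_charts[OF C] by blast
  note comp = mre_components[OF c P[unfolded Cc]]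
  show "(\<Sum>d\<in>UNIV. g P (coord_vec TA C a P) (coord_vec TA C d P) * mre_inv C d b P) = (if a = b then 1 else 0)"
    unfolding Cc sum_UNIV_sum
    by (cases a; cases b) (simp_all add: comp mre_inv_def sum_kronecker sum_negf)
qed

end

sublocale modified_extension \<subseteq> M: metric_atlas "cotangent_atlas A" "modified_riemannian_extension A D \<Phi> \<kappa>" mre_inv
  by (rule mre_metric_atlas)

sublocale modified_extension \<subseteq> L: atlas_connection "cotangent_atlas A" "levi_civita (cotangent_atlas A) (modified_riemannian_extension A D \<Phi> \<kappa>)"
  by (rule M.levi_civita_connection)

section \<open>Christoffel symbols of the modified extension\<close>

context modified_extension
begin

abbreviation "chr c \<equiv> M.lc_symbol (TC c)"

text \<open>Here \<open>H\<close> and \<open>S\<close> are the Christoffel symbols of the first kind of the metric: \<open>\<Gamma>\<^sub>i\<^sub>j\<^sub>,\<^sub>k\<^sub>' = H\<^sub>i\<^sub>j\<^sup>k\<close>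
  and \<open>\<Gamma>\<^sub>i\<^sub>j\<^sub>,\<^sub>k = S\<^sub>i\<^sub>j\<^sub>k\<close>.\<close>

definition H :: "('m, 'n) chart \<Rightarrow> 'n \<Rightarrow> 'n \<Rightarrow> 'n \<Rightarrow> 'm \<times> 'm covec \<Rightarrow> real" where
  "H c i j k P = horizontal_symbol \<kappa> (\<lambda>i j k. \<Gamma> c i j k (fst P)) (\<lambda>i. y c i P) i j k"

definition dchr :: "('m, 'n) chart \<Rightarrow> 'n \<Rightarrow> 'n \<Rightarrow> 'n \<Rightarrow> 'n \<Rightarrow> 'm \<Rightarrow> real" where
  "dchr c l i j k p = coord_vec A c l p (\<Gamma> c i j k)"

definition dtensor :: "('m, 'n) chart \<Rightarrow> 'n \<Rightarrow> 'n \<Rightarrow> 'n \<Rightarrow> 'm \<Rightarrow> real" where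
  "dtensor c l i j p = coord_vec A c l p (\<Phi>_coeff c i j)"

definition S :: "('m, 'n) chart \<Rightarrow> 'n \<Rightarrow> 'n \<Rightarrow> 'n \<Rightarrow> 'm \<times> 'm covec \<Rightarrow> real" where
  "S c i j k P = (dtensor c i j k (fst P) + dtensor c j i k (fst P) - dtensor c k i j (fst P)) / 2
     - (\<Sum>m\<in>UNIV. y c m P * (dchr c i j k m (fst P) + dchr c j i k m (fst P) - dchr c k i j m (fst P)))"

lemma H_sym: "c \<in> A \<Longrightarrow> P \<in> fst (TC c) \<Longrightarrow> H c i j k P = H c j i k P"
  using christoffel_sym[of c "fst P" i j k] base_point[of P c] by (simp add: H_def horizontal_symbol_def add.commute)

context
  fixes c P
  assumes c: "c \<in> A" and P: "P \<in> fst (TC c)"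
begin

lemmas C = TC_in_TA[OF c]
lemmas p = base_point[OF P]
lemmas E_tangent = T.coord_vec_tangent[OF C P]

lemma y_smooth_at: "smooth_at TA P (y c i)"
  by (rule T.smooth_atI[OF momentum_smooth[OF c] P])

lemma pull_smooth_at: "smooth_at A (fst P) f \<Longrightarrow> smooth_at TA P (\<lambda>Q. f (fst Q))"
  by (rule smooth_at_pullback[OF T.in_carrier[OF C P]])

lemma \<Gamma>_smooth_at: "smooth_at A (fst P) (\<Gamma> c i j k)"
  by (rule christoffel_smooth_at[OF c p])

lemma \<Phi>_smooth_at: "smooth_at A (fst P) (\<Phi>_coeff c i j)"
  by (rule smooth_atI[OF \<Phi>_coeff_smooth[OF c] p])

lemma dchr_smooth_at: "smooth_at A (fst P) (dchr c l i j k)"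
  unfolding dchr_def[abs_def] by (rule vector_field_smooth_at[OF vector_field_coord[OF c] p \<Gamma>_smooth_at])

lemma dtensor_smooth_at: "smooth_at A (fst P) (dtensor c l i j)"
  unfolding dtensor_def[abs_def] by (rule vector_field_smooth_at[OF vector_field_coord[OF c] p \<Phi>_smooth_at])

lemma tangent_B:
  assumes v: "v \<in> tangent_space TA P"
  shows "v (B c i j) = \<kappa> * (v (y c i) * y c j P + y c i P * v (y c j)) + v (\<lambda>Q. \<Phi>_coeff c i j (fst Q))
    - 2 * (\<Sum>k\<in>UNIV. v (y c k) * \<Gamma> c i j k (fst P) + y c k P * v (\<lambda>Q. \<Gamma> c i j k (fst Q)))"
proof -
  note s = y_smooth_at pull_smooth_at[OF \<Phi>_smooth_at] pull_smooth_at[OF \<Gamma>_smooth_at] T.in_carrier[OF C P]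
  have "v (B c i j) = v (\<lambda>Q. \<kappa> * (y c i Q * y c j Q) + \<Phi>_coeff c i j (fst Q) - 2 * (\<Sum>k\<in>UNIV. y c k Q * \<Gamma> c i j k (fst Q)))"
    unfolding mre_coeff_def[abs_def] mult.assoc ..
  also have "\<dots> = \<kappa> * v (\<lambda>Q. y c i Q * y c j Q) + v (\<lambda>Q. \<Phi>_coeff c i j (fst Q))
      - 2 * (\<Sum>k\<in>UNIV. v (\<lambda>Q. y c k Q * \<Gamma> c i j k (fst Q)))"
    by (simp add: T.tangent_diff[OF v] T.tangent_add[OF v] T.tangent_cmult[OF v] T.tangent_sum[OF v] s
        T.smooth_at_add T.smooth_at_cmult T.smooth_at_mult T.smooth_at_sum)
  finally show ?thesis
    by (simp add: T.tangent_mult[OF v] s)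
qed

text \<open>Origin of the horizontal symbols: differentiating the quadratic term of \<open>B\<close>
  along the fibre gives the two Kronecker terms, and the linear term gives the symbols of the
  base.\<close>

lemma E_B:
  "E c (Inr k) P (B c i j) = - 2 * H c i j k P"
  "E c (Inl l) P (B c i j) = dtensor c l i j (fst P) - 2 * (\<Sum>k\<in>UNIV. y c k P * dchr c l i j k (fst P))"
proof -
  note pb = coord_vec_pullback[OF c P \<Phi>_smooth_at] coord_vec_pullback[OF c P \<Gamma>_smooth_at] coord_vec_momentum[OF c P]
  show "E c (Inr k) P (B c i j) = - 2 * H c i j k P"
    unfolding tangent_B[OF E_tangent] pb H_def horizontal_symbol_def
    by (simp add: sum_kronecker algebra_simps)
  show "E c (Inl l) P (B c i j) = dtensor c l i j (fst P) - 2 * (\<Sum>k\<in>UNIV. y c k P * dchr c l i j k (fst P))"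
    unfolding tangent_B[OF E_tangent] pb dchr_def dtensor_def by simp
qed

lemma tangent_H:
  assumes v: "v \<in> tangent_space TA P"
  shows "v (H c i j k) = v (\<lambda>Q. \<Gamma> c i j k (fst Q))
    - \<kappa> / 2 * ((if i = k then 1 else 0) * v (y c j) + (if j = k then 1 else 0) * v (y c i))"
proof -
  let ?d = "\<lambda>Q. (if i = k then 1 else 0) * y c j Q + (if j = k then 1 else 0) * y c i Q"
  have eq: "H c i j k = (\<lambda>Q. \<Gamma> c i j k (fst Q) + (- \<kappa> / 2) * ?d Q)"
    by (rule ext) (simp add: H_def horizontal_symbol_def)
  note s = T.smooth_at_cmult[OF y_smooth_at]
  note d = T.smooth_at_add[OF s s]
  show ?thesis
    unfolding eq T.tangent_add[OF v pull_smooth_at[OF \<Gamma>_smooth_at] T.smooth_at_cmult[OF d]] T.tangent_cmult[OF v d]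
      T.tangent_add[OF v s s] T.tangent_cmult[OF v y_smooth_at] by simp
qed

lemma E_H:
  "E c (Inr l) P (H c i j k) = - \<kappa> / 2 * ((if i = k then 1 else 0) * (if l = j then 1 else 0)
    + (if j = k then 1 else 0) * (if l = i then 1 else 0))"
  "E c (Inl l) P (H c i j k) = dchr c l i j k (fst P)"
  unfolding tangent_H[OF E_tangent] coord_vec_pullback[OF c P \<Gamma>_smooth_at] coord_vec_momentum[OF c P] dchr_def
  by simp_all

lemma H_smooth_at: "smooth_at TA P (H c i j k)"
proof -
  have "smooth_at TA P (\<lambda>Q. \<Gamma> c i j k (fst Q) + (- \<kappa> / 2) * ((if i = k then 1 else 0) * y c j Q + (if j = k then 1 else 0) * y c i Q))"
    by (intro T.smooth_at_add T.smooth_at_cmult y_smooth_at pull_smooth_at \<Gamma>_smooth_at)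
  then show ?thesis by (simp add: H_def[abs_def] horizontal_symbol_def)
qed

text \<open>The part of \<open>S\<close> built from \<Phi> is constant along the fibres, so no
  derivative of \<Phi> survives a fibre derivative.\<close>

lemma E_S: "E c (Inr l) P (S c i j k) = - (dchr c i j k l (fst P) + dchr c j i k l (fst P) - dchr c k i j l (fst P))"
  and S_smooth_at: "smooth_at TA P (S c i j k)"
proof -
  let ?F = "\<lambda>p. (1/2) * (dtensor c i j k p + dtensor c j i k p + (-1) * dtensor c k i j p)"
  let ?K = "\<lambda>m p. dchr c i j k m p + dchr c j i k m p + (-1) * dchr c k i j m p"
  have sF: "smooth_at A (fst P) ?F" by (intro smooth_at_add smooth_at_cmult dtensor_smooth_at)
  have sK: "smooth_at A (fst P) (?K m)" for m by (intro smooth_at_add smooth_at_cmult dchr_smooth_at)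
  have eq: "S c i j k = (\<lambda>Q. ?F (fst Q) + (-1) * (\<Sum>m\<in>UNIV. y c m Q * ?K m (fst Q)))"
    by (rule ext) (simp add: S_def)
  note s = pull_smooth_at[OF sF] T.smooth_at_mult[OF y_smooth_at pull_smooth_at[OF sK]]
  have sum: "smooth_at TA P (\<lambda>Q. \<Sum>m\<in>UNIV. y c m Q * ?K m (fst Q))"
    by (rule T.smooth_at_sum[OF T.in_carrier[OF C P] s(2)])
  show "smooth_at TA P (S c i j k)"
    unfolding eq by (rule T.smooth_at_add[OF s(1) T.smooth_at_cmult[OF sum]])
  show "E c (Inr l) P (S c i j k) = - (dchr c i j k l (fst P) + dchr c j i k l (fst P) - dchr c k i j l (fst P))"
    unfolding eq T.tangent_add[OF E_tangent s(1) T.smooth_at_cmult[OF sum]] T.tangent_cmult[OF E_tangent sum]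
      T.tangent_sum[OF E_tangent s(2)] T.tangent_mult[OF E_tangent y_smooth_at pull_smooth_at[OF sK]]
      coord_vec_pullback(2)[OF c P sF] coord_vec_pullback(2)[OF c P sK] coord_vec_momentum[OF c P]
    by (simp add: sum_kronecker)
qed

lemma gcomp_eq:
  "M.gcomp (TC c) (Inl i) (Inl j) P = B c i j P"
  "M.gcomp (TC c) (Inl i) (Inr j) P = (if i = j then 1 else 0)"
  "M.gcomp (TC c) (Inr i) (Inl j) P = (if i = j then 1 else 0)"
  "M.gcomp (TC c) (Inr i) (Inr j) P = 0"
  unfolding M.gcomp_def by (rule mre_components[OF c P])+

lemma mre_inv_eq:
  "mre_inv (TC c) (Inl i) (Inl j) P = 0"
  "mre_inv (TC c) (Inl i) (Inr j) P = (if i = j then 1 else 0)"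
  "mre_inv (TC c) (Inr i) (Inl j) P = (if i = j then 1 else 0)"
  "mre_inv (TC c) (Inr i) (Inr j) P = - B c i j P"
  by (simp_all add: mre_inv_def mre_components[OF c P])

end

lemma E_cong:
  assumes "c \<in> A" "P \<in> fst (TC c)" "\<And>Q. Q \<in> fst (TC c) \<Longrightarrow> f Q = h Q"
  shows "E c a P f = E c a P h"
  by (rule T.tangent_cong[OF T.coord_vec_tangent[OF TC_in_TA[OF assms(1)] assms(2)]
      T.openin_chart[OF TC_in_TA[OF assms(1)]] assms(2,3)])

lemma E_const: "c \<in> A \<Longrightarrow> P \<in> fst (TC c) \<Longrightarrow> E c a P (\<lambda>Q. r) = 0"
  by (rule T.tangent_const[OF T.coord_vec_tangent[OF TC_in_TA]])

lemma E_gcomp: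
  assumes "c \<in> A" "P \<in> fst (TC c)"
  shows "E c a P (M.gcomp (TC c) (Inl i) (Inl j)) = E c a P (B c i j)"
    "E c a P (M.gcomp (TC c) (Inl i) (Inr j)) = 0"
    "E c a P (M.gcomp (TC c) (Inr i) (Inl j)) = 0"
    "E c a P (M.gcomp (TC c) (Inr i) (Inr j)) = 0"
proof -
  show "E c a P (M.gcomp (TC c) (Inl i) (Inl j)) = E c a P (B c i j)"
    by (rule E_cong[OF assms gcomp_eq(1)[OF assms(1)]])
  have "E c a P (M.gcomp (TC c) (Inl i) (Inr j)) = E c a P (\<lambda>Q. if i = j then 1 else 0)"
    by (rule E_cong[OF assms gcomp_eq(2)[OF assms(1)]])
  then show "E c a P (M.gcomp (TC c) (Inl i) (Inr j)) = 0" by (simp only: E_const[OF assms])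
  have "E c a P (M.gcomp (TC c) (Inr i) (Inl j)) = E c a P (\<lambda>Q. if i = j then 1 else 0)"
    by (rule E_cong[OF assms gcomp_eq(3)[OF assms(1)]])
  then show "E c a P (M.gcomp (TC c) (Inr i) (Inl j)) = 0" by (simp only: E_const[OF assms])
  have "E c a P (M.gcomp (TC c) (Inr i) (Inr j)) = E c a P (\<lambda>Q. 0)"
    by (rule E_cong[OF assms gcomp_eq(4)[OF assms(1)]])
  then show "E c a P (M.gcomp (TC c) (Inr i) (Inr j)) = 0" by (simp only: E_const[OF assms])
qed

text \<open>Among the metric components only the block \<open>B\<close> varies. Symbols with one
  primed index are therefore halves of its fibre derivatives, up to sign, and those with two or more
  vanish.\<close>

lemma lc_lower_mre:
  assumes "c \<in> A" "P \<in> fst (TC c)"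
  shows "M.lc_lower (TC c) (Inl i) (Inl j) (Inl k) P = S c i j k P"
    "M.lc_lower (TC c) (Inl i) (Inl j) (Inr k) P = H c i j k P"
    "M.lc_lower (TC c) (Inl i) (Inr j) (Inl k) P = - H c i k j P"
    "M.lc_lower (TC c) (Inr i) (Inl j) (Inl k) P = - H c j k i P"
    "M.lc_lower (TC c) (Inl i) (Inr j) (Inr k) P = 0"
    "M.lc_lower (TC c) (Inr i) (Inl j) (Inr k) P = 0"
    "M.lc_lower (TC c) (Inr i) (Inr j) b P = 0"
proof -
  show "M.lc_lower (TC c) (Inl i) (Inl j) (Inl k) P = S c i j k P"
    unfolding M.lc_lower_def E_gcomp[OF assms] E_B[OF assms] S_def
    by (simp add: sum.distrib sum_subtractf distrib_left right_diff_distrib field_simps)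
  show "M.lc_lower (TC c) (Inr i) (Inr j) b P = 0"
    by (cases b) (simp_all add: M.lc_lower_def E_gcomp[OF assms])
qed (simp_all add: M.lc_lower_def E_gcomp[OF assms] E_B[OF assms])

text \<open>Raising with the block inverse interchanges primed and unprimed: an upper unprimed index
  reads the primed lowered symbol, while an upper primed index reads the unprimed one corrected by
  \<open>B\<close>.\<close>

lemma chr_mre:
  assumes "c \<in> A" "P \<in> fst (TC c)"
  shows "chr c (Inl i) (Inl j) (Inl k) P = H c i j k P"
    "chr c (Inl i) (Inl j) (Inr k) P = S c i j k P - (\<Sum>l\<in>UNIV. H c i j l P * B c l k P)"
    "chr c (Inl i) (Inr j) (Inl k) P = 0"
    "chr c (Inl i) (Inr j) (Inr k) P = - H c i k j P"
    "chr c (Inr i) (Inl j) (Inl k) P = 0"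
    "chr c (Inr i) (Inl j) (Inr k) P = - H c j k i P"
    "chr c (Inr i) (Inr j) b P = 0"
proof -
  show "chr c (Inr i) (Inr j) b P = 0"
    by (cases b) (simp_all add: M.lc_symbol_def lc_lower_mre[OF assms])
qed (simp_all add: M.lc_symbol_def sum_UNIV_sum lc_lower_mre[OF assms] mre_inv_eq[OF assms] sum_kronecker sum_negf)

text \<open>For an unprimed \<open>b\<close> the base and fibre directions contribute opposite
  traces of \<open>H\<close>, by its symmetry in the lower indices; for a primed \<open>b\<close>
  every diagonal symbol vanishes.\<close>

lemma chr_trace:
  assumes "c \<in> A" "P \<in> fst (TC c)"
  shows "(\<Sum>a\<in>UNIV. chr c a b a P) = 0"
  by (cases b) (simp_all add: sum_UNIV_sum chr_mre[OF assms] sum_negf H_sym[OF assms, of _ "_ :: 'n"] sum_subtractf[symmetric])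

section \<open>Components of the Ricci tensor\<close>

lemma ricci_coeff_mre:
  assumes "c \<in> A" "P \<in> fst (TC c)"
  shows "L.ricci_coeff (TC c) a b P = (\<Sum>l\<in>UNIV. E c l P (chr c a b l)) - (\<Sum>l\<in>UNIV. \<Sum>m\<in>UNIV. chr c l b m P * chr c a m l P)"
proof -
  note C = TC_in_TA[OF assms(1)]
  have christoffel_eq: "christoffel TA (levi_civita TA g) (TC c) a b k Q = chr c a b k Q" if "Q \<in> fst (TC c)" for a b k Q
    by (rule M.christoffel_levi_civita[OF C that])
  have E_christoffel: "E c l P (christoffel TA (levi_civita TA g) (TC c) a b k) = E c l P (chr c a b k)" for l a b k
    by (rule E_cong[OF assms christoffel_eq])
  \<comment> \<open>The trace vanishes on the whole chart domain, so its derivatives vanish as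
    well.\<close>
  have tr: "(\<Sum>l\<in>UNIV. E c a P (chr c l b l)) = 0" for a b
  proof -
    have "(\<Sum>l\<in>UNIV. E c a P (chr c l b l)) = E c a P (\<lambda>Q. \<Sum>l\<in>UNIV. chr c l b l Q)"
      by (rule T.tangent_sum[OF T.coord_vec_tangent[OF C assms(2)] T.smooth_atI[OF M.lc_symbol_smooth[OF C] assms(2)], symmetric])
    also have "\<dots> = E c a P (\<lambda>Q. 0)" by (rule E_cong[OF assms chr_trace[OF assms(1)]])
    finally show ?thesis by (simp add: E_const[OF assms])
  qed
  have "(\<Sum>l\<in>UNIV. \<Sum>m\<in>UNIV. chr c a b m P * chr c l m l P) = 0"
    by (subst sum.swap) (simp add: sum_distrib_left[symmetric] chr_trace[OF assms])
  then show ?thesis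
    unfolding L.ricci_coeff_def L.curv_coeff_def E_christoffel christoffel_eq[OF assms(2)] by (simp add: sum.distrib sum_subtractf tr)
qed

text \<open>All quadratic terms vanish because a symbol with a primed lower index and an unprimed
  upper index is 0. In the mixed components only the fibre divergence of \<open>H\<close> is left,
  and its two Kronecker terms sum to n + 1.\<close>

lemma ricci_mre_vertical:
  assumes "c \<in> A" "P \<in> fst (TC c)"
  shows "L.ricci_coeff (TC c) (Inr i) (Inr j) P = 0"
    "L.ricci_coeff (TC c) (Inl i) (Inr j) P = \<kappa> * (real CARD('n) + 1) / 2 * (if i = j then 1 else 0)"
    "L.ricci_coeff (TC c) (Inr i) (Inl j) P = \<kappa> * (real CARD('n) + 1) / 2 * (if i = j then 1 else 0)"
proof -
  have sE: "E c a P (chr c (Inl i) (Inr j) (Inl k)) = E c a P (\<lambda>Q. 0)"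
    "E c a P (chr c (Inl i) (Inr j) (Inr k)) = E c a P (\<lambda>Q. - H c i k j Q)"
    "E c a P (chr c (Inr i) (Inl j) (Inl k)) = E c a P (\<lambda>Q. 0)"
    "E c a P (chr c (Inr i) (Inl j) (Inr k)) = E c a P (\<lambda>Q. - H c j k i Q)"
    "E c a P (chr c (Inr i) (Inr j) b) = E c a P (\<lambda>Q. 0)" for a b i j k
    by (rule E_cong[OF assms chr_mre(3)[OF assms(1)]] E_cong[OF assms chr_mre(4)[OF assms(1)]]
        E_cong[OF assms chr_mre(5)[OF assms(1)]] E_cong[OF assms chr_mre(6)[OF assms(1)]]
        E_cong[OF assms chr_mre(7)[OF assms(1)]]; assumption)+
  note s = chr_mre[OF assms] sE E_const[OF assms]
  have E_neg: "E c a P (\<lambda>Q. - H c i k j Q) = - E c a P (H c i k j)" for a i j k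
    using T.tangent_cmult[OF E_tangent[OF assms] H_smooth_at[OF assms], of a "-1"] by simp
  have tr: "(\<Sum>k\<in>UNIV. - E c (Inr k) P (H c i k j)) = \<kappa> * (real CARD('n) + 1) / 2 * (if i = j then 1 else 0)" for i j
  proof -
    have "- E c (Inr k) P (H c i k j) = \<kappa> / 2 * ((if i = j then 1 else 0) + (if k = j then 1 else 0) * (if k = i then 1 else 0))" for k
      unfolding E_H[OF assms] by (simp add: algebra_simps)
    then show ?thesis
      by (simp only: sum_distrib_left[symmetric] sum.distrib sum_kronecker) (simp add: algebra_simps)
  qed
  show "L.ricci_coeff (TC c) (Inr i) (Inr j) P = 0"
    unfolding ricci_coeff_mre[OF assms] sum_UNIV_sum by (simp add: s)
  show "L.ricci_coeff (TC c) (Inl i) (Inr j) P = \<kappa> * (real CARD('n) + 1) / 2 * (if i = j then 1 else 0)"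
    unfolding ricci_coeff_mre[OF assms] sum_UNIV_sum tr[symmetric] by (simp add: s E_neg)
  show "L.ricci_coeff (TC c) (Inr i) (Inl j) P = \<kappa> * (real CARD('n) + 1) / 2 * (if i = j then 1 else 0)"
    unfolding ricci_coeff_mre[OF assms] sum_UNIV_sum eq_commute[of i j] tr[symmetric] by (simp add: s E_neg)
qed

text \<open>The divergence over the base gives derivatives of the base symbols. The divergence over
  the fibre gives further such derivatives, the term \<kappa> \<open>B\<close> and a product of
  \<open>H\<close> with its trace. The powers of the fibre coordinates then assemble into a multiple
  of \<open>B\<close>.\<close>

lemma ricci_mre_horizontal:
  assumes "c \<in> A" "P \<in> fst (TC c)"
  shows "L.ricci_coeff (TC c) (Inl i) (Inl j) P = \<kappa> * (real CARD('n) + 1) / 2 * B c i j P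
    + (ricci_coeff c i j (fst P) + ricci_coeff c j i (fst P) - \<kappa> * (real CARD('n) - 1) / 2 * \<Phi>_coeff c i j (fst P))"
proof -
  define G where "G = (\<lambda>i j k. \<Gamma> c i j k (fst P))"
  define w where "w = (\<lambda>i. y c i P)"
  define T where "T = (\<lambda>i. \<Sum>k\<in>UNIV. G i k k)"
  define dG where "dG = (\<lambda>l i j k. dchr c l i j k (fst P))"
  have p: "fst P \<in> fst c" by (rule base_point[OF assms(2)])
  have Gsym: "G i j k = G j i k" for i j k
    unfolding G_def by (rule christoffel_sym[OF assms(1) p])
  have dGsym: "dG l i j k = dG l j i k" for l i j k
    unfolding dG_def dchr_def
    by (rule tangent_cong[OF coord_vec_tangent[OF assms(1) p] openin_chart[OF assms(1)] p christoffel_sym[OF assms(1)]])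
  have H: "H c i j k P = horizontal_symbol \<kappa> G w i j k" for i j k
    by (simp add: H_def G_def w_def)
  have BG: "B c i j P = \<kappa> * (w i * w j) + \<Phi>_coeff c i j (fst P) - 2 * (\<Sum>k\<in>UNIV. G i j k * w k)"
    by (simp add: mre_coeff_def w_def G_def mult_ac)
  have ric: "ricci_coeff c i j (fst P) = (\<Sum>k\<in>UNIV. dG k i j k) - (\<Sum>k\<in>UNIV. dG i j k k)
      + (\<Sum>l\<in>UNIV. G i j l * T l) - (\<Sum>l\<in>UNIV. \<Sum>m\<in>UNIV. G l j m * G i m l)" for i j
  proof -
    have *: "(\<Sum>l\<in>UNIV. \<Sum>m\<in>UNIV. G i j m * G l m l) = (\<Sum>m\<in>UNIV. G i j m * T m)"
      unfolding T_def by (subst sum.swap) (simp add: sum_distrib_left Gsym[of _ _ "_"])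
    have "ricci_coeff c i j (fst P) = (\<Sum>l\<in>UNIV. dG l i j l - dG i l j l + (\<Sum>m\<in>UNIV. G i j m * G l m l - G l j m * G i m l))"
      by (simp add: ricci_coeff_def curv_coeff_def dG_def dchr_def G_def)
    then show ?thesis
      by (simp add: sum.distrib sum_subtractf dGsym[of i _ j] *)
  qed
  have E1: "(\<Sum>k\<in>UNIV. E c (Inl k) P (chr c (Inl i) (Inl j) (Inl k))) = (\<Sum>k\<in>UNIV. dG k i j k)"
  proof (rule sum.cong[OF refl])
    fix k
    have "E c (Inl k) P (chr c (Inl i) (Inl j) (Inl k)) = E c (Inl k) P (H c i j k)"
      by (rule E_cong[OF assms chr_mre(1)[OF assms(1)]])
    then show "E c (Inl k) P (chr c (Inl i) (Inl j) (Inl k)) = dG k i j k"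
      unfolding E_H[OF assms] dG_def .
  qed
  \<comment> \<open>The product rule for \<open>H\<close> times \<open>B\<close>: the derivative of
    \<open>H\<close> yields the Kronecker terms, and that of \<open>B\<close> is
    \<open>-2 * H\<close>, hence the quadratic term with coefficient +2.\<close>
  have E2: "E c (Inr k) P (chr c (Inl i) (Inl j) (Inr k)) = dG k i j k - dG i j k k - dG j i k k
      + \<kappa> / 2 * (\<Sum>l\<in>UNIV. ((if i = l then 1 else 0) * (if k = j then 1 else 0) + (if j = l then 1 else 0) * (if k = i then 1 else 0)) * B c l k P)
      + 2 * (\<Sum>l\<in>UNIV. H c i j l P * H c l k k P)" for k
  proof -
    note t = E_tangent[OF assms, of "Inr k"]
    have Bs: "smooth_at TA P (B c l k)" for l k by (rule T.smooth_atI[OF mre_coeff_smooth[OF assms(1)] assms(2)])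
    note HB = T.smooth_at_mult[OF H_smooth_at[OF assms] Bs]
    have "E c (Inr k) P (chr c (Inl i) (Inl j) (Inr k)) = E c (Inr k) P (\<lambda>Q. S c i j k Q - (\<Sum>l\<in>UNIV. H c i j l Q * B c l k Q))"
      by (rule E_cong[OF assms chr_mre(2)[OF assms(1)]])
    also have "\<dots> = E c (Inr k) P (S c i j k) - (\<Sum>l\<in>UNIV. E c (Inr k) P (\<lambda>Q. H c i j l Q * B c l k Q))"
      unfolding T.tangent_diff[OF t S_smooth_at[OF assms] T.smooth_at_sum[OF T.in_carrier[OF TC_in_TA[OF assms(1)] assms(2)] HB]]
        T.tangent_sum[OF t HB] ..
    also have "\<dots> = E c (Inr k) P (S c i j k) - (\<Sum>l\<in>UNIV. E c (Inr k) P (H c i j l) * B c l k P + H c i j l P * (- 2 * H c l k k P))"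
      unfolding T.tangent_mult[OF t H_smooth_at[OF assms] Bs] E_B[OF assms] ..
    finally show ?thesis
      unfolding E_S[OF assms] E_H[OF assms] dG_def
      by (simp add: sum.distrib sum_distrib_left sum_subtractf sum_negf mult_ac)
  qed
  \<comment> \<open>The two Kronecker terms pick out \<open>B c i j P\<close> and
    \<open>B c j i P\<close>, so \<kappa> / 2 becomes the full term \<kappa>
    \<open>B\<close>.\<close>
  have delta: "(\<Sum>k\<in>UNIV. \<Sum>l\<in>UNIV. ((if i = l then 1 else 0) * (if k = j then 1 else 0) + (if j = l then 1 else 0) * (if k = i then 1 else 0)) * B c l k P)
      = 2 * B c i j P"
    by (simp only: distrib_right sum.distrib mult.assoc sum_kronecker) (simp add: mre_coeff_sym[OF assms, of j i])
  have E2s: "(\<Sum>k\<in>UNIV. E c (Inr k) P (chr c (Inl i) (Inl j) (Inr k)))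
      = (\<Sum>k\<in>UNIV. dG k i j k) - (\<Sum>k\<in>UNIV. dG i j k k) - (\<Sum>k\<in>UNIV. dG j i k k) + \<kappa> * B c i j P
        + 2 * (\<Sum>l\<in>UNIV. H c i j l P * (\<Sum>k\<in>UNIV. H c l k k P))"
  proof -
    have "(\<Sum>k\<in>UNIV. \<Sum>l\<in>UNIV. H c i j l P * H c l k k P) = (\<Sum>l\<in>UNIV. H c i j l P * (\<Sum>k\<in>UNIV. H c l k k P))"
      by (subst sum.swap) (simp add: sum_distrib_left)
    then show ?thesis
      unfolding E2 sum.distrib sum_subtractf sum_distrib_left[symmetric] delta by simp
  qed
  \<comment> \<open>Products containing \<open>S\<close> drop out, since their other factor has a
    primed lower and an unprimed upper index. The purely horizontal and the purely vertical index
    pairs give the same sum, hence the factor 2.\<close>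
  have Q: "(\<Sum>l\<in>UNIV. \<Sum>m\<in>UNIV. chr c l (Inl j) m P * chr c (Inl i) m l P) = 2 * (\<Sum>l\<in>UNIV. \<Sum>m\<in>UNIV. H c l j m P * H c i m l P)"
  proof -
    have "(\<Sum>l\<in>UNIV. \<Sum>m\<in>UNIV. H c j m l P * H c i l m P) = (\<Sum>l\<in>UNIV. \<Sum>m\<in>UNIV. H c l j m P * H c i m l P)"
      by (subst sum.swap) (simp add: H_sym[OF assms, of j])
    then show ?thesis
      unfolding sum_UNIV_sum chr_mre[OF assms] by simp
  qed
  \<comment> \<open>Identifies the quadratic term of \<open>ricci_coeff c j i\<close> with that of
    \<open>ricci_coeff c i j\<close>.\<close>
  have sq: "(\<Sum>l\<in>UNIV. \<Sum>m\<in>UNIV. G l i m * G j m l) = (\<Sum>l\<in>UNIV. \<Sum>m\<in>UNIV. G l j m * G i m l)"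
    by (subst sum.swap) (simp add: Gsym[of _ i] Gsym[of _ j] mult.commute)
  have "L.ricci_coeff (TC c) (Inl i) (Inl j) P = (\<Sum>k\<in>UNIV. dG k i j k)
      + ((\<Sum>k\<in>UNIV. dG k i j k) - (\<Sum>k\<in>UNIV. dG i j k k) - (\<Sum>k\<in>UNIV. dG j i k k) + \<kappa> * B c i j P
        + 2 * (\<Sum>l\<in>UNIV. H c i j l P * (\<Sum>k\<in>UNIV. H c l k k P)))
      - 2 * (\<Sum>l\<in>UNIV. \<Sum>m\<in>UNIV. H c l j m P * H c i m l P)"
    unfolding ricci_coeff_mre[OF assms] Q unfolding sum_UNIV_sum E1 E2s ..
  \<comment> \<open>The coefficient of \<open>w i * w j\<close> is \<kappa>^2 ((n + 1) - (n + 3) / 2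
    + 1) = \<kappa>^2 (n + 1) / 2. That of the contraction of \<open>G\<close> with \<open>w\<close>
    is - \<kappa> (n + 1) + 2 \<kappa> - 2 \<kappa> = - \<kappa> (n + 1). Both match \<kappa> (n +
    1) / 2 times \<open>B\<close>; the products of \<open>w\<close> with traces of \<open>G\<close>
    cancel.\<close>
  also have "\<dots> = \<kappa> * (real CARD('n) + 1) / 2 * B c i j P
    + (ricci_coeff c i j (fst P) + ricci_coeff c j i (fst P) - \<kappa> * (real CARD('n) - 1) / 2 * \<Phi>_coeff c i j (fst P))"
    unfolding H horizontal_symbol_trace_product horizontal_symbol_square[of G, OF Gsym] ric T_def sq BG
    using Gsym[of j i] dGsym[of _ j i] by (simp add: field_simps)
  finally show ?thesis .
qed

end

section \<open>The Einstein condition\<close>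

lemma matrix_inv_eqI:
  fixes G K :: "real ^ 'n ^ 'n"
  assumes "G ** K = mat 1"
  shows "matrix_inv G = K"
proof -
  have K: "K ** G = mat 1" using assms by (simp add: matrix_left_right_inverse)
  have "G ** matrix_inv G = mat 1 \<and> matrix_inv G ** G = mat 1"
    unfolding matrix_inv_def by (rule someI_ex) (use assms K in blast)
  then have "matrix_inv G = (K ** G) ** matrix_inv G" by (simp add: K)
  also have "\<dots> = K" using \<open>G ** matrix_inv G = mat 1 \<and> _\<close> by (simp add: matrix_mul_assoc[symmetric])
  finally show ?thesis .
qed

context atlas_connection
begin

lemma ricci_coord_vec:
  assumes "c \<in> A" "p \<in> fst c"
  shows "ricci A D p (coord_vec A c i p) (coord_vec A c j p) = ricci_coeff c i j p"
  unfolding ricci_component[OF coord_vec_tangent[OF assms] coord_vec_tangent[OF assms] assms]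
    coord_diff_coord_vec[OF assms]
  by (simp only: mult.assoc sum_distrib_left[symmetric] sum_kronecker)

lemma ricci_sym_component:
  assumes u: "u \<in> tangent_space A p" and v: "v \<in> tangent_space A p" and c: "c \<in> A" "p \<in> fst c"
  shows "ricci_sym A D p u v = (\<Sum>i\<in>UNIV. \<Sum>j\<in>UNIV. coord_diff c i u * coord_diff c j v
    * ((ricci_coeff c i j p + ricci_coeff c j i p) / 2))"
proof -
  have "ricci A D p v u = (\<Sum>i\<in>UNIV. \<Sum>j\<in>UNIV. coord_diff c i u * coord_diff c j v * ricci_coeff c j i p)"
    unfolding ricci_component[OF v u c] by (subst sum.swap) (simp add: mult_ac)
  then show ?thesis
    unfolding ricci_sym_def ricci_component[OF u v c]
    by (simp add: sum.distrib[symmetric] sum_divide_distrib distrib_left add_divide_distrib)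
qed

end

context modified_extension
begin

definition einstein_const :: real where
  "einstein_const = \<kappa> * (real CARD('n) + 1) / 2"

text \<open>A function on the base: the dependence of the Ricci components on the fibre coordinates
  is absorbed by the multiple of the metric.\<close>

definition defect :: "('m, 'n) chart \<Rightarrow> 'n \<Rightarrow> 'n \<Rightarrow> 'm \<Rightarrow> real" where
  "defect c i j p = ricci_coeff c i j p + ricci_coeff c j i p - \<kappa> * (real CARD('n) - 1) / 2 * \<Phi>_coeff c i j p"

lemma ricci_coeff_mre_gcomp:
  assumes "c \<in> A" "P \<in> fst (TC c)"
  shows "L.ricci_coeff (TC c) a b P = einstein_const * M.gcomp (TC c) a b P
    + (case a of Inl i \<Rightarrow> (case b of Inl j \<Rightarrow> defect c i j (fst P) | Inr j \<Rightarrow> 0) | Inr i \<Rightarrow> 0)"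
  by (cases a; cases b)
    (simp_all add: ricci_mre_vertical[OF assms] ricci_mre_horizontal[OF assms] gcomp_eq[OF assms]
      einstein_const_def defect_def)

lemma scalar_curvature_mre:
  assumes P: "P \<in> carrier TA"
  shows "scalar_curvature TA g P = einstein_const * real CARD('n + 'n)"
proof -
  define C where "C = chart_at TA P"
  have C: "C \<in> TA" "P \<in> fst C" using T.chart_at[OF P] by (simp_all add: C_def)
  obtain c where c: "c \<in> A" and Cc: "C = TC c" using TA_charts[OF C(1)] by blast
  have Pc: "P \<in> fst (TC c)" using C Cc by simp
  let ?G = "(\<chi> a b. g P (coord_vec TA C a P) (coord_vec TA C b P)) :: real ^ ('n + 'n) ^ ('n + 'n)"
  have "?G ** (\<chi> a b. mre_inv C a b P) = mat 1"
    using M.gcomp_ginv[OF C] by (simp add: matrix_matrix_mult_def mat_def vec_eq_iff M.gcomp_def)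
  then have inv: "matrix_inv ?G $ a $ b = mre_inv C a b P" for a b
    by (simp add: matrix_inv_eqI)
  have "scalar_curvature TA g P = (\<Sum>a\<in>UNIV. \<Sum>b\<in>UNIV. matrix_inv ?G $ a $ b
      * metric_ricci TA g P (coord_vec TA C a P) (coord_vec TA C b P))"
    unfolding scalar_curvature_def Let_def C_def ..
  also have "\<dots> = (\<Sum>a\<in>UNIV. \<Sum>b\<in>UNIV. mre_inv C a b P * L.ricci_coeff C a b P)"
    unfolding inv metric_ricci_def L.ricci_coord_vec[OF C] ..
  \<comment> \<open>Only the two mixed blocks contribute, equally: the horizontal Ricci components
    meet the zero block of the inverse, and the vertical ones vanish.\<close>
  also have "\<dots> = 2 * (\<Sum>i\<in>(UNIV :: 'n set). \<Sum>j\<in>UNIV. (if i = j then 1 else 0) * (einstein_const * (if i = j then 1 else 0)))"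
    unfolding Cc by (simp add: sum_UNIV_sum mre_inv_eq[OF c Pc] ricci_mre_vertical[OF c Pc] einstein_const_def sum.distrib)
  also have "\<dots> = einstein_const * real CARD('n + 'n)"
    by (simp only: sum_kronecker) simp
  finally show ?thesis .
qed

lemma einstein_iff_defect:
  "einstein TA g \<longleftrightarrow> (\<forall>c\<in>A. \<forall>p\<in>fst c. \<forall>i j. defect c i j p = 0)"
proof
  assume e: "einstein TA g"
  show "\<forall>c\<in>A. \<forall>p\<in>fst c. \<forall>i j. defect c i j p = 0"
  proof (intro ballI allI)
    fix c p i j assume c: "c \<in> A" and p: "p \<in> fst c"
    \<comment> \<open>The defect depends on the base point alone, so any covector over
      \<open>p\<close> can be used; the zero covector is always available.\<close>
    let ?P = "(p, \<lambda>v. 0) :: 'm \<times> 'm covec"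
    have P: "?P \<in> fst (TC c)" using p zero_covector by (simp add: fst_cotangent_chart)
    note Pc = T.in_carrier[OF TC_in_TA[OF c] P]
    note t = T.coord_vec_tangent[OF TC_in_TA[OF c] P]
    have "metric_ricci TA g ?P (E c (Inl i) ?P) (E c (Inl j) ?P)
        = scalar_curvature TA g ?P / real CARD('n + 'n) * g ?P (E c (Inl i) ?P) (E c (Inl j) ?P)"
      using e Pc t unfolding einstein_def by blast
    then have "L.ricci_coeff (TC c) (Inl i) (Inl j) ?P = einstein_const * M.gcomp (TC c) (Inl i) (Inl j) ?P"
      unfolding metric_ricci_def L.ricci_coord_vec[OF TC_in_TA[OF c] P] scalar_curvature_mre[OF Pc] M.gcomp_def by simp
    then show "defect c i j p = 0"
      unfolding ricci_coeff_mre_gcomp[OF c P] by simp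
  qed
next
  assume d: "\<forall>c\<in>A. \<forall>p\<in>fst c. \<forall>i j. defect c i j p = 0"
  show "einstein TA g"
    unfolding einstein_def
  proof (intro conjI ballI)
    show "pseudo_riemannian_metric TA g" by (rule M.metric_pseudo_riemannian)
    fix P u v assume P: "P \<in> carrier TA" and u: "u \<in> tangent_space TA P" and v: "v \<in> tangent_space TA P"
    obtain c where c: "c \<in> A" "P \<in> fst (TC c)" using T.carrier_chart[OF P] TA_charts by blast
    have "L.ricci_coeff (TC c) a b P = einstein_const * M.gcomp (TC c) a b P" for a b
      using d c base_point[OF c(2)] unfolding ricci_coeff_mre_gcomp[OF c] by (auto split: sum.split)
    then have "metric_ricci TA g P u v = einstein_const * g P u v"
      unfolding metric_ricci_def L.ricci_component[OF u v TC_in_TA[OF c(1)] c(2)]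
        T.tensor_expand[OF mre_symmetric_tensor u v TC_in_TA[OF c(1)] c(2)] M.gcomp_def
      by (simp add: sum_distrib_left mult_ac)
    then show "metric_ricci TA g P u v = scalar_curvature TA g P / real CARD('n + 'n) * g P u v"
      unfolding scalar_curvature_mre[OF P] by simp
  qed
qed

lemma tensor_iff_defect:
  assumes n: "CARD('n) \<ge> 2" and \<kappa>: "\<kappa> \<noteq> 0"
  shows "(\<forall>p\<in>carrier A. \<forall>u\<in>tangent_space A p. \<forall>v\<in>tangent_space A p.
      \<Phi> p u v = 4 / (\<kappa> * (real CARD('n) - 1)) * ricci_sym A D p u v)
    \<longleftrightarrow> (\<forall>c\<in>A. \<forall>p\<in>fst c. \<forall>i j. defect c i j p = 0)"
    (is "?lhs \<longleftrightarrow> ?rhs")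
proof -
  have n0: "real CARD('n) - 1 \<noteq> 0" using n by linarith
  \<comment> \<open>Since n is at least 2 and \<kappa> is nonzero, the equation can be solved for
    \<Phi>. One factor 2 of the 4 inverts \<kappa> (n - 1) / 2, the other compensates the 1/2 in the
    symmetrisation.\<close>
  have zero_iff: "defect c i j p = 0 \<longleftrightarrow>
      \<Phi>_coeff c i j p = 4 / (\<kappa> * (real CARD('n) - 1)) * ((ricci_coeff c i j p + ricci_coeff c j i p) / 2)" for c i j p
    unfolding defect_def using n0 \<kappa> by (simp add: field_simps) argo
  show ?thesis
  proof
    assume ?lhs
    show ?rhs
    proof (intro ballI allI)
      fix c p i j assume c: "c \<in> A" and p: "p \<in> fst c"
      note t = coord_vec_tangent[OF c p]
      have "\<Phi>_coeff c i j p = 4 / (\<kappa> * (real CARD('n) - 1)) * ricci_sym A D p (coord_vec A c i p) (coord_vec A c j p)"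
        unfolding \<Phi>_coeff_def using \<open>?lhs\<close> in_carrier[OF c p] t by blast
      then show "defect c i j p = 0"
        unfolding zero_iff ricci_sym_def ricci_coord_vec[OF c p] .
    qed
  next
    assume d: ?rhs
    show ?lhs
    proof (intro ballI)
      fix p u v assume p: "p \<in> carrier A" and u: "u \<in> tangent_space A p" and v: "v \<in> tangent_space A p"
      obtain c where c: "c \<in> A" "p \<in> fst c" using carrier_chart[OF p] by blast
      have e: "\<Phi>_coeff c i j p = 4 / (\<kappa> * (real CARD('n) - 1)) * ((ricci_coeff c i j p + ricci_coeff c j i p) / 2)" for i j
        using d c unfolding zero_iff by blast
      have "\<Phi> p u v = (\<Sum>i\<in>UNIV. \<Sum>j\<in>UNIV. coord_diff c i u * coord_diff c j v * \<Phi>_coeff c i j p)"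
        unfolding \<Phi>_coeff_def by (rule tensor_expand[OF \<Phi> u v c])
      then show "\<Phi> p u v = 4 / (\<kappa> * (real CARD('n) - 1)) * ricci_sym A D p u v"
        unfolding ricci_sym_component[OF u v c] e sum_distrib_left by (simp only: mult.left_commute)
    qed
  qed
qed

end

theorem theorem2p1:
  fixes A :: "('m, 'n::finite) chart set"
    and D :: "('m \<Rightarrow> 'm tvec) \<Rightarrow> ('m \<Rightarrow> 'm tvec) \<Rightarrow> 'm \<Rightarrow> 'm tvec"
    and \<Phi> :: "'m \<Rightarrow> 'm tvec \<Rightarrow> 'm tvec \<Rightarrow> real"
    and c :: real
  assumes "affine_manifold A D"
    and "CARD('n) \<ge> 2"
    and "symmetric_tensor_field A \<Phi>"
    and "c \<noteq> 0"
  shows "einstein (cotangent_atlas A) (modified_riemannian_extension A D \<Phi> c) \<longleftrightarrow>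
    (\<forall>p\<in>carrier A. \<forall>u\<in>tangent_space A p. \<forall>v\<in>tangent_space A p.
       \<Phi> p u v = 4 / (c * (real CARD('n) - 1)) * ricci_sym A D p u v)"
proof -
  interpret smooth_atlas A
    using assms(1) by (intro smooth_manifold_atlas) (simp add: affine_manifold_def)
  interpret modified_extension A D \<Phi> c
    by unfold_locales (use assms in \<open>simp_all add: affine_manifold_def\<close>)
  show ?thesis
    unfolding einstein_iff_defect tensor_iff_defect[OF assms(2,4)] ..
qed

end
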